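(* Let $\mathcal{C}$ be the monoidal category of finite dimensional complex $\mathfrak{sl}_2$-modules, and let $\mathcal{Y}$ be an admissible (locally finitary) simple transitive $\mathcal{C}$-module category of type $D_\infty$. Then $\mathcal{Y}$ is a semi-simple category.
   Context: Everything is over $\mathbb{C}$. $\mathcal{C}$ is the monoidal category (under $\otimes_{\mathbb{C}}$) of finite dimensional $\mathfrak{sl}_2$-modules; $L(1)$ is the simple module of dimension $2$. A $\mathcal{C}$-module category $\mathcal{M}$ is locally finitary if it is $\mathbb{C}$-linear, additive, idempotent split, Krull-Schmidt, has at most countably many indecomposable objects up to isomorphism, and has finite dimensional hom-spaces. It is simple transitive if it has no non-trivial $\mathcal{C}$-invariant ideals (ideals other than $0$ and $\mathcal{M}$). It is of type $D_\infty$ if its indecomposables, up to isomorphism, can be listed without repetition as $Y_0,Y_1,Y_2,\dots$ so that $L(1)\cdot Y_0\cong L(1)\cdot Y_1\cong Y_2$, $L(1)\cdot Y_2\cong Y_0\oplus Y_1\oplus Y_3$, and $L(1)\cdot Y_i\cong Y_{i-1}\oplus Y_{i+1}$ for $i\geq 3$. Semi-simple means that the radical of the category is zero. The projective abelianization $\overline{\mathcal{M}}$ has as objects diagrams $X\to Y$ over $\mathcal{M}$ and as morphisms commutative squares modulo those whose component $Y\to Y'$ factors through $X'\to Y'$. $\mathcal{M}$ is called admissible if it has weak kernels; equivalently, $\overline{\mathcal{M}}$ is abelian, with $\mathcal{M}$ embedded, via $P\mapsto (0\to P)$, as the category of projective objects. *)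

theory Defs
  imports "Jordan_Normal_Form.VS_Connect" "HOL-Library.Countable_Set"
begin

section \<open>Complex linear categories\<close>

record ('o, 'm) lin_cat =
  Obj :: "'o set"
  Arr :: "'m set"
  Dom :: "'m \<Rightarrow> 'o"
  Cod :: "'m \<Rightarrow> 'o"
  Ide :: "'o \<Rightarrow> 'm"
  Comp :: "'m \<Rightarrow> 'm \<Rightarrow> 'm"  (infixl "\<cdot>\<index>" 70)  \<comment> \<open>\<open>g \<cdot> f\<close> is \<open>g\<close> after \<open>f\<close>\<close>
  Zero :: "'o \<Rightarrow> 'o \<Rightarrow> 'm"
  Add :: "'m \<Rightarrow> 'm \<Rightarrow> 'm"
  Scale :: "complex \<Rightarrow> 'm \<Rightarrow> 'm"

definition Hom :: "('o, 'm, 'z) lin_cat_scheme \<Rightarrow> 'o \<Rightarrow> 'o \<Rightarrow> 'm set"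
  where "Hom M X Y = {f \<in> Arr M. Dom M f = X \<and> Cod M f = Y}"

text \<open>The multiplicative fields of the \<open>module\<close> record play no role in \<open>vectorspace\<close>.\<close>

definition hom_space :: "('o, 'm, 'z) lin_cat_scheme \<Rightarrow> 'o \<Rightarrow> 'o \<Rightarrow> (complex, 'm) module"
  where "hom_space M X Y =
    \<lparr>carrier = Hom M X Y, mult = undefined, one = undefined,
     zero = Zero M X Y, add = Add M, smult = Scale M\<rparr>"

definition end_ring :: "('o, 'm, 'z) lin_cat_scheme \<Rightarrow> 'o \<Rightarrow> 'm ring"
  where "end_ring M X =
    \<lparr>carrier = Hom M X X, mult = Comp M, one = Ide M X, zero = Zero M X X, add = Add M\<rparr>"

locale linear_category =
  fixes M :: "('o, 'm, 'z) lin_cat_scheme" (structure)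
  assumes Dom_Obj: "f \<in> Arr M \<Longrightarrow> Dom M f \<in> Obj M"
    and Cod_Obj: "f \<in> Arr M \<Longrightarrow> Cod M f \<in> Obj M"
    and Ide_Hom: "X \<in> Obj M \<Longrightarrow> Ide M X \<in> Hom M X X"
    and Comp_Hom: "\<lbrakk>f \<in> Hom M X Y; g \<in> Hom M Y Z\<rbrakk> \<Longrightarrow> g \<cdot> f \<in> Hom M X Z"
    and Comp_assoc: "\<lbrakk>f \<in> Hom M W X; g \<in> Hom M X Y; h \<in> Hom M Y Z\<rbrakk>
      \<Longrightarrow> (h \<cdot> g) \<cdot> f = h \<cdot> (g \<cdot> f)"
    and Ide_left: "f \<in> Hom M X Y \<Longrightarrow> Ide M Y \<cdot> f = f"
    and Ide_right: "f \<in> Hom M X Y \<Longrightarrow> f \<cdot> Ide M X = f"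
    and hom_vectorspace: "\<lbrakk>X \<in> Obj M; Y \<in> Obj M\<rbrakk> \<Longrightarrow> vectorspace class_ring (hom_space M X Y)"
    and Comp_Add_left: "\<lbrakk>f \<in> Hom M X Y; g \<in> Hom M Y Z; g' \<in> Hom M Y Z\<rbrakk>
      \<Longrightarrow> Add M g g' \<cdot> f = Add M (g \<cdot> f) (g' \<cdot> f)"
    and Comp_Add_right: "\<lbrakk>f \<in> Hom M X Y; f' \<in> Hom M X Y; g \<in> Hom M Y Z\<rbrakk>
      \<Longrightarrow> g \<cdot> Add M f f' = Add M (g \<cdot> f) (g \<cdot> f')"
    and Comp_Scale_left: "\<lbrakk>f \<in> Hom M X Y; g \<in> Hom M Y Z\<rbrakk>
      \<Longrightarrow> Scale M c g \<cdot> f = Scale M c (g \<cdot> f)"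
    and Comp_Scale_right: "\<lbrakk>f \<in> Hom M X Y; g \<in> Hom M Y Z\<rbrakk>
      \<Longrightarrow> g \<cdot> Scale M c f = Scale M c (g \<cdot> f)"

definition is_iso :: "('o, 'm, 'z) lin_cat_scheme \<Rightarrow> 'm \<Rightarrow> bool"
  where "is_iso M f \<longleftrightarrow> f \<in> Arr M \<and>
    (\<exists>g \<in> Hom M (Cod M f) (Dom M f).
       g \<cdot>\<^bsub>M\<^esub> f = Ide M (Dom M f) \<and> f \<cdot>\<^bsub>M\<^esub> g = Ide M (Cod M f))"

definition isomorphic :: "('o, 'm, 'z) lin_cat_scheme \<Rightarrow> 'o \<Rightarrow> 'o \<Rightarrow> bool"
  where "isomorphic M X Y \<longleftrightarrow> (\<exists>f \<in> Hom M X Y. is_iso M f)"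

definition zero_object :: "('o, 'm, 'z) lin_cat_scheme \<Rightarrow> 'o \<Rightarrow> bool"
  where "zero_object M X \<longleftrightarrow> X \<in> Obj M \<and>
    (\<forall>Y \<in> Obj M. (\<exists>!f. f \<in> Hom M X Y) \<and> (\<exists>!f. f \<in> Hom M Y X))"

text \<open>\<open>X \<cong> Xs ! 0 \<oplus> \<dots> \<oplus> Xs ! (n - 1)\<close>, i.e. \<open>X\<close> carries the structure of a biproduct of the list \<open>Xs\<close>.\<close>

definition is_direct_sum :: "('o, 'm, 'z) lin_cat_scheme \<Rightarrow> 'o \<Rightarrow> 'o list \<Rightarrow> bool"
  where "is_direct_sum M X Xs \<longleftrightarrow> X \<in> Obj M \<and> set Xs \<subseteq> Obj M \<and>
    (\<exists>inj proj.
       (\<forall>j < length Xs. inj j \<in> Hom M (Xs ! j) X \<and> proj j \<in> Hom M X (Xs ! j)) \<and>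
       (\<forall>j < length Xs. \<forall>k < length Xs.
          proj j \<cdot>\<^bsub>M\<^esub> inj k = (if j = k then Ide M (Xs ! j) else Zero M (Xs ! k) (Xs ! j))) \<and>
       finsum (hom_space M X X) (\<lambda>j. inj j \<cdot>\<^bsub>M\<^esub> proj j) {..<length Xs} = Ide M X)"

definition indecomposable :: "('o, 'm, 'z) lin_cat_scheme \<Rightarrow> 'o \<Rightarrow> bool"
  where "indecomposable M X \<longleftrightarrow> X \<in> Obj M \<and> \<not> zero_object M X \<and>
    (\<forall>A B. is_direct_sum M X [A, B] \<longrightarrow> zero_object M A \<or> zero_object M B)"

definition additive_category :: "('o, 'm, 'z) lin_cat_scheme \<Rightarrow> bool"
  where "additive_category M \<longleftrightarrow> linear_category M \<and> (\<exists>Z. zero_object M Z) \<and>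
    (\<forall>A \<in> Obj M. \<forall>B \<in> Obj M. \<exists>X. is_direct_sum M X [A, B])"

definition idempotent_split :: "('o, 'm, 'z) lin_cat_scheme \<Rightarrow> bool"
  where "idempotent_split M \<longleftrightarrow>
    (\<forall>X \<in> Obj M. \<forall>e \<in> Hom M X X. e \<cdot>\<^bsub>M\<^esub> e = e \<longrightarrow>
       (\<exists>Z \<in> Obj M. \<exists>p \<in> Hom M X Z. \<exists>i \<in> Hom M Z X.
          i \<cdot>\<^bsub>M\<^esub> p = e \<and> p \<cdot>\<^bsub>M\<^esub> i = Ide M Z))"

definition local_ring :: "('a, 'z) ring_scheme \<Rightarrow> bool"
  where "local_ring R \<longleftrightarrow> ring R \<and> \<one>\<^bsub>R\<^esub> \<noteq> \<zero>\<^bsub>R\<^esub> \<and>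
    (\<forall>a \<in> carrier R - Units R. \<forall>b \<in> carrier R - Units R. a \<oplus>\<^bsub>R\<^esub> b \<notin> Units R)"

definition krull_schmidt :: "('o, 'm, 'z) lin_cat_scheme \<Rightarrow> bool"
  where "krull_schmidt M \<longleftrightarrow>
    (\<forall>X \<in> Obj M. \<exists>Xs. is_direct_sum M X Xs \<and> (\<forall>A \<in> set Xs. local_ring (end_ring M A)))"

definition locally_finitary :: "('o, 'm, 'z) lin_cat_scheme \<Rightarrow> bool"
  where "locally_finitary M \<longleftrightarrow>
    additive_category M \<and> idempotent_split M \<and> krull_schmidt M \<and>
    (\<exists>S. countable S \<and> (\<forall>X. indecomposable M X \<longrightarrow> (\<exists>Z \<in> S. isomorphic M X Z))) \<and>
    (\<forall>X \<in> Obj M. \<forall>Y \<in> Obj M. vectorspace.fin_dim class_ring (hom_space M X Y))"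

definition weak_kernel :: "('o, 'm, 'z) lin_cat_scheme \<Rightarrow> 'm \<Rightarrow> 'm \<Rightarrow> bool"
  where "weak_kernel M f k \<longleftrightarrow> f \<in> Arr M \<and> k \<in> Arr M \<and> Cod M k = Dom M f \<and>
    f \<cdot>\<^bsub>M\<^esub> k = Zero M (Dom M k) (Cod M f) \<and>
    (\<forall>g \<in> Arr M. Cod M g = Dom M f \<and> f \<cdot>\<^bsub>M\<^esub> g = Zero M (Dom M g) (Cod M f) \<longrightarrow>
       (\<exists>h \<in> Hom M (Dom M g) (Dom M k). k \<cdot>\<^bsub>M\<^esub> h = g))"

definition admissible :: "('o, 'm, 'z) lin_cat_scheme \<Rightarrow> bool"
  where "admissible M \<longleftrightarrow> (\<forall>f \<in> Arr M. \<exists>k. weak_kernel M f k)"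

definition radical :: "('o, 'm, 'z) lin_cat_scheme \<Rightarrow> 'o \<Rightarrow> 'o \<Rightarrow> 'm set"
  where "radical M X Y = {f \<in> Hom M X Y. \<forall>g \<in> Hom M Y X.
    Ide M X \<ominus>\<^bsub>end_ring M X\<^esub> (g \<cdot>\<^bsub>M\<^esub> f) \<in> Units (end_ring M X)}"

definition semisimple_category :: "('o, 'm, 'z) lin_cat_scheme \<Rightarrow> bool"
  where "semisimple_category M \<longleftrightarrow> (\<forall>X \<in> Obj M. \<forall>Y \<in> Obj M. radical M X Y = {Zero M X Y})"

definition category_ideal :: "('o, 'm, 'z) lin_cat_scheme \<Rightarrow> ('o \<Rightarrow> 'o \<Rightarrow> 'm set) \<Rightarrow> bool"
  where "category_ideal M I \<longleftrightarrow>
    (\<forall>X \<in> Obj M. \<forall>Y \<in> Obj M. VectorSpace.subspace class_ring (I X Y) (hom_space M X Y)) \<and>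
    (\<forall>W \<in> Obj M. \<forall>X \<in> Obj M. \<forall>Y \<in> Obj M. \<forall>Z \<in> Obj M.
       \<forall>h \<in> Hom M W X. \<forall>f \<in> I X Y. \<forall>g \<in> Hom M Y Z. g \<cdot>\<^bsub>M\<^esub> f \<cdot>\<^bsub>M\<^esub> h \<in> I W Z)"

section \<open>Monoidal categories and module categories\<close>

record ('o, 'm) monoidal_cat = "('o, 'm) lin_cat" +
  TensO :: "'o \<Rightarrow> 'o \<Rightarrow> 'o"
  TensA :: "'m \<Rightarrow> 'm \<Rightarrow> 'm"
  UnitO :: "'o"
  Assoc :: "'o \<Rightarrow> 'o \<Rightarrow> 'o \<Rightarrow> 'm"  \<comment> \<open>\<open>(U \<otimes> V) \<otimes> W \<rightarrow> U \<otimes> (V \<otimes> W)\<close>\<close>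
  LUnit :: "'o \<Rightarrow> 'm"  \<comment> \<open>\<open>\<one> \<otimes> V \<rightarrow> V\<close>\<close>
  RUnit :: "'o \<Rightarrow> 'm"  \<comment> \<open>\<open>V \<otimes> \<one> \<rightarrow> V\<close>\<close>

locale monoidal_category = linear_category C
  for C :: "('c, 'f, 'z) monoidal_cat_scheme" (structure) +
  assumes UnitO_Obj: "UnitO C \<in> Obj C"
    and TensO_Obj: "\<lbrakk>U \<in> Obj C; V \<in> Obj C\<rbrakk> \<Longrightarrow> TensO C U V \<in> Obj C"
    and TensA_Hom: "\<lbrakk>a \<in> Hom C U U'; b \<in> Hom C V V'\<rbrakk>
      \<Longrightarrow> TensA C a b \<in> Hom C (TensO C U V) (TensO C U' V')"
    and TensA_Ide: "\<lbrakk>U \<in> Obj C; V \<in> Obj C\<rbrakk>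
      \<Longrightarrow> TensA C (Ide C U) (Ide C V) = Ide C (TensO C U V)"
    and TensA_Comp: "\<lbrakk>a \<in> Hom C U U'; a' \<in> Hom C U' U''; b \<in> Hom C V V'; b' \<in> Hom C V' V''\<rbrakk>
      \<Longrightarrow> TensA C (a' \<cdot> a) (b' \<cdot> b) = TensA C a' b' \<cdot> TensA C a b"
    and TensA_Add_left: "\<lbrakk>a \<in> Hom C U U'; a' \<in> Hom C U U'; b \<in> Hom C V V'\<rbrakk>
      \<Longrightarrow> TensA C (Add C a a') b = Add C (TensA C a b) (TensA C a' b)"
    and TensA_Add_right: "\<lbrakk>a \<in> Hom C U U'; b \<in> Hom C V V'; b' \<in> Hom C V V'\<rbrakk>
      \<Longrightarrow> TensA C a (Add C b b') = Add C (TensA C a b) (TensA C a b')"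
    and TensA_Scale_left: "\<lbrakk>a \<in> Hom C U U'; b \<in> Hom C V V'\<rbrakk>
      \<Longrightarrow> TensA C (Scale C c a) b = Scale C c (TensA C a b)"
    and TensA_Scale_right: "\<lbrakk>a \<in> Hom C U U'; b \<in> Hom C V V'\<rbrakk>
      \<Longrightarrow> TensA C a (Scale C c b) = Scale C c (TensA C a b)"
    and Assoc_Hom: "\<lbrakk>U \<in> Obj C; V \<in> Obj C; W \<in> Obj C\<rbrakk>
      \<Longrightarrow> Assoc C U V W \<in> Hom C (TensO C (TensO C U V) W) (TensO C U (TensO C V W))"
    and Assoc_iso: "\<lbrakk>U \<in> Obj C; V \<in> Obj C; W \<in> Obj C\<rbrakk> \<Longrightarrow> is_iso C (Assoc C U V W)"
    and Assoc_natural: "\<lbrakk>a \<in> Hom C U U'; b \<in> Hom C V V'; d \<in> Hom C W W'\<rbrakk>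
      \<Longrightarrow> Assoc C U' V' W' \<cdot> TensA C (TensA C a b) d = TensA C a (TensA C b d) \<cdot> Assoc C U V W"
    and LUnit_Hom: "V \<in> Obj C \<Longrightarrow> LUnit C V \<in> Hom C (TensO C (UnitO C) V) V"
    and LUnit_iso: "V \<in> Obj C \<Longrightarrow> is_iso C (LUnit C V)"
    and LUnit_natural: "a \<in> Hom C V V'
      \<Longrightarrow> LUnit C V' \<cdot> TensA C (Ide C (UnitO C)) a = a \<cdot> LUnit C V"
    and RUnit_Hom: "V \<in> Obj C \<Longrightarrow> RUnit C V \<in> Hom C (TensO C V (UnitO C)) V"
    and RUnit_iso: "V \<in> Obj C \<Longrightarrow> is_iso C (RUnit C V)"
    and RUnit_natural: "a \<in> Hom C V V'
      \<Longrightarrow> RUnit C V' \<cdot> TensA C a (Ide C (UnitO C)) = a \<cdot> RUnit C V"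
    and pentagon: "\<lbrakk>T \<in> Obj C; U \<in> Obj C; V \<in> Obj C; W \<in> Obj C\<rbrakk> \<Longrightarrow>
      TensA C (Ide C T) (Assoc C U V W) \<cdot> Assoc C T (TensO C U V) W
        \<cdot> TensA C (Assoc C T U V) (Ide C W)
      = Assoc C T U (TensO C V W) \<cdot> Assoc C (TensO C T U) V W"
    and triangle: "\<lbrakk>V \<in> Obj C; W \<in> Obj C\<rbrakk> \<Longrightarrow>
      TensA C (Ide C V) (LUnit C W) \<cdot> Assoc C V (UnitO C) W = TensA C (RUnit C V) (Ide C W)"

record ('c, 'f, 'o, 'm) module_cat = "('o, 'm) lin_cat" +
  ActO :: "'c \<Rightarrow> 'o \<Rightarrow> 'o"
  ActA :: "'f \<Rightarrow> 'm \<Rightarrow> 'm"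
  ActAssoc :: "'c \<Rightarrow> 'c \<Rightarrow> 'o \<Rightarrow> 'm"  \<comment> \<open>\<open>(U \<otimes> V) \<cdot> X \<rightarrow> U \<cdot> (V \<cdot> X)\<close>\<close>
  ActUnit :: "'o \<Rightarrow> 'm"  \<comment> \<open>\<open>\<one> \<cdot> X \<rightarrow> X\<close>\<close>

locale module_category = C: monoidal_category C + M: linear_category M
  for C :: "('c, 'f, 'y) monoidal_cat_scheme"
    and M :: "('c, 'f, 'o, 'm, 'z) module_cat_scheme" +
  assumes ActO_Obj: "\<lbrakk>V \<in> Obj C; X \<in> Obj M\<rbrakk> \<Longrightarrow> ActO M V X \<in> Obj M"
    and ActA_Hom: "\<lbrakk>a \<in> Hom C V V'; f \<in> Hom M X X'\<rbrakk>
      \<Longrightarrow> ActA M a f \<in> Hom M (ActO M V X) (ActO M V' X')"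
    and ActA_Ide: "\<lbrakk>V \<in> Obj C; X \<in> Obj M\<rbrakk> \<Longrightarrow> ActA M (Ide C V) (Ide M X) = Ide M (ActO M V X)"
    and ActA_Comp: "\<lbrakk>a \<in> Hom C V V'; a' \<in> Hom C V' V''; f \<in> Hom M X X'; f' \<in> Hom M X' X''\<rbrakk>
      \<Longrightarrow> ActA M (a' \<cdot>\<^bsub>C\<^esub> a) (f' \<cdot>\<^bsub>M\<^esub> f) = ActA M a' f' \<cdot>\<^bsub>M\<^esub> ActA M a f"
    and ActA_Add_left: "\<lbrakk>a \<in> Hom C V V'; a' \<in> Hom C V V'; f \<in> Hom M X X'\<rbrakk>
      \<Longrightarrow> ActA M (Add C a a') f = Add M (ActA M a f) (ActA M a' f)"
    and ActA_Add_right: "\<lbrakk>a \<in> Hom C V V'; f \<in> Hom M X X'; f' \<in> Hom M X X'\<rbrakk>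
      \<Longrightarrow> ActA M a (Add M f f') = Add M (ActA M a f) (ActA M a f')"
    and ActA_Scale_left: "\<lbrakk>a \<in> Hom C V V'; f \<in> Hom M X X'\<rbrakk>
      \<Longrightarrow> ActA M (Scale C c a) f = Scale M c (ActA M a f)"
    and ActA_Scale_right: "\<lbrakk>a \<in> Hom C V V'; f \<in> Hom M X X'\<rbrakk>
      \<Longrightarrow> ActA M a (Scale M c f) = Scale M c (ActA M a f)"
    and ActAssoc_Hom: "\<lbrakk>U \<in> Obj C; V \<in> Obj C; X \<in> Obj M\<rbrakk>
      \<Longrightarrow> ActAssoc M U V X \<in> Hom M (ActO M (TensO C U V) X) (ActO M U (ActO M V X))"
    and ActAssoc_iso: "\<lbrakk>U \<in> Obj C; V \<in> Obj C; X \<in> Obj M\<rbrakk> \<Longrightarrow> is_iso M (ActAssoc M U V X)"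
    and ActAssoc_natural: "\<lbrakk>a \<in> Hom C U U'; b \<in> Hom C V V'; f \<in> Hom M X X'\<rbrakk> \<Longrightarrow>
      ActAssoc M U' V' X' \<cdot>\<^bsub>M\<^esub> ActA M (TensA C a b) f
      = ActA M a (ActA M b f) \<cdot>\<^bsub>M\<^esub> ActAssoc M U V X"
    and ActUnit_Hom: "X \<in> Obj M \<Longrightarrow> ActUnit M X \<in> Hom M (ActO M (UnitO C) X) X"
    and ActUnit_iso: "X \<in> Obj M \<Longrightarrow> is_iso M (ActUnit M X)"
    and ActUnit_natural: "f \<in> Hom M X X'
      \<Longrightarrow> ActUnit M X' \<cdot>\<^bsub>M\<^esub> ActA M (Ide C (UnitO C)) f = f \<cdot>\<^bsub>M\<^esub> ActUnit M X"
    and act_pentagon: "\<lbrakk>U \<in> Obj C; V \<in> Obj C; W \<in> Obj C; X \<in> Obj M\<rbrakk> \<Longrightarrow>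
      ActA M (Ide C U) (ActAssoc M V W X) \<cdot>\<^bsub>M\<^esub> ActAssoc M U (TensO C V W) X
        \<cdot>\<^bsub>M\<^esub> ActA M (Assoc C U V W) (Ide M X)
      = ActAssoc M U V (ActO M W X) \<cdot>\<^bsub>M\<^esub> ActAssoc M (TensO C U V) W X"
    and act_triangle: "\<lbrakk>V \<in> Obj C; X \<in> Obj M\<rbrakk> \<Longrightarrow>
      ActA M (Ide C V) (ActUnit M X) \<cdot>\<^bsub>M\<^esub> ActAssoc M V (UnitO C) X
      = ActA M (RUnit C V) (Ide M X)"

definition invariant_ideal ::
  "('c, 'f, 'y) monoidal_cat_scheme \<Rightarrow> ('c, 'f, 'o, 'm, 'z) module_cat_scheme
    \<Rightarrow> ('o \<Rightarrow> 'o \<Rightarrow> 'm set) \<Rightarrow> bool"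
  where "invariant_ideal C M I \<longleftrightarrow> category_ideal M I \<and>
    (\<forall>V \<in> Obj C. \<forall>X \<in> Obj M. \<forall>Y \<in> Obj M. \<forall>f \<in> I X Y.
       ActA M (Ide C V) f \<in> I (ActO M V X) (ActO M V Y))"

definition simple_transitive ::
  "('c, 'f, 'y) monoidal_cat_scheme \<Rightarrow> ('c, 'f, 'o, 'm, 'z) module_cat_scheme \<Rightarrow> bool"
  where "simple_transitive C M \<longleftrightarrow>
    (\<forall>I. invariant_ideal C M I \<longrightarrow>
       (\<forall>X \<in> Obj M. \<forall>Y \<in> Obj M. I X Y = {Zero M X Y}) \<or>
       (\<forall>X \<in> Obj M. \<forall>Y \<in> Obj M. I X Y = Hom M X Y))"

section \<open>Finite dimensional modules over \<open>sl\<^sub>2\<close>\<close>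

definition sl2 :: "complex mat set"
  where "sl2 = {x \<in> carrier_mat 2 2. x $$ (0, 0) + x $$ (1, 1) = 0}"

definition bracket :: "complex mat \<Rightarrow> complex mat \<Rightarrow> complex mat"
  where "bracket x y = x * y - y * x"

text \<open>A finite dimensional module is given in coordinates, by its dimension \<open>n\<close> and the
  homomorphism of Lie algebras from \<open>sl2\<close> to the \<open>n \<times> n\<close> matrices. Choosing bases identifies the
  category of all finite dimensional modules with this one, up to monoidal equivalence; with the
  Kronecker product as tensor product it becomes strict.\<close>

datatype sl2_mod = Sl2_Mod (sdim: nat) (srep: "complex mat \<Rightarrow> complex mat")

datatype sl2_hom = Sl2_Hom (hdom: sl2_mod) (hcod: sl2_mod) (hmat: "complex mat")

definition is_sl2_mod :: "sl2_mod \<Rightarrow> bool"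
  where "is_sl2_mod V \<longleftrightarrow>
    srep V \<in> sl2 \<rightarrow>\<^sub>E carrier_mat (sdim V) (sdim V) \<and>
    (\<forall>x \<in> sl2. \<forall>y \<in> sl2. srep V (x + y) = srep V x + srep V y) \<and>
    (\<forall>c. \<forall>x \<in> sl2. srep V (c \<cdot>\<^sub>m x) = c \<cdot>\<^sub>m srep V x) \<and>
    (\<forall>x \<in> sl2. \<forall>y \<in> sl2. srep V (bracket x y) = bracket (srep V x) (srep V y))"

definition is_sl2_hom :: "sl2_hom \<Rightarrow> bool"
  where "is_sl2_hom a \<longleftrightarrow> is_sl2_mod (hdom a) \<and> is_sl2_mod (hcod a) \<and>
    hmat a \<in> carrier_mat (sdim (hcod a)) (sdim (hdom a)) \<and>
    (\<forall>x \<in> sl2. hmat a * srep (hdom a) x = srep (hcod a) x * hmat a)"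

definition kronecker :: "complex mat \<Rightarrow> complex mat \<Rightarrow> complex mat"
  where "kronecker A B = mat (dim_row A * dim_row B) (dim_col A * dim_col B)
    (\<lambda>(i, j). A $$ (i div dim_row B, j div dim_col B) * B $$ (i mod dim_row B, j mod dim_col B))"

definition sl2_tensor :: "sl2_mod \<Rightarrow> sl2_mod \<Rightarrow> sl2_mod"
  where "sl2_tensor V W = Sl2_Mod (sdim V * sdim W)
    (\<lambda>x \<in> sl2. kronecker (srep V x) (1\<^sub>m (sdim W)) + kronecker (1\<^sub>m (sdim V)) (srep W x))"

definition sl2_unit :: sl2_mod
  where "sl2_unit = Sl2_Mod 1 (\<lambda>x \<in> sl2. 0\<^sub>m 1 1)"

definition sl2_id :: "sl2_mod \<Rightarrow> sl2_hom"
  where "sl2_id V = Sl2_Hom V V (1\<^sub>m (sdim V))"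

definition sl2_modules :: "(sl2_mod, sl2_hom) monoidal_cat"
  where "sl2_modules =
    \<lparr>Obj = {V. is_sl2_mod V},
     Arr = {a. is_sl2_hom a},
     Dom = hdom,
     Cod = hcod,
     Ide = sl2_id,
     Comp = (\<lambda>b a. Sl2_Hom (hdom a) (hcod b) (hmat b * hmat a)),
     Zero = (\<lambda>V W. Sl2_Hom V W (0\<^sub>m (sdim W) (sdim V))),
     Add = (\<lambda>a b. Sl2_Hom (hdom a) (hcod a) (hmat a + hmat b)),
     Scale = (\<lambda>c a. Sl2_Hom (hdom a) (hcod a) (c \<cdot>\<^sub>m hmat a)),
     TensO = sl2_tensor,
     TensA = (\<lambda>a b. Sl2_Hom (sl2_tensor (hdom a) (hdom b)) (sl2_tensor (hcod a) (hcod b))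
                (kronecker (hmat a) (hmat b))),
     UnitO = sl2_unit,
     Assoc = (\<lambda>U V W. sl2_id (sl2_tensor U (sl2_tensor V W))),
     LUnit = sl2_id,
     RUnit = sl2_id\<rparr>"

text \<open>The simple module of dimension 2, realised as the natural module \<open>\<complex>\<^sup>2\<close>.\<close>

definition L1 :: sl2_mod
  where "L1 = Sl2_Mod 2 (\<lambda>x \<in> sl2. x)"

definition type_D_infinity :: "(sl2_mod, sl2_hom, 'o, 'm, 'z) module_cat_scheme \<Rightarrow> bool"
  where "type_D_infinity M \<longleftrightarrow> (\<exists>Y :: nat \<Rightarrow> 'o.
    (\<forall>i. indecomposable M (Y i)) \<and>
    (\<forall>i j. isomorphic M (Y i) (Y j) \<longrightarrow> i = j) \<and>
    (\<forall>X. indecomposable M X \<longrightarrow> (\<exists>i. isomorphic M X (Y i))) \<and>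
    isomorphic M (ActO M L1 (Y 0)) (Y 2) \<and>
    isomorphic M (ActO M L1 (Y 1)) (Y 2) \<and>
    is_direct_sum M (ActO M L1 (Y 2)) [Y 0, Y 1, Y 3] \<and>
    (\<forall>i \<ge> 3. is_direct_sum M (ActO M L1 (Y i)) [Y (i - 1), Y (i + 1)]))"

end

theory Submission
  imports "HOL-Computational_Algebra.Fundamental_Theorem_Algebra" Defs
begin

text \<open>The radical is shown to be a \<open>\<C>\<close>-invariant ideal; it contains no identity of an
  indecomposable object, so it vanishes by simple transitivity.

  Every finite dimensional module is a retract of a direct sum of tensor powers of \<open>L(1)\<close>, so it is
  enough that the self-adjoint functor \<open>F = L(1) \<cdot> -\<close> preserves radical morphisms
  \<open>f : Y\<^sub>i \<rightarrow> Y\<^sub>j\<close>. For \<open>i = j\<close> both \<open>f\<close> and \<open>F f\<close> are nilpotent, and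
  the summands of \<open>F Y\<^sub>i\<close> are pairwise non-isomorphic, so \<open>F f\<close> is radical. If \<open>i \<le> 1\<close> or \<open>j \<le> 1\<close>, then \<open>F Y\<^sub>i\<close> or \<open>F Y\<^sub>j\<close> is indecomposable, and a
  non-radical \<open>F f\<close> would be split, which \<open>F\<close> reflects because the identity is a retract of \<open>F F\<close>.
  Otherwise only \<open>|i - j| = 2\<close> matters, and one moves away from the fork of the
  graph by induction: if \<open>F\<close> preserves the radical morphisms from the neighbours of \<open>Y\<^sub>m\<close> to
  \<open>Y\<^bsub>m+1\<^esub>\<close>, then adjunction maps radical morphisms \<open>F Y\<^sub>m \<rightarrow> Y\<^bsub>m+1\<^esub>\<close> to radical morphisms
  \<open>Y\<^sub>m \<rightarrow> F Y\<^bsub>m+1\<^esub>\<close>, and a radical \<open>f : Y\<^sub>m \<rightarrow> Y\<^bsub>m+2\<^esub>\<close> with non-radical \<open>F f\<close> would produce a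
  non-radical morphism with radical adjunct.\<close>

section \<open>The radical of a linear category\<close>

text \<open>The obstacle is that for distinct i, j every morphism from Y_i to Y_j is radical, so
  radicality carries no information about it, and there are no powers to take. Its image under F can
  fail to be radical only at a summand shared by F Y_i and F Y_j, that is, at a common neighbour;
  away from the two prongs of the fork this forces distance two and makes the neighbour unique.
  There a non-radical component of F f, multiplied by endomorphisms of Y_{m+1}, exhausts Hom(F Y_m,
  Y_{m+1}) up to radical morphisms. Its own adjunct factors through f and is radical. Hence every
  morphism from Y_m to F Y_{m+1} would be radical, although Y_m is a direct summand of F Y_{m+1}.
  The reduction to tensor powers is complete reducibility in disguise, carried out with operators:
  idempotents given by highest weight operators are split off the identity one by one, and each
  extends to an intertwiner that is a sum of composites through a tensor power, whose extreme vector
  has the right weight.\<close>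

lemma (in abelian_monoid) finsum_mem:
  assumes "finite A" "S \<subseteq> carrier G" "\<zero> \<in> S" "\<And>x y. x \<in> S \<Longrightarrow> y \<in> S \<Longrightarrow> x \<oplus> y \<in> S"
    and "\<And>i. i \<in> A \<Longrightarrow> f i \<in> S"
  shows "finsum G f A \<in> S"
  using assms(1,5)
proof (induction A rule: finite_induct)
  case (insert a A)
  then have "f \<in> A \<rightarrow> carrier G" "f a \<in> carrier G" using assms(2) by auto
  with insert show ?case using assms(4) by auto
qed (use assms(3) in auto)

context linear_category
begin

abbreviation sub :: "'m \<Rightarrow> 'm \<Rightarrow> 'm"
  where "sub f g \<equiv> Add M f (Scale M (- 1) g)"

lemma Hom_Obj: "f \<in> Hom M X Y \<Longrightarrow> X \<in> Obj M \<and> Y \<in> Obj M"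
  using Dom_Obj Cod_Obj by (auto simp: Hom_def)

lemma hom_module: "X \<in> Obj M \<Longrightarrow> Y \<in> Obj M \<Longrightarrow> module class_ring (hom_space M X Y)"
  using hom_vectorspace by (simp add: vectorspace_def)

lemma hom_abelian_group: "X \<in> Obj M \<Longrightarrow> Y \<in> Obj M \<Longrightarrow> abelian_group (hom_space M X Y)"
  using module.axioms(2)[OF hom_module] .

lemma hom_space_simps [simp]:
  "carrier (hom_space M X Y) = Hom M X Y" "add (hom_space M X Y) = Add M"
  "zero (hom_space M X Y) = Zero M X Y" "smult (hom_space M X Y) = Scale M"
  by (simp_all add: hom_space_def)

lemma Add_Hom: "f \<in> Hom M X Y \<Longrightarrow> g \<in> Hom M X Y \<Longrightarrow> Add M f g \<in> Hom M X Y"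
  using abelian_monoid.a_closed[OF abelian_group.axioms(1)[OF hom_abelian_group[of X Y]]] Hom_Obj
  by auto

lemma Zero_Hom: "X \<in> Obj M \<Longrightarrow> Y \<in> Obj M \<Longrightarrow> Zero M X Y \<in> Hom M X Y"
  using abelian_monoid.zero_closed[OF abelian_group.axioms(1)[OF hom_abelian_group[of X Y]]] by auto

lemma Scale_Hom: "f \<in> Hom M X Y \<Longrightarrow> Scale M c f \<in> Hom M X Y"
  using module.smult_closed[OF hom_module[of X Y], of c f] Hom_Obj by (auto simp: class_ring_simps)

lemma Add_assoc: "f \<in> Hom M X Y \<Longrightarrow> g \<in> Hom M X Y \<Longrightarrow> h \<in> Hom M X Y \<Longrightarrow>
    Add M (Add M f g) h = Add M f (Add M g h)"
  using abelian_monoid.a_assoc[OF abelian_group.axioms(1)[OF hom_abelian_group[of X Y]]] Hom_Obj by auto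

lemma Add_comm: "f \<in> Hom M X Y \<Longrightarrow> g \<in> Hom M X Y \<Longrightarrow> Add M f g = Add M g f"
  using abelian_monoid.a_comm[OF abelian_group.axioms(1)[OF hom_abelian_group[of X Y]]] Hom_Obj by auto

lemma Add_Zero_left: "f \<in> Hom M X Y \<Longrightarrow> Add M (Zero M X Y) f = f"
  using abelian_monoid.l_zero[OF abelian_group.axioms(1)[OF hom_abelian_group[of X Y]]] Hom_Obj by auto

lemma Add_Zero_right: "f \<in> Hom M X Y \<Longrightarrow> Add M f (Zero M X Y) = f"
  using Add_Zero_left Add_comm Zero_Hom Hom_Obj by metis

lemma Scale_one: "f \<in> Hom M X Y \<Longrightarrow> Scale M 1 f = f"
  using module.smult_one[OF hom_module[of X Y], of f] Hom_Obj by (auto simp: class_ring_simps)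

lemma Scale_add: "f \<in> Hom M X Y \<Longrightarrow> Scale M (a + b) f = Add M (Scale M a f) (Scale M b f)"
  using module.smult_l_distr[OF hom_module[of X Y], of a b f] Hom_Obj by (auto simp: class_ring_simps)

lemma Scale_Scale: "f \<in> Hom M X Y \<Longrightarrow> Scale M a (Scale M b f) = Scale M (a * b) f"
  using module.smult_assoc1[OF hom_module[of X Y], of a b f] Hom_Obj by (auto simp: class_ring_simps)

lemma Scale_zero: "f \<in> Hom M X Y \<Longrightarrow> Scale M 0 f = Zero M X Y"
proof -
  assume f: "f \<in> Hom M X Y"
  interpret abelian_group "hom_space M X Y"
    using hom_abelian_group Hom_Obj[OF f] by blast
  have "Add M (Scale M 0 f) (Scale M 0 f) = Scale M 0 f"
    using Scale_add[OF f, of 0 0] by simp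
  then show ?thesis
    using add.l_cancel_one'[of "Scale M 0 f" "Scale M 0 f"] Scale_Hom[OF f, of 0] by simp
qed

lemma sub_self: "f \<in> Hom M X Y \<Longrightarrow> sub f f = Zero M X Y"
  using Scale_add[of f X Y 1 "- 1"] Scale_one[of f X Y] Scale_zero[of f X Y] by simp

lemma sub_Hom: "f \<in> Hom M X Y \<Longrightarrow> g \<in> Hom M X Y \<Longrightarrow> sub f g \<in> Hom M X Y"
  by (simp add: Add_Hom Scale_Hom)

lemma sub_Add_cancel: "f \<in> Hom M X Y \<Longrightarrow> g \<in> Hom M X Y \<Longrightarrow> sub (Add M f g) g = f"
  by (simp add: Add_assoc Scale_Hom sub_self Add_Zero_right)

lemma Add_sub_cancel: "f \<in> Hom M X Y \<Longrightarrow> g \<in> Hom M X Y \<Longrightarrow> Add M (sub f g) g = f"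
proof -
  assume f: "f \<in> Hom M X Y" and g: "g \<in> Hom M X Y"
  have "Add M (sub f g) g = Add M f (sub g g)"
    using Add_assoc[OF f Scale_Hom[OF g] g] Add_comm[OF g Scale_Hom[OF g]] by simp
  then show ?thesis by (simp add: sub_self[OF g] Add_Zero_right[OF f])
qed

lemma Comp_sub_left: "f \<in> Hom M X Y \<Longrightarrow> g \<in> Hom M Y Z \<Longrightarrow> g' \<in> Hom M Y Z \<Longrightarrow>
    sub g g' \<cdot> f = sub (g \<cdot> f) (g' \<cdot> f)"
  by (simp add: Comp_Add_left Comp_Scale_left Scale_Hom)

lemma Comp_sub_right: "f \<in> Hom M X Y \<Longrightarrow> f' \<in> Hom M X Y \<Longrightarrow> g \<in> Hom M Y Z \<Longrightarrow>
    g \<cdot> sub f f' = sub (g \<cdot> f) (g \<cdot> f')"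
  by (simp add: Comp_Add_right Comp_Scale_right Scale_Hom)

lemma Comp_Zero_right:
  assumes g: "g \<in> Hom M Y Z" and X: "X \<in> Obj M"
  shows "g \<cdot> Zero M X Y = Zero M X Z"
proof -
  have z: "Zero M X Y \<in> Hom M X Y" using Zero_Hom X Hom_Obj[OF g] by blast
  have "g \<cdot> Scale M 0 (Zero M X Y) = Scale M 0 (g \<cdot> Zero M X Y)"
    by (rule Comp_Scale_right[OF z g])
  then show ?thesis using Scale_zero[OF z] Scale_zero[OF Comp_Hom[OF z g]] by simp
qed

lemma Comp_Zero_left:
  assumes f: "f \<in> Hom M X Y" and Z: "Z \<in> Obj M"
  shows "Zero M Y Z \<cdot> f = Zero M X Z"
proof -
  have z: "Zero M Y Z \<in> Hom M Y Z" using Zero_Hom Z Hom_Obj[OF f] by blast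
  have "Scale M 0 (Zero M Y Z) \<cdot> f = Scale M 0 (Zero M Y Z \<cdot> f)"
    by (rule Comp_Scale_left[OF f z])
  then show ?thesis using Scale_zero[OF z] Scale_zero[OF Comp_Hom[OF f z]] by simp
qed

subsection \<open>Units and the radical\<close>

definition unit_at :: "'o \<Rightarrow> 'm \<Rightarrow> bool"
  where "unit_at X u \<longleftrightarrow> u \<in> Hom M X X \<and> (\<exists>v \<in> Hom M X X. v \<cdot> u = Ide M X \<and> u \<cdot> v = Ide M X)"

lemma unit_at_Ide: "X \<in> Obj M \<Longrightarrow> unit_at X (Ide M X)"
  using Ide_Hom Ide_left unfolding unit_at_def by blast

lemma unit_at_Comp:
  assumes "unit_at X u" "unit_at X v"
  shows "unit_at X (u \<cdot> v)"
proof -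
  obtain u' v' where u: "u \<in> Hom M X X" "u' \<in> Hom M X X" "u' \<cdot> u = Ide M X" "u \<cdot> u' = Ide M X"
    and v: "v \<in> Hom M X X" "v' \<in> Hom M X X" "v' \<cdot> v = Ide M X" "v \<cdot> v' = Ide M X"
    using assms by (auto simp: unit_at_def)
  note uv = Comp_Hom[OF v(1) u(1)] and vu' = Comp_Hom[OF u(2) v(2)]
  have "(v' \<cdot> u') \<cdot> (u \<cdot> v) = v' \<cdot> ((u' \<cdot> u) \<cdot> v)"
    by (simp add: Comp_assoc[OF uv u(2) v(2)] Comp_assoc[OF v(1) u(1,2)])
  moreover have "(u \<cdot> v) \<cdot> (v' \<cdot> u') = u \<cdot> ((v \<cdot> v') \<cdot> u')"
    by (simp add: Comp_assoc[OF vu' v(1) u(1)] Comp_assoc[OF u(2) v(2,1)])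
  ultimately show ?thesis
    unfolding unit_at_def using u v uv vu' by (auto simp: Ide_left intro!: bexI[of _ "v' \<cdot> u'"])
qed

lemma unit_at_Scale:
  assumes "unit_at X u" "c \<noteq> 0"
  shows "unit_at X (Scale M c u)"
proof -
  obtain u' where u: "u \<in> Hom M X X" "u' \<in> Hom M X X" "u' \<cdot> u = Ide M X" "u \<cdot> u' = Ide M X"
    using assms by (auto simp: unit_at_def)
  then have "X \<in> Obj M" using Hom_Obj by blast
  then have "Scale M (inverse c) u' \<cdot> Scale M c u = Ide M X"
    "Scale M c u \<cdot> Scale M (inverse c) u' = Ide M X"
    using u assms(2) Ide_Hom[of X]
    by (simp_all add: Comp_Scale_left[of _ X X _ X] Comp_Scale_right[of _ X X _ X] Scale_Hom
        Scale_Scale[of _ X X] Scale_one[of _ X X])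
  then show ?thesis
    unfolding unit_at_def using u Scale_Hom by blast
qed

lemma end_ring_simps [simp]:
  "carrier (end_ring M X) = Hom M X X" "add (end_ring M X) = Add M" "mult (end_ring M X) = (\<cdot>)"
  "zero (end_ring M X) = Zero M X X" "one (end_ring M X) = Ide M X"
  by (simp_all add: end_ring_def)

lemma end_ring_ring:
  assumes "X \<in> Obj M"
  shows "ring (end_ring M X)"
proof (rule ringI)
  show "abelian_group (end_ring M X)"
  proof (rule abelian_groupI)
    fix f assume "f \<in> carrier (end_ring M X)"
    then have f: "f \<in> Hom M X X" by simp
    then have "Add M (Scale M (- 1) f) f = Zero M X X"
      using sub_self Add_comm Scale_Hom by metis
    then show "\<exists>y\<in>carrier (end_ring M X). y \<oplus>\<^bsub>end_ring M X\<^esub> f = \<zero>\<^bsub>end_ring M X\<^esub>"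
      using Scale_Hom[OF f] by (intro bexI[of _ "Scale M (- 1) f"]) simp_all
  qed (use assms in \<open>auto intro: Add_Hom Zero_Hom Add_assoc Add_comm Add_Zero_left\<close>)
  show "monoid (end_ring M X)"
    by (rule monoidI) (use assms in \<open>auto intro: Comp_Hom Ide_Hom Comp_assoc Ide_left Ide_right\<close>)
qed (auto intro: Comp_Add_left Comp_Add_right)

lemma end_ring_Units: "u \<in> Units (end_ring M X) \<longleftrightarrow> unit_at X u"
  by (auto simp: Units_def unit_at_def)

lemma end_ring_minus:
  assumes "f \<in> Hom M X X" "g \<in> Hom M X X"
  shows "f \<ominus>\<^bsub>end_ring M X\<^esub> g = sub f g"
proof -
  interpret ring "end_ring M X"
    using end_ring_ring Hom_Obj assms by blast
  have "Add M (Scale M (- 1) g) g = Zero M X X"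
    using sub_self Add_comm Scale_Hom assms by metis
  then have "\<ominus>\<^bsub>end_ring M X\<^esub> g = Scale M (- 1) g"
    using minus_equality[of "Scale M (- 1) g" g] assms Scale_Hom by simp
  then show ?thesis by (simp add: a_minus_def)
qed

text \<open>Substituting \<open>Scale M (- 1) g\<close> for \<open>g\<close> turns the difference in
  the definition into a sum, which composes more smoothly.\<close>

lemma radical_iff: "f \<in> radical M X Y \<longleftrightarrow>
    f \<in> Hom M X Y \<and> (\<forall>g \<in> Hom M Y X. unit_at X (Add M (Ide M X) (g \<cdot> f)))"
proof (cases "f \<in> Hom M X Y")
  case True
  note f = True
  have X: "X \<in> Obj M" using Hom_Obj[OF f] by simp
  have minus: "Ide M X \<ominus>\<^bsub>end_ring M X\<^esub> (g \<cdot> f) = Add M (Ide M X) (Scale M (- 1) g \<cdot> f)"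
    if "g \<in> Hom M Y X" for g
    using end_ring_minus[OF Ide_Hom[OF X] Comp_Hom[OF f that]] Comp_Scale_left[OF f that] by simp
  have neg: "Scale M (- 1) (Scale M (- 1) g) = g" if "g \<in> Hom M Y X" for g
    using Scale_Scale[OF that, of "- 1" "- 1"] Scale_one[OF that] by simp
  have "(\<forall>g \<in> Hom M Y X. unit_at X (Add M (Ide M X) (Scale M (- 1) g \<cdot> f)))
    \<longleftrightarrow> (\<forall>g \<in> Hom M Y X. unit_at X (Add M (Ide M X) (g \<cdot> f)))"
    using neg Scale_Hom by metis
  then show ?thesis
    using f by (simp add: radical_def end_ring_Units minus cong: ball_cong)
qed (simp add: radical_def)

lemma radical_Hom: "f \<in> radical M X Y \<Longrightarrow> f \<in> Hom M X Y"
  by (simp add: radical_iff)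

text \<open>If \<open>v\<close> inverts 1 + b a, then 1 - a v b inverts 1 + a b. This is what makes
  the radical left-right symmetric.\<close>

lemma jacobson:
  assumes a: "a \<in> Hom M X W" and b: "b \<in> Hom M W X"
    and unit: "unit_at X (Add M (Ide M X) (b \<cdot> a))"
  shows "unit_at W (Add M (Ide M W) (a \<cdot> b))"
proof -
  have X: "X \<in> Obj M" and W: "W \<in> Obj M" using Hom_Obj[OF a] by auto
  define P where "P = Add M (Ide M W) (a \<cdot> b)"
  define Q where "Q = Add M (Ide M X) (b \<cdot> a)"
  obtain v where v: "v \<in> Hom M X X" "v \<cdot> Q = Ide M X" "Q \<cdot> v = Ide M X"
    using unit unfolding unit_at_def Q_def by blast
  note ab = Comp_Hom[OF b a] and ba = Comp_Hom[OF a b]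
  have P: "P \<in> Hom M W W" unfolding P_def by (rule Add_Hom[OF Ide_Hom[OF W] ab])
  have Q: "Q \<in> Hom M X X" unfolding Q_def by (rule Add_Hom[OF Ide_Hom[OF X] ba])
  have Pa: "P \<cdot> a = a \<cdot> Q"
    unfolding P_def Q_def
    by (simp add: Comp_Add_left[OF a Ide_Hom[OF W] ab] Comp_Add_right[OF Ide_Hom[OF X] ba a]
        Ide_left[OF a] Ide_right[OF a] Comp_assoc[OF a b a])
  have bP: "b \<cdot> P = Q \<cdot> b"
    unfolding P_def Q_def
    by (simp add: Comp_Add_left[OF b Ide_Hom[OF X] ba] Comp_Add_right[OF Ide_Hom[OF W] ab b]
        Ide_left[OF b] Ide_right[OF b] Comp_assoc[OF b a b])
  define w where "w = a \<cdot> (v \<cdot> b)"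
  have vb: "v \<cdot> b \<in> Hom M W X" by (rule Comp_Hom[OF b v(1)])
  have w: "w \<in> Hom M W W" unfolding w_def by (rule Comp_Hom[OF vb a])
  have "P \<cdot> w = (a \<cdot> Q) \<cdot> (v \<cdot> b)"
    unfolding w_def by (simp add: Pa flip: Comp_assoc[OF vb a P])
  also have "\<dots> = a \<cdot> ((Q \<cdot> v) \<cdot> b)"
    by (simp add: Comp_assoc[OF vb Q a] Comp_assoc[OF b v(1) Q])
  finally have Pw: "P \<cdot> w = a \<cdot> b"
    by (simp add: v Ide_left[OF b])
  have "w \<cdot> P = a \<cdot> (v \<cdot> (Q \<cdot> b))"
    unfolding w_def by (simp add: Comp_assoc[OF P vb a] Comp_assoc[OF P b v(1)] bP)
  also have "\<dots> = a \<cdot> b"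
    by (simp add: v Ide_left[OF b] flip: Comp_assoc[OF b Q v(1)])
  finally have wP: "w \<cdot> P = a \<cdot> b" .
  have cancel: "sub P (a \<cdot> b) = Ide M W"
    unfolding P_def by (rule sub_Add_cancel[OF Ide_Hom[OF W] ab])
  have "P \<cdot> sub (Ide M W) w = Ide M W" "sub (Ide M W) w \<cdot> P = Ide M W"
    by (simp_all add: Comp_sub_right[OF Ide_Hom[OF W] w P] Comp_sub_left[OF P Ide_Hom[OF W] w]
        Ide_left[OF P] Ide_right[OF P] Pw wP cancel)
  then show ?thesis
    unfolding unit_at_def P_def[symmetric] using P sub_Hom[OF Ide_Hom[OF W] w] by blast
qed

lemma radical_iff_right: "f \<in> radical M X Y \<longleftrightarrow>
    f \<in> Hom M X Y \<and> (\<forall>g \<in> Hom M Y X. unit_at Y (Add M (Ide M Y) (f \<cdot> g)))"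
  unfolding radical_iff using jacobson by blast

lemma radical_Comp_left:
  assumes f: "f \<in> radical M X Y" and h: "h \<in> Hom M Y Z"
  shows "h \<cdot> f \<in> radical M X Z"
  unfolding radical_iff
proof (intro conjI ballI)
  show "h \<cdot> f \<in> Hom M X Z" by (rule Comp_Hom[OF radical_Hom[OF f] h])
  fix g assume g: "g \<in> Hom M Z X"
  show "unit_at X (Add M (Ide M X) (g \<cdot> (h \<cdot> f)))"
    using f Comp_Hom[OF h g] by (simp add: radical_iff flip: Comp_assoc[OF radical_Hom[OF f] h g])
qed

lemma radical_Comp_right:
  assumes f: "f \<in> radical M X Y" and h: "h \<in> Hom M W X"
  shows "f \<cdot> h \<in> radical M W Y"
  unfolding radical_iff_right
proof (intro conjI ballI)
  show "f \<cdot> h \<in> Hom M W Y" by (rule Comp_Hom[OF h radical_Hom[OF f]])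
  fix g assume g: "g \<in> Hom M Y W"
  show "unit_at Y (Add M (Ide M Y) ((f \<cdot> h) \<cdot> g))"
    using f Comp_Hom[OF g h] by (simp add: radical_iff_right Comp_assoc[OF g h radical_Hom[OF f]])
qed

text \<open>With the unit u = 1 + g f and its inverse v, the element 1 + g (f + f') equals u (1 + (v
  g) f'), a product of two units.\<close>

lemma radical_Add:
  assumes f: "f \<in> radical M X Y" and f': "f' \<in> radical M X Y"
  shows "Add M f f' \<in> radical M X Y"
  unfolding radical_iff
proof (intro conjI ballI)
  note F = radical_Hom[OF f] and F' = radical_Hom[OF f']
  show "Add M f f' \<in> Hom M X Y" by (rule Add_Hom[OF F F'])
  fix g assume g: "g \<in> Hom M Y X"
  have X: "X \<in> Obj M" using Hom_Obj[OF F] by simp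
  define u where "u = Add M (Ide M X) (g \<cdot> f)"
  have "unit_at X u" using f g by (simp add: radical_iff u_def)
  then obtain v where u: "u \<in> Hom M X X" and v: "v \<in> Hom M X X" "u \<cdot> v = Ide M X"
    unfolding unit_at_def by blast
  note vg = Comp_Hom[OF g v(1)]
  have "u \<cdot> ((v \<cdot> g) \<cdot> f') = g \<cdot> f'"
    using v Comp_assoc[OF F' g v(1)] Comp_assoc[OF Comp_Hom[OF F' g] v(1) u] Ide_left[OF Comp_Hom[OF F' g]] by simp
  then have "u \<cdot> Add M (Ide M X) ((v \<cdot> g) \<cdot> f') = Add M u (g \<cdot> f')"
    using Comp_Add_right[OF Ide_Hom[OF X] Comp_Hom[OF F' vg] u] Ide_right[OF u] by simp
  also have "\<dots> = Add M (Ide M X) (g \<cdot> Add M f f')"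
    unfolding u_def
    using Add_assoc[OF Ide_Hom[OF X] Comp_Hom[OF F g] Comp_Hom[OF F' g]] Comp_Add_right[OF F F' g] by simp
  finally have "u \<cdot> Add M (Ide M X) ((v \<cdot> g) \<cdot> f') = Add M (Ide M X) (g \<cdot> Add M f f')" .
  moreover have "unit_at X (Add M (Ide M X) ((v \<cdot> g) \<cdot> f'))"
    using f' vg by (simp add: radical_iff)
  ultimately show "unit_at X (Add M (Ide M X) (g \<cdot> Add M f f'))"
    using unit_at_Comp[OF \<open>unit_at X u\<close>] by metis
qed

lemma radical_Zero: "X \<in> Obj M \<Longrightarrow> Y \<in> Obj M \<Longrightarrow> Zero M X Y \<in> radical M X Y"
  by (simp add: radical_iff Zero_Hom Comp_Zero_right Add_Zero_right Ide_Hom unit_at_Ide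
      Add_Zero_right[of _ X X])

lemma radical_Scale: "f \<in> radical M X Y \<Longrightarrow> Scale M c f \<in> radical M X Y"
proof -
  assume f: "f \<in> radical M X Y"
  have Y: "Y \<in> Obj M" using Hom_Obj[OF radical_Hom[OF f]] by simp
  have "Scale M c (Ide M Y) \<cdot> f = Scale M c f"
    using Comp_Scale_left[OF radical_Hom[OF f] Ide_Hom[OF Y]] Ide_left[OF radical_Hom[OF f]] by simp
  then show ?thesis
    using radical_Comp_left[OF f Scale_Hom[OF Ide_Hom[OF Y], of c]] by simp
qed

lemma radical_category_ideal: "category_ideal M (radical M)"
  unfolding category_ideal_def
proof (intro conjI ballI)
  fix X Y assume "X \<in> Obj M" "Y \<in> Obj M"
  then interpret vectorspace class_ring "hom_space M X Y" by (rule hom_vectorspace)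
  show "VectorSpace.subspace class_ring (radical M X Y) (hom_space M X Y)"
    unfolding subspace_def submodule_def
    using vectorspace_axioms module_axioms \<open>X \<in> Obj M\<close> \<open>Y \<in> Obj M\<close>
    by (auto intro: radical_Hom radical_Zero radical_Add radical_Scale)
next
  fix W X Y Z h f g
  assume "h \<in> Hom M W X" "f \<in> radical M X Y" "g \<in> Hom M Y Z"
  then show "g \<cdot> f \<cdot> h \<in> radical M W Z"
    by (intro radical_Comp_right radical_Comp_left)
qed

text \<open>If v inverts g f, the test morphism k = - v g gives 1 + k f = 0, and zero is a unit only
  on a zero object.\<close>

lemma split_mono_not_radical:
  assumes "f \<in> radical M X Y" "g \<in> Hom M Y X" "unit_at X (g \<cdot> f)"
  shows "Ide M X = Zero M X X"
proof -
  have X: "X \<in> Obj M" using assms Hom_Obj by blast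
  obtain v where v: "v \<in> Hom M X X" "v \<cdot> (g \<cdot> f) = Ide M X"
    using assms(3) unfolding unit_at_def by blast
  define k where "k = Scale M (- 1) (v \<cdot> g)"
  have vg: "v \<cdot> g \<in> Hom M Y X" by (rule Comp_Hom[OF assms(2) v(1)])
  have k: "k \<in> Hom M Y X" unfolding k_def by (rule Scale_Hom[OF vg])
  have "k \<cdot> f = Scale M (- 1) (Ide M X)"
    unfolding k_def using v Comp_Scale_left[OF radical_Hom[OF assms(1)] vg]
      Comp_assoc[OF radical_Hom[OF assms(1)] assms(2) v(1)] by simp
  then have "Add M (Ide M X) (k \<cdot> f) = Zero M X X"
    using sub_self[OF Ide_Hom[OF X]] by simp
  then have "unit_at X (Zero M X X)"
    using assms(1) k by (metis radical_iff)
  then show ?thesis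
    unfolding unit_at_def using Comp_Zero_left X by metis
qed

subsection \<open>Objects with local endomorphism ring\<close>

text \<open>Locality in contrapositive form: a unit is never a sum of two non-units. This is the
  direction in which it is applied.\<close>

definition local_obj :: "'o \<Rightarrow> bool"
  where "local_obj X \<longleftrightarrow> X \<in> Obj M \<and> Ide M X \<noteq> Zero M X X \<and>
    (\<forall>a \<in> Hom M X X. \<forall>b \<in> Hom M X X. unit_at X (Add M a b) \<longrightarrow> unit_at X a \<or> unit_at X b)"

lemma local_objI: "X \<in> Obj M \<Longrightarrow> local_ring (end_ring M X) \<Longrightarrow> local_obj X"
  unfolding local_ring_def local_obj_def by (simp add: end_ring_Units) (metis DiffI end_ring_Units)

text \<open>The identity is the difference of 1 + a and a, so one of the two must be a unit.\<close>

lemma local_unit_minus: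
  assumes X: "local_obj X" and a: "a \<in> Hom M X X" and nu: "\<not> unit_at X (Add M (Ide M X) a)"
  shows "unit_at X a"
proof -
  have XO: "X \<in> Obj M" using X by (simp add: local_obj_def)
  have "sub (Add M (Ide M X) a) a = Ide M X"
    by (rule sub_Add_cancel[OF Ide_Hom[OF XO] a])
  then have "unit_at X (sub (Add M (Ide M X) a) a)"
    using unit_at_Ide[OF XO] by simp
  then have "unit_at X (Scale M (- 1) a)"
    using X nu Add_Hom[OF Ide_Hom[OF XO] a] Scale_Hom[OF a] unfolding local_obj_def by blast
  then have "unit_at X (Scale M (- 1) (Scale M (- 1) a))"
    by (rule unit_at_Scale) simp
  then show ?thesis
    using Scale_Scale[OF a, of "- 1" "- 1"] Scale_one[OF a] by simp
qed

text \<open>A morphism \<open>k\<close> at which the radical test fails makes 1 + k f a non-unit,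
  hence k f a unit; correcting \<open>k\<close> by its inverse gives the retraction.\<close>

lemma not_radical_split_mono:
  assumes "local_obj X" "f \<in> Hom M X Y" "f \<notin> radical M X Y"
  obtains g where "g \<in> Hom M Y X" "g \<cdot> f = Ide M X"
proof -
  obtain k where k: "k \<in> Hom M Y X" "\<not> unit_at X (Add M (Ide M X) (k \<cdot> f))"
    using assms by (auto simp: radical_iff)
  have "unit_at X (k \<cdot> f)"
    by (rule local_unit_minus[OF assms(1) Comp_Hom[OF assms(2) k(1)] k(2)])
  then obtain v where v: "v \<in> Hom M X X" "v \<cdot> (k \<cdot> f) = Ide M X"
    unfolding unit_at_def by blast
  show ?thesis
    by (rule that[OF Comp_Hom[OF k(1) v(1)]]) (simp add: Comp_assoc[OF assms(2) k(1) v(1)] v)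
qed

lemma not_radical_split_epi:
  assumes "local_obj Y" "f \<in> Hom M X Y" "f \<notin> radical M X Y"
  obtains g where "g \<in> Hom M Y X" "f \<cdot> g = Ide M Y"
proof -
  obtain k where k: "k \<in> Hom M Y X" "\<not> unit_at Y (Add M (Ide M Y) (f \<cdot> k))"
    using assms by (auto simp: radical_iff_right)
  have "unit_at Y (f \<cdot> k)"
    by (rule local_unit_minus[OF assms(1) Comp_Hom[OF k(1) assms(2)] k(2)])
  then obtain v where v: "v \<in> Hom M Y Y" "(f \<cdot> k) \<cdot> v = Ide M Y"
    unfolding unit_at_def by blast
  show ?thesis
    by (rule that[OF Comp_Hom[OF v(1) k(1)]]) (simp flip: Comp_assoc[OF v(1) k(1) assms(2)] add: v)
qed

text \<open>A non-radical morphism has a left and a right inverse, and these agree. In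
  contrapositive form: all morphisms between non-isomorphic local objects are radical.\<close>

lemma local_not_radical_isomorphic:
  assumes "local_obj X" "local_obj Y" "f \<in> Hom M X Y" "f \<notin> radical M X Y"
  shows "isomorphic M X Y"
proof -
  obtain g where g: "g \<in> Hom M Y X" "g \<cdot> f = Ide M X"
    by (rule not_radical_split_mono[OF assms(1,3,4)])
  obtain k where k: "k \<in> Hom M Y X" "f \<cdot> k = Ide M Y"
    by (rule not_radical_split_epi[OF assms(2,3,4)])
  have "g = g \<cdot> (f \<cdot> k)" using k g Ide_right by metis
  also have "\<dots> = k" using Comp_assoc[OF k(1) assms(3) g(1)] g Ide_left[OF k(1)] by simp
  finally have "g = k" .
  then show ?thesis
    using assms(3) g k unfolding isomorphic_def is_iso_def Hom_def by auto
qed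

lemma local_radical_end_iff:
  assumes "local_obj X" "f \<in> Hom M X X"
  shows "f \<in> radical M X X \<longleftrightarrow> \<not> unit_at X f"
proof
  assume f: "f \<in> radical M X X"
  have X: "X \<in> Obj M" using assms by (simp add: local_obj_def)
  show "\<not> unit_at X f"
    using split_mono_not_radical[OF f Ide_Hom[OF X]] Ide_left[OF assms(2)] assms(1)
    by (auto simp: local_obj_def)
next
  assume nu: "\<not> unit_at X f"
  show "f \<in> radical M X X"
  proof (rule ccontr)
    assume nr: "f \<notin> radical M X X"
    obtain g where g: "g \<in> Hom M X X" "g \<cdot> f = Ide M X"
      by (rule not_radical_split_mono[OF assms nr])
    obtain k where k: "k \<in> Hom M X X" "f \<cdot> k = Ide M X"
      by (rule not_radical_split_epi[OF assms nr])
    have "g = g \<cdot> (f \<cdot> k)" using k g Ide_right by metis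
    also have "\<dots> = k" using Comp_assoc[OF k(1) assms(2) g(1)] g Ide_left[OF k(1)] by simp
    finally show False using nu g k assms(2) unfolding unit_at_def by blast
  qed
qed

end

context linear_category
begin

lemma Hom_iff: "f \<in> Hom M X Y \<longleftrightarrow> f \<in> Arr M \<and> Dom M f = X \<and> Cod M f = Y"
  by (auto simp: Hom_def)

text \<open>Typing of composites through \<open>Dom\<close> and \<open>Cod\<close>, which the simplifier can discharge without
  guessing objects.\<close>

lemma comp_simps:
  assumes "f \<in> Arr M" "g \<in> Arr M" "Cod M f = Dom M g"
  shows "g \<cdot> f \<in> Arr M" "Dom M (g \<cdot> f) = Dom M f" "Cod M (g \<cdot> f) = Cod M g"
  using Comp_Hom[of f "Dom M f" "Dom M g" g "Cod M g"] assms by (auto simp: Hom_def)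

lemma comp_assoc: "f \<in> Arr M \<Longrightarrow> g \<in> Arr M \<Longrightarrow> h \<in> Arr M \<Longrightarrow> Cod M f = Dom M g \<Longrightarrow>
    Cod M g = Dom M h \<Longrightarrow> (h \<cdot> g) \<cdot> f = h \<cdot> (g \<cdot> f)"
  using Comp_assoc[of f "Dom M f" "Dom M g" g "Dom M h" h "Cod M h"] by (auto simp: Hom_def)

lemma ide_simps: "X \<in> Obj M \<Longrightarrow> Ide M X \<in> Arr M" "X \<in> Obj M \<Longrightarrow> Dom M (Ide M X) = X"
  "X \<in> Obj M \<Longrightarrow> Cod M (Ide M X) = X"
  using Ide_Hom[of X] by (auto simp: Hom_def)

lemma ide_comp: "f \<in> Arr M \<Longrightarrow> Cod M f = Y \<Longrightarrow> Ide M Y \<cdot> f = f"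
  "f \<in> Arr M \<Longrightarrow> Dom M f = X \<Longrightarrow> f \<cdot> Ide M X = f"
  using Ide_left Ide_right by (auto simp: Hom_def)

lemmas cat_simps = comp_simps comp_assoc ide_simps ide_comp

subsection \<open>Biproducts\<close>

text \<open>Membership in such a set can be tested on the components of a biproduct, which takes the
  place of matrix calculus.\<close>

definition add_closed :: "'o \<Rightarrow> 'o \<Rightarrow> 'm set \<Rightarrow> bool"
  where "add_closed X Y I \<longleftrightarrow> I \<subseteq> Hom M X Y \<and> Zero M X Y \<in> I \<and> (\<forall>f \<in> I. \<forall>g \<in> I. Add M f g \<in> I)"

lemma add_closed_radical: "X \<in> Obj M \<Longrightarrow> Y \<in> Obj M \<Longrightarrow> add_closed X Y (radical M X Y)"
  by (auto simp: add_closed_def radical_Hom radical_Zero radical_Add)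

definition biproduct :: "'o \<Rightarrow> 'o list \<Rightarrow> (nat \<Rightarrow> 'm) \<Rightarrow> (nat \<Rightarrow> 'm) \<Rightarrow> bool"
  where "biproduct X Xs inc prj \<longleftrightarrow> X \<in> Obj M \<and> set Xs \<subseteq> Obj M \<and>
    (\<forall>j < length Xs. inc j \<in> Hom M (Xs ! j) X \<and> prj j \<in> Hom M X (Xs ! j)) \<and>
    (\<forall>j < length Xs. \<forall>k < length Xs.
       prj j \<cdot> inc k = (if j = k then Ide M (Xs ! j) else Zero M (Xs ! k) (Xs ! j))) \<and>
    finsum (hom_space M X X) (\<lambda>j. inc j \<cdot> prj j) {..<length Xs} = Ide M X"

lemma is_direct_sum_iff: "is_direct_sum M X Xs \<longleftrightarrow> (\<exists>inc prj. biproduct X Xs inc prj)"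
  unfolding is_direct_sum_def biproduct_def by blast

lemma biproduct_Ide_mem:
  assumes b: "biproduct X Xs inc prj" and I: "add_closed X X I"
    and mem: "\<And>j. j < length Xs \<Longrightarrow> inc j \<cdot> prj j \<in> I"
  shows "Ide M X \<in> I"
proof -
  have X: "X \<in> Obj M" using b by (simp add: biproduct_def)
  interpret abelian_group "hom_space M X X" by (rule hom_abelian_group[OF X X])
  have "finsum (hom_space M X X) (\<lambda>j. inc j \<cdot> prj j) {..<length Xs} \<in> I"
    by (rule finsum_mem) (use I mem in \<open>auto simp: add_closed_def\<close>)
  then show ?thesis using b by (simp add: biproduct_def)
qed

lemma biproduct_maps:
  assumes "biproduct X Xs inc prj" "j < length Xs"
  shows "inc j \<in> Hom M (Xs ! j) X" "prj j \<in> Hom M X (Xs ! j)" "Xs ! j \<in> Obj M"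
    "inc j \<cdot> prj j \<in> Hom M X X"
  using assms Comp_Hom unfolding biproduct_def by auto

text \<open>The endomorphisms \<open>e\<close> with \<open>f \<cdot> e\<close> in \<open>I\<close>
  form an additively closed set containing every \<open>inc j \<cdot> prj j\<close>, hence their
  sum, the identity.\<close>

lemma biproduct_mem_right:
  assumes b: "biproduct X Xs inc prj" and f: "f \<in> Hom M X Z" and I: "add_closed X Z I"
    and mem: "\<And>j. j < length Xs \<Longrightarrow> (f \<cdot> inc j) \<cdot> prj j \<in> I"
  shows "f \<in> I"
proof -
  have X: "X \<in> Obj M" and Z: "Z \<in> Obj M" using Hom_Obj[OF f] by auto
  have "Ide M X \<in> {e \<in> Hom M X X. f \<cdot> e \<in> I}"
  proof (rule biproduct_Ide_mem[OF b])
    show "add_closed X X {e \<in> Hom M X X. f \<cdot> e \<in> I}"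
      using I Zero_Hom[OF X X] Comp_Zero_right[OF f X]
      by (auto simp: add_closed_def Add_Hom Comp_Add_right[OF _ _ f])
  next
    fix j assume j: "j < length Xs"
    show "inc j \<cdot> prj j \<in> {e \<in> Hom M X X. f \<cdot> e \<in> I}"
      using mem[OF j] Comp_assoc[OF biproduct_maps(2,1)[OF b j] f] biproduct_maps(4)[OF b j] by simp
  qed
  then show ?thesis using Ide_right[OF f] by simp
qed

lemma biproduct_mem_left:
  assumes b: "biproduct X Xs inc prj" and f: "f \<in> Hom M Z X" and I: "add_closed Z X I"
    and mem: "\<And>j. j < length Xs \<Longrightarrow> inc j \<cdot> (prj j \<cdot> f) \<in> I"
  shows "f \<in> I"
proof -
  have X: "X \<in> Obj M" and Z: "Z \<in> Obj M" using Hom_Obj[OF f] by auto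
  have "Ide M X \<in> {e \<in> Hom M X X. e \<cdot> f \<in> I}"
  proof (rule biproduct_Ide_mem[OF b])
    show "add_closed X X {e \<in> Hom M X X. e \<cdot> f \<in> I}"
      using I Zero_Hom[OF X X] Comp_Zero_left[OF f X]
      by (auto simp: add_closed_def Add_Hom Comp_Add_left[OF f])
  next
    fix j assume j: "j < length Xs"
    show "inc j \<cdot> prj j \<in> {e \<in> Hom M X X. e \<cdot> f \<in> I}"
      using mem[OF j] Comp_assoc[OF f biproduct_maps(2,1)[OF b j]] biproduct_maps(4)[OF b j] by simp
  qed
  then show ?thesis using Ide_left[OF f] by simp
qed

lemma biproduct_radical_right:
  assumes "biproduct X Xs inc prj" "f \<in> Hom M X Z"
    "\<And>j. j < length Xs \<Longrightarrow> f \<cdot> inc j \<in> radical M (Xs ! j) Z"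
  shows "f \<in> radical M X Z"
proof (rule biproduct_mem_right[OF assms(1,2)])
  show "add_closed X Z (radical M X Z)"
    using Hom_Obj[OF assms(2)] add_closed_radical by blast
qed (rule radical_Comp_right[OF assms(3) biproduct_maps(2)[OF assms(1)]])

lemma biproduct_radical_left:
  assumes "biproduct X Xs inc prj" "f \<in> Hom M Z X"
    "\<And>j. j < length Xs \<Longrightarrow> prj j \<cdot> f \<in> radical M Z (Xs ! j)"
  shows "f \<in> radical M Z X"
proof (rule biproduct_mem_left[OF assms(1,2)])
  show "add_closed Z X (radical M Z X)"
    using Hom_Obj[OF assms(2)] add_closed_radical by blast
qed (rule radical_Comp_left[OF assms(3) biproduct_maps(1)[OF assms(1)]])

subsection \<open>Nilpotency of radical endomorphisms\<close>

definition pow :: "'o \<Rightarrow> 'm \<Rightarrow> nat \<Rightarrow> 'm"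
  where "pow X f n = ((\<cdot>) f ^^ n) (Ide M X)"

lemma pow_0: "pow X f 0 = Ide M X" and pow_Suc: "pow X f (Suc n) = f \<cdot> pow X f n"
  by (simp_all add: pow_def)

lemma pow_Hom: "f \<in> Hom M X X \<Longrightarrow> pow X f n \<in> Hom M X X"
  by (induction n) (auto simp: pow_0 pow_Suc Ide_Hom Comp_Hom Hom_Obj)

lemma pow_add: "f \<in> Hom M X X \<Longrightarrow> pow X f (m + n) = pow X f m \<cdot> pow X f n"
proof (induction m)
  case 0
  then show ?case using Ide_left[OF pow_Hom] by (simp add: pow_0)
next
  case (Suc m)
  then show ?case
    using Comp_assoc[OF pow_Hom[of f X n] pow_Hom[of f X m] Suc.prems] by (simp add: pow_Suc)
qed

text \<open>A Nakayama argument: p (1 - f h) = 0, and 1 - f h is invertible because \<open>f\<close>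
  is radical.\<close>

lemma radical_absorb:
  assumes f: "f \<in> radical M X X" and h: "h \<in> Hom M X X" and p: "p \<in> Hom M X X"
    and eq: "p = p \<cdot> (f \<cdot> h)"
  shows "p = Zero M X X"
proof -
  note F = radical_Hom[OF f]
  have X: "X \<in> Obj M" using Hom_Obj[OF F] by simp
  note fh = Comp_Hom[OF h F]
  define k where "k = sub (Ide M X) (f \<cdot> h)"
  have "unit_at X (Add M (Ide M X) (f \<cdot> Scale M (- 1) h))"
    using f Scale_Hom[OF h] by (simp add: radical_iff_right)
  then have "unit_at X k"
    using Comp_Scale_right[OF h F] by (simp add: k_def)
  then obtain v where v: "k \<in> Hom M X X" "v \<in> Hom M X X" "k \<cdot> v = Ide M X"
    unfolding unit_at_def by blast
  have "p \<cdot> k = Zero M X X"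
    unfolding k_def using Comp_sub_right[OF Ide_Hom[OF X] fh p] eq Ide_right[OF p] sub_self[OF p] by simp
  then have "Zero M X X = p \<cdot> (k \<cdot> v)"
    using Comp_assoc[OF v(2,1) p] Comp_Zero_left[OF v(2) X] by simp
  then show ?thesis using v Ide_right[OF p] by simp
qed

text \<open>Finite dimension gives a linear relation among the powers of \<open>f\<close>. Its
  lowest power is expressed through higher ones, so it has the form p = p f h and vanishes by
  \<open>radical_absorb\<close>.\<close>

lemma radical_nilpotent:
  assumes fd: "vectorspace.fin_dim class_ring (hom_space M X X)" and f: "f \<in> radical M X X"
  obtains n where "pow X f n = Zero M X X"
proof -
  note F = radical_Hom[OF f]
  have X: "X \<in> Obj M" using Hom_Obj[OF F] by simp
  interpret V: vectorspace class_ring "hom_space M X X" by (rule hom_vectorspace[OF X X])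
  define P where "P = pow X f"
  have P: "P n \<in> Hom M X X" for n unfolding P_def by (rule pow_Hom[OF F])
  have shift: "P m = P n \<cdot> (f \<cdot> P (m - Suc n))" if "n < m" for m n
  proof -
    have "P (n + Suc (m - Suc n)) = P n \<cdot> P (Suc (m - Suc n))"
      unfolding P_def by (rule pow_add[OF F])
    then show ?thesis using that by (simp add: P_def pow_Suc)
  qed
  \<comment> \<open>Linear dependence concerns the set of powers, so a repetition among them has to
    be treated separately; it yields p = p f h at once.\<close>
  show ?thesis
  proof (cases "inj P")
    case False
    then obtain m n where "n < m" "P n = P m"
      by (metis injI linorder_neq_iff)
    then have "P n = P n \<cdot> (f \<cdot> P (m - Suc n))" using shift by metis
    then have "P n = Zero M X X"
      by (rule radical_absorb[OF f P P])
    then show ?thesis using that by (simp add: P_def)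
  next
    case True
    then have "infinite (range P)" by (simp add: finite_image_iff)
    then have "V.lin_dep (range P)"
      using V.fin_dim_li_fin[OF fd] P by auto
    then obtain A a w where A: "finite A" "A \<subseteq> range P" and lc: "V.lincomb a A = Zero M X X"
      and w: "w \<in> A" "a w \<noteq> 0"
      unfolding V.lin_dep_def by (auto simp: class_ring_simps)
    \<comment> \<open>The lowest exponent occurring with non-zero coefficient; every other term of
      the relation is divisible on the right by one more factor \<open>f\<close>.\<close>
    define n where "n = (LEAST n. P n \<in> A \<and> a (P n) \<noteq> 0)"
    have "\<exists>n. P n \<in> A \<and> a (P n) \<noteq> 0" using A w by blast
    then have n: "P n \<in> A" "a (P n) \<noteq> 0"
      unfolding n_def by (rule LeastI_ex[THEN conjunct1], rule LeastI_ex[THEN conjunct2])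
    have least: "n \<le> m" if "P m \<in> A" "a (P m) \<noteq> 0" for m
      unfolding n_def using that by (intro Least_le) simp
    \<comment> \<open>All terms except the lowest lie in this set, and so does their sum.\<close>
    define S where "S = {P n \<cdot> (f \<cdot> h) | h. h \<in> Hom M X X}"
    have S_Hom: "S \<subseteq> Hom M X X" unfolding S_def using Comp_Hom[OF Comp_Hom[OF _ F] P] by blast
    have "finsum (hom_space M X X) (\<lambda>v. a v \<odot>\<^bsub>hom_space M X X\<^esub> v) (A - {P n}) \<in> S"
    proof (rule V.finsum_mem)
      have "Zero M X X = P n \<cdot> (f \<cdot> Zero M X X)"
        using Comp_Zero_right[OF F X] Comp_Zero_right[OF P X] by simp
      then show "\<zero>\<^bsub>hom_space M X X\<^esub> \<in> S"
        unfolding S_def using Zero_Hom[OF X X] by auto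
    next
      fix x y assume "x \<in> S" "y \<in> S"
      then obtain h k where h: "h \<in> Hom M X X" "x = P n \<cdot> (f \<cdot> h)" and k: "k \<in> Hom M X X" "y = P n \<cdot> (f \<cdot> k)"
        unfolding S_def by blast
      have "Add M x y = P n \<cdot> (f \<cdot> Add M h k)"
        using h k Comp_Add_right[OF h(1) k(1) F] Comp_Add_right[OF Comp_Hom[OF h(1) F] Comp_Hom[OF k(1) F] P] by simp
      then show "x \<oplus>\<^bsub>hom_space M X X\<^esub> y \<in> S"
        unfolding S_def using Add_Hom[OF h(1) k(1)] by auto
    next
      fix v assume "v \<in> A - {P n}"
      then obtain m where m: "v = P m" "P m \<in> A" "m \<noteq> n" using A by blast
      show "a v \<odot>\<^bsub>hom_space M X X\<^esub> v \<in> S"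
      proof (cases "a v = 0")
        case True
        have "Scale M 0 v = P n \<cdot> (f \<cdot> Zero M X X)"
          using Comp_Zero_right[OF F X] Comp_Zero_right[OF P X] Scale_zero[OF P] m by simp
        then show ?thesis
          unfolding S_def using Zero_Hom[OF X X] True by auto
      next
        case False
        then have "n < m" using least[of m] m by simp
        have "Scale M (a v) v = P n \<cdot> (f \<cdot> Scale M (a v) (P (m - Suc n)))"
          using shift[OF \<open>n < m\<close>] Comp_Scale_right[OF P F] Comp_Scale_right[OF Comp_Hom[OF P F] P] m by simp
        then show ?thesis
          unfolding S_def using Scale_Hom[OF P] by auto
      qed
    qed (use A S_Hom in auto)
    then obtain h where h: "h \<in> Hom M X X"
      and rest: "finsum (hom_space M X X) (\<lambda>v. a v \<odot>\<^bsub>hom_space M X X\<^esub> v) (A - {P n}) = P n \<cdot> (f \<cdot> h)"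
      unfolding S_def by blast
    have "V.lincomb a A = Add M (Scale M (a (P n)) (P n)) (P n \<cdot> (f \<cdot> h))"
    proof -
      have "V.lincomb a (insert (P n) (A - {P n}))
        = Add M (Scale M (a (P n)) (P n)) (finsum (hom_space M X X) (\<lambda>v. a v \<odot>\<^bsub>hom_space M X X\<^esub> v) (A - {P n}))"
        unfolding V.lincomb_def using A P Scale_Hom by (subst V.finsum_insert) auto
      then show ?thesis using n(1) rest by (simp add: insert_absorb)
    qed
    with lc have eq: "Add M (Scale M (a (P n)) (P n)) (P n \<cdot> (f \<cdot> h)) = Zero M X X" by simp
    define c where "c = - inverse (a (P n))"
    have Pfh: "P n \<cdot> (f \<cdot> h) \<in> Hom M X X" by (rule Comp_Hom[OF Comp_Hom[OF h F] P])
    have "Scale M (a (P n)) (P n) = Scale M (- 1) (P n \<cdot> (f \<cdot> h))"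
      using sub_Add_cancel[OF Scale_Hom[OF P[of n]] Pfh, of "a (P n)"] eq Add_Zero_left[OF Scale_Hom[OF Pfh]] by simp
    then have "Scale M (inverse (a (P n))) (Scale M (a (P n)) (P n))
        = Scale M (inverse (a (P n))) (Scale M (- 1) (P n \<cdot> (f \<cdot> h)))" by simp
    then have "P n = Scale M c (P n \<cdot> (f \<cdot> h))"
      using n(2) Scale_Scale[OF P] Scale_Scale[OF Pfh] Scale_one[OF P] by (simp add: c_def)
    also have "\<dots> = P n \<cdot> (f \<cdot> Scale M c h)"
      using Comp_Scale_right[OF h F] Comp_Scale_right[OF Comp_Hom[OF h F] P] by simp
    finally have "P n = Zero M X X"
      by (rule radical_absorb[OF f Scale_Hom[OF h] P])
    then show ?thesis using that by (simp add: P_def)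
  qed
qed

end

section \<open>Krull-Schmidt categories\<close>

context linear_category
begin

lemma zero_object_iff:
  assumes A: "A \<in> Obj M"
  shows "zero_object M A \<longleftrightarrow> Ide M A = Zero M A A"
proof
  assume "zero_object M A"
  then show "Ide M A = Zero M A A"
    using A Ide_Hom Zero_Hom unfolding zero_object_def by blast
next
  assume z: "Ide M A = Zero M A A"
  have "f = Zero M A B" if "f \<in> Hom M A B" for f B
    using Ide_right[OF that] Comp_Zero_right[OF that A] z by simp
  moreover have "f = Zero M B A" if "f \<in> Hom M B A" for f B
    using Ide_left[OF that] Comp_Zero_left[OF that A] z by simp
  ultimately show "zero_object M A"
    unfolding zero_object_def using A Zero_Hom by metis
qed

lemma idempotent_unit:
  assumes "unit_at X e" "e \<cdot> e = e"
  shows "e = Ide M X"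
proof -
  obtain v where v: "e \<in> Hom M X X" "v \<in> Hom M X X" "v \<cdot> e = Ide M X"
    using assms(1) unfolding unit_at_def by blast
  then show ?thesis
    using Comp_assoc[OF v(1,1,2)] assms(2) Ide_left[OF v(1)] by simp
qed

lemma iso_obtain:
  assumes "isomorphic M X Y"
  obtains f g where "f \<in> Hom M X Y" "g \<in> Hom M Y X" "g \<cdot> f = Ide M X" "f \<cdot> g = Ide M Y"
  using assms unfolding isomorphic_def is_iso_def by (auto simp: Hom_iff)

lemma isomorphicI:
  "f \<in> Hom M X Y \<Longrightarrow> g \<in> Hom M Y X \<Longrightarrow> g \<cdot> f = Ide M X \<Longrightarrow> f \<cdot> g = Ide M Y \<Longrightarrow> isomorphic M X Y"
  unfolding isomorphic_def is_iso_def by (rule bexI[of _ f]) (auto simp: Hom_iff)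

text \<open>The identity is not radical, so one of the two idempotents
  \<open>inc j \<cdot> prj j\<close> is not radical either. It is then an invertible idempotent,
  hence the identity, and the other summand is zero.\<close>

lemma local_indecomposable:
  assumes "local_obj A"
  shows "indecomposable M A"
  unfolding indecomposable_def
proof (intro conjI allI impI)
  show A: "A \<in> Obj M" using assms by (simp add: local_obj_def)
  show "\<not> zero_object M A" using assms zero_object_iff[OF A] by (simp add: local_obj_def)
  fix B C assume "is_direct_sum M A [B, C]"
  then obtain inc prj where b: "biproduct A [B, C] inc prj" unfolding is_direct_sum_iff by blast
  note m = biproduct_maps[OF b]
  have "\<exists>j<length [B, C]. inc j \<cdot> prj j \<notin> radical M A A"
  proof (rule ccontr)
    assume "\<not> ?thesis"
    then have "Ide M A \<in> radical M A A"
      using biproduct_Ide_mem[OF b add_closed_radical[OF A A]] by blast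
    then show False
      using local_radical_end_iff[OF assms Ide_Hom[OF A]] unit_at_Ide[OF A] by simp
  qed
  then obtain j where j: "j < length [B, C]" "inc j \<cdot> prj j \<notin> radical M A A" by blast
  have "prj j \<cdot> inc j = Ide M ([B, C] ! j)" using b j by (simp add: biproduct_def)
  then have "(inc j \<cdot> prj j) \<cdot> (inc j \<cdot> prj j) = inc j \<cdot> prj j"
    using Comp_assoc[OF m(4)[OF j(1)] m(2,1)[OF j(1)]] Comp_assoc[OF m(2,1,2)[OF j(1)]]
      Ide_left[OF m(2)[OF j(1)]] by simp
  then have e: "inc j \<cdot> prj j = Ide M A"
    using idempotent_unit local_radical_end_iff[OF assms m(4)[OF j(1)]] j(2) by blast
  obtain k where k: "k < length [B, C]" "k \<noteq> j"
    by (rule that[of "1 - j"]) (use j in \<open>auto simp: less_Suc_eq\<close>)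
  let ?K = "[B, C] ! k"
  have K: "?K \<in> Obj M" by (rule m(3)[OF k(1)])
  have "prj k = (prj k \<cdot> inc j) \<cdot> prj j"
    using e Ide_right[OF m(2)[OF k(1)]] Comp_assoc[OF m(2,1)[OF j(1)] m(2)[OF k(1)]] by simp
  also have "\<dots> = Zero M A ?K"
    using b j(1) k Comp_Zero_left[OF m(2)[OF j(1)] K] unfolding biproduct_def by metis
  finally have "prj k = Zero M A ?K" .
  moreover have "prj k \<cdot> inc k = Ide M ?K"
    using b k(1) unfolding biproduct_def by presburger
  ultimately have "Ide M ?K = Zero M ?K ?K"
    using Comp_Zero_left[OF m(1)[OF k(1)] K] by simp
  then have "zero_object M ?K" using zero_object_iff[OF K] by simp
  then show "zero_object M B \<or> zero_object M C"
    using k(1) by (auto simp: less_Suc_eq)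
qed

lemma isomorphic_direct_sum: "isomorphic M X A \<Longrightarrow> is_direct_sum M X [A]"
proof -
  assume "isomorphic M X A"
  then obtain f g where fg: "f \<in> Hom M X A" "g \<in> Hom M A X" "g \<cdot> f = Ide M X" "f \<cdot> g = Ide M A"
    by (rule iso_obtain)
  have X: "X \<in> Obj M" and A: "A \<in> Obj M" using Hom_Obj[OF fg(1)] by auto
  interpret abelian_group "hom_space M X X" by (rule hom_abelian_group[OF X X])
  have "finsum (hom_space M X X) (\<lambda>j. g \<cdot> f) {0::nat} = g \<cdot> f"
    using Comp_Hom[OF fg(1,2)] by (subst finsum_insert) (auto simp: Add_Zero_right)
  then show ?thesis
    unfolding is_direct_sum_def using fg X A
    by (intro conjI exI[of _ "\<lambda>_. g"] exI[of _ "\<lambda>_. f"]) (auto simp: lessThan_Suc)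
qed

text \<open>Splitting both e and 1 - e exhibits X as a biproduct of the two images, one of which
  must be zero.\<close>

lemma indecomposable_idempotent:
  assumes ind: "indecomposable M X" and split: "idempotent_split M"
    and e: "e \<in> Hom M X X" "e \<cdot> e = e"
  shows "e = Zero M X X \<or> e = Ide M X"
proof -
  have X: "X \<in> Obj M" using ind by (simp add: indecomposable_def)
  note I = Ide_Hom[OF X]
  define e' where "e' = sub (Ide M X) e"
  have e': "e' \<in> Hom M X X" unfolding e'_def by (rule sub_Hom[OF I e(1)])
  have ee': "e \<cdot> e' = Zero M X X" and e'e: "e' \<cdot> e = Zero M X X"
    unfolding e'_def Comp_sub_right[OF I e(1,1)] Comp_sub_left[OF e(1) I e(1)]
    by (simp_all add: e Ide_left[OF e(1)] Ide_right[OF e(1)] sub_self[OF e(1)])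
  have "e' \<cdot> e' = sub (Ide M X \<cdot> e') (e \<cdot> e')"
    using Comp_sub_left[OF e' I e(1)] by (simp add: e'_def)
  also have "\<dots> = e'"
    using sub_Add_cancel[OF e' Zero_Hom[OF X X]]
    by (simp add: ee' Ide_left[OF e'] Add_Zero_right[OF e'])
  finally have e'e': "e' \<cdot> e' = e'" .
  obtain A p i where A: "A \<in> Obj M" "p \<in> Hom M X A" "i \<in> Hom M A X" "i \<cdot> p = e" "p \<cdot> i = Ide M A"
    using split X e unfolding idempotent_split_def by blast
  obtain B q j where B: "B \<in> Obj M" "q \<in> Hom M X B" "j \<in> Hom M B X" "j \<cdot> q = e'" "q \<cdot> j = Ide M B"
    using split X e' e'e' unfolding idempotent_split_def by blast
  \<comment> \<open>Orthogonality of the two idempotents passes to the maps that split them: insert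
    p' i' on the left and q' j' on the right.\<close>
  have cross: "p' \<cdot> j' = Zero M B' A'"
    if "p' \<in> Hom M X A'" "i' \<in> Hom M A' X" "p' \<cdot> i' = Ide M A'" "q' \<in> Hom M X B'" "j' \<in> Hom M B' X"
      "q' \<cdot> j' = Ide M B'" "(i' \<cdot> p') \<cdot> (j' \<cdot> q') = Zero M X X" for p' i' q' j' A' B'
  proof -
    have O: "A' \<in> Obj M" using Hom_Obj that(1) by blast
    have "p' \<cdot> j' = (p' \<cdot> i') \<cdot> (p' \<cdot> j') \<cdot> (q' \<cdot> j')"
      using that by (simp add: Ide_left[OF Comp_Hom[OF that(5,1)]] Ide_right[OF Comp_Hom[OF that(5,1)]])
    also have "\<dots> = p' \<cdot> (((i' \<cdot> p') \<cdot> (j' \<cdot> q')) \<cdot> j')"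
      using that(1,2,4,5) by (simp add: Hom_iff cat_simps)
    also have "\<dots> = Zero M B' A'"
      using that Comp_Zero_left[OF that(5)] Comp_Zero_right[OF that(1)] Hom_Obj[OF that(5)] by simp
    finally show ?thesis .
  qed
  have pj: "p \<cdot> j = Zero M B A"
    using cross[OF A(2,3,5) B(2,3,5)] A(4) B(4) ee' by simp
  have qi: "q \<cdot> i = Zero M A B"
    using cross[OF B(2,3,5) A(2,3,5)] A(4) B(4) e'e by simp
  interpret abelian_group "hom_space M X X" by (rule hom_abelian_group[OF X X])
  have "is_direct_sum M X [A, B]"
    unfolding is_direct_sum_iff biproduct_def
  proof (intro exI conjI allI impI)
    let ?inc = "\<lambda>n::nat. if n = 0 then i else j" and ?prj = "\<lambda>n::nat. if n = 0 then p else q"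
    show "finsum (hom_space M X X) (\<lambda>n. ?inc n \<cdot> ?prj n) {..<length [A, B]} = Ide M X"
    proof -
      have "finsum (hom_space M X X) (\<lambda>n. ?inc n \<cdot> ?prj n) {1, 0} = Add M e' e"
        using e(1) e' by (subst finsum_insert, simp_all add: A(4) B(4) Pi_def)+
          (simp add: Add_Zero_right[OF e(1)])
      also have "\<dots> = Ide M X" unfolding e'_def by (rule Add_sub_cancel[OF I e(1)])
      also have "{1, 0} = {..<length [A, B]}" by auto
      finally show ?thesis .
    qed
  qed (use X A B pj qi in \<open>auto simp: less_Suc_eq\<close>)
  then have "zero_object M A \<or> zero_object M B"
    using ind by (simp add: indecomposable_def)
  then show ?thesis
  proof
    assume "zero_object M A"
    then have "Ide M A = Zero M A A" using zero_object_iff A(1) by simp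
    then have "p = Zero M X A"
      using Ide_left[OF A(2)] Comp_Zero_left[OF A(2,1)] by simp
    then have "e = Zero M X X" using A(4) Comp_Zero_right[OF A(3) X] by simp
    then show ?thesis ..
  next
    assume "zero_object M B"
    then have "Ide M B = Zero M B B" using zero_object_iff B(1) by simp
    then have "q = Zero M X B"
      using Ide_left[OF B(2)] Comp_Zero_left[OF B(2,1)] by simp
    then have "e' = Zero M X X" using B(4) Comp_Zero_right[OF B(3) X] by simp
    then have "e = Ide M X"
      using Add_sub_cancel[OF I e(1)] Add_Zero_left[OF e(1)] by (simp add: e'_def)
    then show ?thesis ..
  qed
qed

lemma local_obj_isomorphic:
  assumes "isomorphic M X A" and A: "local_obj A"
  shows "local_obj X"
proof -
  obtain f g where fg: "f \<in> Hom M X A" "g \<in> Hom M A X" "g \<cdot> f = Ide M X" "f \<cdot> g = Ide M A"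
    using assms(1) by (rule iso_obtain)
  have X: "X \<in> Obj M" and AO: "A \<in> Obj M" using Hom_Obj[OF fg(1)] by auto
  define c where "c a = f \<cdot> (a \<cdot> g)" for a
  have c: "c a \<in> Hom M A A" if "a \<in> Hom M X X" for a
    unfolding c_def by (rule Comp_Hom[OF Comp_Hom[OF fg(2) that] fg(1)])
  have cc: "c a \<cdot> c b = c (a \<cdot> b)" if "a \<in> Hom M X X" "b \<in> Hom M X X" for a b
  proof -
    have "c a \<cdot> c b = f \<cdot> (a \<cdot> ((g \<cdot> f) \<cdot> (b \<cdot> g)))"
      unfolding c_def using that fg(1,2) by (simp add: Hom_iff cat_simps)
    then show ?thesis unfolding fg(3) c_def using that fg(1,2) by (simp add: Hom_iff cat_simps)
  qed
  have cI: "c (Ide M X) = Ide M A" unfolding c_def using fg by (simp add: Ide_left[OF fg(2)])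
  have conj_back: "g \<cdot> (c a \<cdot> f) = a" if "a \<in> Hom M X X" for a
  proof -
    have "g \<cdot> (c a \<cdot> f) = (g \<cdot> f) \<cdot> (a \<cdot> (g \<cdot> f))"
      unfolding c_def using that fg(1,2) by (simp add: Hom_iff cat_simps)
    then show ?thesis unfolding fg(3) using that by (simp add: Ide_left Ide_right)
  qed
  have unit: "unit_at A (c a) \<longleftrightarrow> unit_at X a" if a: "a \<in> Hom M X X" for a
  proof
    assume "unit_at X a"
    then obtain v where v: "v \<in> Hom M X X" "v \<cdot> a = Ide M X" "a \<cdot> v = Ide M X"
      unfolding unit_at_def by blast
    then have "c v \<cdot> c a = Ide M A" "c a \<cdot> c v = Ide M A" using cc a cI by simp_all
    then show "unit_at A (c a)" unfolding unit_at_def using c a v by blast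
  next
    assume "unit_at A (c a)"
    then obtain v where v: "v \<in> Hom M A A" "v \<cdot> c a = Ide M A" "c a \<cdot> v = Ide M A"
      unfolding unit_at_def by blast
    define w where "w = g \<cdot> (v \<cdot> f)"
    have w: "w \<in> Hom M X X" unfolding w_def by (rule Comp_Hom[OF Comp_Hom[OF fg(1) v(1)] fg(2)])
    have cw: "c w = v"
    proof -
      have "c w = (f \<cdot> g) \<cdot> (v \<cdot> (f \<cdot> g))"
        unfolding c_def w_def using v(1) fg(1,2) by (simp add: Hom_iff cat_simps)
      then show ?thesis unfolding fg(4) using v(1) by (simp add: Ide_left Ide_right)
    qed
    have "w \<cdot> a = Ide M X" "a \<cdot> w = Ide M X"
      using conj_back[OF Comp_Hom[OF a w]] conj_back[OF Comp_Hom[OF w a]] cc[OF w a] cc[OF a w] v cw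
        Ide_left[OF fg(1)] fg(3) by simp_all
    then show "unit_at X a" unfolding unit_at_def using a w by blast
  qed
  have "Ide M X \<noteq> Zero M X X"
  proof
    assume "Ide M X = Zero M X X"
    then have "f = Zero M X A"
      using Ide_right[OF fg(1)] Comp_Zero_right[OF fg(1) X] by simp
    then have "Ide M A = Zero M A A"
      using fg(4) Comp_Zero_left[OF fg(2) AO] by simp
    then show False using A by (simp add: local_obj_def)
  qed
  moreover have "c (Add M a b) = Add M (c a) (c b)" if "a \<in> Hom M X X" "b \<in> Hom M X X" for a b
    unfolding c_def
    using Comp_Add_left[OF fg(2) that] Comp_Add_right[OF Comp_Hom[OF fg(2) that(1)] Comp_Hom[OF fg(2) that(2)] fg(1)]
    by simp
  ultimately show ?thesis
    using A X unit c Add_Hom unfolding local_obj_def by metis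
qed

text \<open>Some decomposition with local summands exists. The idempotent of its first summand is
  non-zero, hence the identity, so X is isomorphic to that summand.\<close>

lemma indecomposable_local:
  assumes ind: "indecomposable M X" and split: "idempotent_split M"
    and "krull_schmidt M"
  shows "local_obj X"
proof -
  have X: "X \<in> Obj M" using ind by (simp add: indecomposable_def)
  obtain Xs where "is_direct_sum M X Xs" and Xs: "\<forall>A \<in> set Xs. local_ring (end_ring M A)"
    using assms(3) X unfolding krull_schmidt_def by blast
  then obtain inc prj where b: "biproduct X Xs inc prj" unfolding is_direct_sum_iff by blast
  have "Xs \<noteq> []"
  proof
    assume "Xs = []"
    then have "Ide M X \<in> {Zero M X X}"
      using Add_Zero_left[OF Zero_Hom[OF X X]] Zero_Hom[OF X X]
      by (intro biproduct_Ide_mem[OF b]) (auto simp: add_closed_def)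
    then show False using ind zero_object_iff[OF X] by (simp add: indecomposable_def)
  qed
  then have z: "0 < length Xs" by simp
  note m = biproduct_maps[OF b z]
  let ?A = "Xs ! 0"
  have A: "local_obj ?A" using local_objI[OF m(3)] Xs z by simp
  have pi: "prj 0 \<cdot> inc 0 = Ide M ?A" using b z by (simp add: biproduct_def)
  let ?e = "inc 0 \<cdot> prj 0"
  have "?e \<cdot> ?e = ?e"
    using Comp_assoc[OF m(4) m(2,1)] Comp_assoc[OF m(2,1,2)] pi Ide_left[OF m(2)] by simp
  moreover have "?e \<noteq> Zero M X X"
  proof
    assume "?e = Zero M X X"
    then have "inc 0 = Zero M ?A X"
      using Comp_assoc[OF m(1,2,1)] pi Ide_right[OF m(1)] Comp_Zero_left[OF m(1) X] by simp
    then have "Ide M ?A = Zero M ?A ?A" using pi Comp_Zero_right[OF m(2,3)] by simp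
    then show False using A by (simp add: local_obj_def)
  qed
  ultimately have "?e = Ide M X"
    using indecomposable_idempotent[OF ind split m(4)] by blast
  then have "isomorphic M X ?A"
    using isomorphicI[OF m(2,1)] pi by blast
  then show ?thesis using local_obj_isomorphic A by blast
qed

end

section \<open>The opposite category\<close>

text \<open>The notions used below are self-dual, so each statement about the domain of a morphism
  yields its mirror image for the codomain.\<close>

definition op_cat :: "('o, 'm, 'z) lin_cat_scheme \<Rightarrow> ('o, 'm, 'z) lin_cat_scheme"
  where "op_cat M = M\<lparr>Dom := Cod M, Cod := Dom M, Comp := \<lambda>g f. Comp M f g, Zero := \<lambda>X Y. Zero M Y X\<rparr>"

lemma op_cat_simps [simp]:
  "Obj (op_cat M) = Obj M" "Arr (op_cat M) = Arr M" "Dom (op_cat M) = Cod M" "Cod (op_cat M) = Dom M"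
  "Ide (op_cat M) = Ide M" "Comp (op_cat M) = (\<lambda>g f. Comp M f g)" "Zero (op_cat M) = (\<lambda>X Y. Zero M Y X)"
  "Add (op_cat M) = Add M" "Scale (op_cat M) = Scale M"
  by (simp_all add: op_cat_def)

lemma Hom_op [simp]: "Hom (op_cat M) X Y = Hom M Y X"
  by (auto simp: Hom_def)

lemma hom_space_op [simp]: "hom_space (op_cat M) X Y = hom_space M Y X"
  by (simp add: hom_space_def)

context linear_category
begin

lemma linear_category_op: "linear_category (op_cat M)"
proof (rule linear_category.intro)
  fix f g h :: 'm and W X Y Z
  assume "f \<in> Hom (op_cat M) W X" "g \<in> Hom (op_cat M) X Y" "h \<in> Hom (op_cat M) Y Z"
  then show "Comp (op_cat M) (Comp (op_cat M) h g) f = Comp (op_cat M) h (Comp (op_cat M) g f)"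
    using Comp_assoc[of h Z Y g X f W] by simp
qed (auto intro: Dom_Obj Cod_Obj Ide_Hom Comp_Hom Ide_left Ide_right hom_vectorspace Comp_Add_left
    Comp_Add_right Comp_Scale_left Comp_Scale_right)

lemma op_unit_at: "linear_category.unit_at (op_cat M) = unit_at"
  by (intro ext) (auto simp: linear_category.unit_at_def[OF linear_category_op] unit_at_def)

lemma op_radical: "radical (op_cat M) X Y = radical M Y X"
  by (auto simp: linear_category.radical_iff[OF linear_category_op] radical_iff_right op_unit_at)

lemma op_local_obj: "linear_category.local_obj (op_cat M) = local_obj"
  by (intro ext) (auto simp: linear_category.local_obj_def[OF linear_category_op] local_obj_def op_unit_at)

lemma op_isomorphic: "isomorphic (op_cat M) X Y \<longleftrightarrow> isomorphic M Y X"
  unfolding isomorphic_def is_iso_def by (auto simp: Hom_def)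

lemma op_is_direct_sum:
  assumes "is_direct_sum M X Xs"
  shows "is_direct_sum (op_cat M) X Xs"
proof -
  obtain inc prj where b: "biproduct X Xs inc prj"
    using assms unfolding is_direct_sum_iff by blast
  have "linear_category.biproduct (op_cat M) X Xs prj inc"
    using b unfolding linear_category.biproduct_def[OF linear_category_op] biproduct_def by auto
  then show ?thesis
    unfolding linear_category.is_direct_sum_iff[OF linear_category_op] by blast
qed

end

section \<open>Self-adjoint endofunctors\<close>

text \<open>The zigzag composites are only required to be invertible: for a module category this needs no
  further coherence, whereas equality with the identity uses the second triangle identity.\<close>

locale self_adjoint = linear_category M
  for M :: "('o, 'm, 'z) lin_cat_scheme" (structure) +
  fixes F0 :: "'o \<Rightarrow> 'o" and F1 :: "'m \<Rightarrow> 'm" and \<eta> \<epsilon> :: "'o \<Rightarrow> 'm"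
  assumes F0_Obj: "X \<in> Obj M \<Longrightarrow> F0 X \<in> Obj M"
    and F1_Hom: "f \<in> Hom M X Y \<Longrightarrow> F1 f \<in> Hom M (F0 X) (F0 Y)"
    and F1_Ide: "X \<in> Obj M \<Longrightarrow> F1 (Ide M X) = Ide M (F0 X)"
    and F1_Comp: "f \<in> Hom M X Y \<Longrightarrow> g \<in> Hom M Y Z \<Longrightarrow> F1 (g \<cdot> f) = F1 g \<cdot> F1 f"
    and F1_Add: "f \<in> Hom M X Y \<Longrightarrow> g \<in> Hom M X Y \<Longrightarrow> F1 (Add M f g) = Add M (F1 f) (F1 g)"
    and F1_Scale: "f \<in> Hom M X Y \<Longrightarrow> F1 (Scale M c f) = Scale M c (F1 f)"
    and unit_Hom: "X \<in> Obj M \<Longrightarrow> \<eta> X \<in> Hom M X (F0 (F0 X))"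
    and counit_Hom: "X \<in> Obj M \<Longrightarrow> \<epsilon> X \<in> Hom M (F0 (F0 X)) X"
    and unit_natural: "f \<in> Hom M X Y \<Longrightarrow> \<eta> Y \<cdot> f = F1 (F1 f) \<cdot> \<eta> X"
    and counit_natural: "f \<in> Hom M X Y \<Longrightarrow> f \<cdot> \<epsilon> X = \<epsilon> Y \<cdot> F1 (F1 f)"
    and counit_unit: "X \<in> Obj M \<Longrightarrow> unit_at X (\<epsilon> X \<cdot> \<eta> X)"
    and zigzag: "X \<in> Obj M \<Longrightarrow> unit_at (F0 X) (F1 (\<epsilon> X) \<cdot> \<eta> (F0 X))"
    and zigzag': "X \<in> Obj M \<Longrightarrow> unit_at (F0 X) (\<epsilon> (F0 X) \<cdot> F1 (\<eta> X))"
begin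

lemma F1_Zero: "X \<in> Obj M \<Longrightarrow> Y \<in> Obj M \<Longrightarrow> F1 (Zero M X Y) = Zero M (F0 X) (F0 Y)"
  using F1_Scale[OF Zero_Hom, of X Y 0] Scale_zero[OF Zero_Hom, of X Y]
    Scale_zero[OF F1_Hom[OF Zero_Hom], of X Y] by simp

text \<open>Reversing arrows exchanges unit and counit, the two naturality laws and the two zigzag
  conditions, while \<open>counit_unit\<close> is carried to itself.\<close>

lemma self_adjoint_op: "self_adjoint (op_cat M) F0 F1 \<epsilon> \<eta>"
proof -
  interpret op: linear_category "op_cat M" by (rule linear_category_op)
  show ?thesis
    by unfold_locales (auto simp: op_unit_at F0_Obj F1_Ide unit_natural counit_natural zigzag zigzag'
        counit_unit intro: F1_Hom F1_Comp F1_Add F1_Scale unit_Hom counit_Hom)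
qed

text \<open>The candidate is the composite of \<eta> at \<open>Y\<close>, \<open>F1 g\<close> and
  \<epsilon> at \<open>X\<close>. Naturality of \<eta> moves \<open>f\<close> past the unit, where
  \<open>g\<close> cancels it, and what remains is the invertible composite of unit and counit at
  \<open>X\<close>.\<close>

lemma reflects_split_mono:
  assumes f: "f \<in> Hom M X Y" and g: "g \<in> Hom M (F0 Y) (F0 X)" "g \<cdot> F1 f = Ide M (F0 X)"
  obtains k where "k \<in> Hom M Y X" "unit_at X (k \<cdot> f)"
proof -
  have X: "X \<in> Obj M" and Y: "Y \<in> Obj M" using Hom_Obj[OF f] by auto
  note eX = counit_Hom[OF X] and Gg = F1_Hom[OF g(1)] and hY = unit_Hom[OF Y] and FFf = F1_Hom[OF F1_Hom[OF f]]
  note Ggh = Comp_Hom[OF hY Gg]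
  have "(\<epsilon> X \<cdot> (F1 g \<cdot> \<eta> Y)) \<cdot> f = \<epsilon> X \<cdot> (F1 g \<cdot> (\<eta> Y \<cdot> f))"
    by (simp add: Comp_assoc[OF f Ggh eX] Comp_assoc[OF f hY Gg])
  also have "\<dots> = \<epsilon> X \<cdot> (F1 (g \<cdot> F1 f) \<cdot> \<eta> X)"
    by (simp add: unit_natural[OF f] F1_Comp[OF F1_Hom[OF f] g(1)]
        Comp_assoc[OF unit_Hom[OF X] FFf Gg])
  also have "\<dots> = \<epsilon> X \<cdot> \<eta> X"
    by (simp add: g(2) F1_Ide[OF F0_Obj[OF X]] Ide_left[OF unit_Hom[OF X]])
  finally have "unit_at X ((\<epsilon> X \<cdot> (F1 g \<cdot> \<eta> Y)) \<cdot> f)"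
    using counit_unit[OF X] by simp
  then show ?thesis by (rule that[OF Comp_Hom[OF Ggh eX]])
qed

lemma radical_F1_local_dom:
  assumes f: "f \<in> radical M X Y" and X: "local_obj X" and FX: "local_obj (F0 X)"
  shows "F1 f \<in> radical M (F0 X) (F0 Y)"
proof (rule ccontr)
  note F = radical_Hom[OF f]
  assume nr: "F1 f \<notin> radical M (F0 X) (F0 Y)"
  obtain g where "g \<in> Hom M (F0 Y) (F0 X)" "g \<cdot> F1 f = Ide M (F0 X)"
    by (rule not_radical_split_mono[OF FX F1_Hom[OF F] nr])
  then obtain k where "k \<in> Hom M Y X" "unit_at X (k \<cdot> f)"
    by (rule reflects_split_mono[OF F])
  then show False
    using split_mono_not_radical[OF f] X by (simp add: local_obj_def)
qed

lemma radical_F1_local_cod: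
  "f \<in> radical M X Y \<Longrightarrow> local_obj Y \<Longrightarrow> local_obj (F0 Y) \<Longrightarrow> F1 f \<in> radical M (F0 X) (F0 Y)"
  using self_adjoint.radical_F1_local_dom[OF self_adjoint_op, of f Y X] by (simp add: op_radical op_local_obj)

lemma unit_at_cancel_left:
  assumes u: "unit_at Y u" and q: "q \<in> Hom M X Y" and r: "u \<cdot> q \<in> radical M X Y"
  shows "q \<in> radical M X Y"
proof -
  obtain v where v: "u \<in> Hom M Y Y" "v \<in> Hom M Y Y" "v \<cdot> u = Ide M Y"
    using u unfolding unit_at_def by blast
  have "v \<cdot> (u \<cdot> q) = q"
    using Comp_assoc[OF q v(1,2)] v(3) Ide_left[OF q] by simp
  then show ?thesis using radical_Comp_left[OF r v(2)] by simp
qed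

text \<open>Write \<open>r\<close> for \<open>p \<cdot> F1 f\<close>. Its adjunct \<open>F1 r \<cdot> \<eta> A\<close> factors through the radical morphism \<open>f\<close>.
  Every morphism from \<open>F0 A\<close> to \<open>B\<close> is a multiple of \<open>r\<close> plus a radical one, so all adjuncts,
  that is all morphisms from \<open>A\<close> to \<open>F0 B\<close>, are radical.\<close>

lemma all_radical_dom:
  assumes f: "f \<in> radical M A D" and p: "p \<in> Hom M (F0 D) B" and q: "q \<in> Hom M B (F0 A)"
    and unit: "unit_at B (p \<cdot> (F1 f \<cdot> q))"
    and adj: "\<And>r. r \<in> radical M (F0 A) B \<Longrightarrow> F1 r \<cdot> \<eta> A \<in> radical M A (F0 B)"
    and split: "\<And>r. r \<in> Hom M (F0 A) B \<Longrightarrow> r \<cdot> q = Zero M B B \<Longrightarrow> r \<in> radical M (F0 A) B"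
    and x: "x \<in> Hom M A (F0 B)"
  shows "x \<in> radical M A (F0 B)"
proof -
  note F = radical_Hom[OF f]
  have A: "A \<in> Obj M" and B: "B \<in> Obj M" and D: "D \<in> Obj M" using Hom_Obj[OF F] Hom_Obj[OF p] by auto
  define r where "r = p \<cdot> F1 f"
  have r: "r \<in> Hom M (F0 A) B" unfolding r_def by (rule Comp_Hom[OF F1_Hom[OF F] p])
  have "unit_at B (r \<cdot> q)" using unit by (simp add: r_def Comp_assoc[OF q F1_Hom[OF F] p])
  then obtain v where v: "v \<in> Hom M B B" "v \<cdot> (r \<cdot> q) = Ide M B"
    unfolding unit_at_def by blast
  define y where "y = \<epsilon> B \<cdot> F1 x"
  note Fx = F1_Hom[OF x] and eB = counit_Hom[OF B]
  have y: "y \<in> Hom M (F0 A) B" unfolding y_def by (rule Comp_Hom[OF Fx eB])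
  \<comment> \<open>The coefficient for which \<open>a \<cdot> r\<close> and \<open>y\<close> agree
    after composition with \<open>q\<close>, so that their difference falls under
    \<open>split\<close>.\<close>
  define a where "a = (y \<cdot> q) \<cdot> v"
  note yq = Comp_Hom[OF q y] and rq = Comp_Hom[OF q r]
  have a: "a \<in> Hom M B B" unfolding a_def by (rule Comp_Hom[OF v(1) yq])
  note ar = Comp_Hom[OF r a]
  have "(a \<cdot> r) \<cdot> q = (y \<cdot> q) \<cdot> (v \<cdot> (r \<cdot> q))"
    unfolding a_def using Comp_assoc[OF q r Comp_Hom[OF v(1) yq]] Comp_assoc[OF rq v(1) yq] by simp
  then have arq: "(a \<cdot> r) \<cdot> q = y \<cdot> q" using v(2) Ide_right[OF yq] by simp
  define s where "s = sub y (a \<cdot> r)"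
  have s: "s \<in> Hom M (F0 A) B" unfolding s_def by (rule sub_Hom[OF y ar])
  have "s \<cdot> q = Zero M B B"
    unfolding s_def Comp_sub_left[OF q y ar] arq by (rule sub_self[OF yq])
  then have srad: "s \<in> radical M (F0 A) B" by (rule split[OF s])
  have "F1 r \<cdot> \<eta> A = F1 p \<cdot> (\<eta> D \<cdot> f)"
    unfolding r_def
    by (simp add: F1_Comp[OF F1_Hom[OF F] p] unit_natural[OF F]
        Comp_assoc[OF unit_Hom[OF A] F1_Hom[OF F1_Hom[OF F]] F1_Hom[OF p]])
  also have "\<dots> \<in> radical M A (F0 B)"
    by (rule radical_Comp_left[OF radical_Comp_left[OF f unit_Hom[OF D]] F1_Hom[OF p]])
  finally have "F1 a \<cdot> (F1 r \<cdot> \<eta> A) \<in> radical M A (F0 B)"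
    using radical_Comp_left F1_Hom[OF a] by blast
  then have "F1 (a \<cdot> r) \<cdot> \<eta> A \<in> radical M A (F0 B)"
    by (simp add: F1_Comp[OF r a] Comp_assoc[OF unit_Hom[OF A] F1_Hom[OF r] F1_Hom[OF a]])
  then have "Add M (F1 s \<cdot> \<eta> A) (F1 (a \<cdot> r) \<cdot> \<eta> A) \<in> radical M A (F0 B)"
    by (rule radical_Add[OF adj[OF srad]])
  moreover have "y = Add M s (a \<cdot> r)"
    unfolding s_def using Add_sub_cancel[OF y ar] by simp
  then have "F1 y \<cdot> \<eta> A = Add M (F1 s \<cdot> \<eta> A) (F1 (a \<cdot> r) \<cdot> \<eta> A)"
    using F1_Add[OF s ar] Comp_Add_left[OF unit_Hom[OF A] F1_Hom[OF s] F1_Hom[OF ar]] by simp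
  \<comment> \<open>Taking the adjunct twice returns \<open>x\<close> only up to the zigzag unit,
    which is cancelled at the end.\<close>
  moreover have "F1 y \<cdot> \<eta> A = (F1 (\<epsilon> B) \<cdot> \<eta> (F0 B)) \<cdot> x"
    unfolding y_def
    by (simp add: F1_Comp[OF Fx eB] Comp_assoc[OF unit_Hom[OF A] F1_Hom[OF Fx] F1_Hom[OF eB]]
        Comp_assoc[OF x unit_Hom[OF F0_Obj[OF B]] F1_Hom[OF eB]] unit_natural[OF x])
  ultimately show ?thesis
    using unit_at_cancel_left[OF zigzag[OF B] x] by simp
qed

lemma F1_pow: "f \<in> Hom M X X \<Longrightarrow> F1 (pow X f n) = pow (F0 X) (F1 f) n"
  by (induction n) (auto simp: pow_0 pow_Suc F1_Ide Hom_Obj F1_Comp[OF pow_Hom])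

lemma add_unit_radical:
  assumes X: "local_obj X" and a: "a \<in> Hom M X X" "unit_at X a" and r: "r \<in> radical M X X"
  shows "unit_at X (Add M a r)"
proof (rule ccontr)
  note R = radical_Hom[OF r]
  assume "\<not> unit_at X (Add M a r)"
  then have "Add M a r \<in> radical M X X"
    using local_radical_end_iff[OF X Add_Hom[OF a(1) R]] by simp
  then have "sub (Add M a r) r \<in> radical M X X"
    by (rule radical_Add[OF _ radical_Scale[OF r]])
  then have "a \<in> radical M X X" by (simp add: sub_Add_cancel[OF a(1) R])
  then show False using local_radical_end_iff[OF X a(1)] a(2) by simp
qed

text \<open>Modulo the radical the matrix of \<open>t\<close> is diagonal, because its summands are
  pairwise non-isomorphic. Diagonal entries of powers are thus powers of diagonal entries up to
  radical terms, and a unit entry would stay a unit in the zero power.\<close>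

lemma nilpotent_diagonal:
  assumes b: "biproduct X Xs inc prj"
    and loc: "\<And>j. j < length Xs \<Longrightarrow> local_obj (Xs ! j)"
    and dist: "\<And>i j. i < length Xs \<Longrightarrow> j < length Xs \<Longrightarrow> isomorphic M (Xs ! i) (Xs ! j) \<Longrightarrow> i = j"
    and t: "t \<in> Hom M X X" and nil: "pow X t n = Zero M X X" and k: "k < length Xs"
  shows "\<not> unit_at (Xs ! k) (prj k \<cdot> (t \<cdot> inc k))"
proof
  let ?A = "Xs ! k"
  note m = biproduct_maps[OF b]
  assume unit: "unit_at ?A (prj k \<cdot> (t \<cdot> inc k))"
  have A: "?A \<in> Obj M" by (rule m(3)[OF k])
  have "unit_at ?A (prj k \<cdot> (pow X t i \<cdot> inc k))" for i
  proof (induction i)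
    case 0
    have "prj k \<cdot> (Ide M X \<cdot> inc k) = Ide M ?A"
      using b k Ide_left[OF m(1)[OF k]] by (simp add: biproduct_def)
    then show ?case using unit_at_Ide[OF A] by (simp add: pow_0)
  next
    case (Suc i)
    note T = pow_Hom[OF t, of i]
    define w where "w = pow X t i \<cdot> inc k"
    have w: "w \<in> Hom M ?A X" unfolding w_def by (rule Comp_Hom[OF m(1)[OF k] T])
    note pt = Comp_Hom[OF t m(2)[OF k]]
    define u where "u = (prj k \<cdot> t \<cdot> inc k) \<cdot> (prj k \<cdot> w)"
    note pti = Comp_Hom[OF m(1)[OF k] pt] and pw = Comp_Hom[OF w m(2)[OF k]]
    have u: "u \<in> Hom M ?A ?A" unfolding u_def by (rule Comp_Hom[OF pw pti])
    have uu: "unit_at ?A u"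
      unfolding u_def Comp_assoc[OF m(1)[OF k] t m(2)[OF k]] w_def by (rule unit_at_Comp[OF unit Suc])
    \<comment> \<open>Row \<open>k\<close> of \<open>t\<close> with its diagonal entry removed; what
      is left has only radical components.\<close>
    define g where "g = sub (prj k \<cdot> t) ((prj k \<cdot> t \<cdot> inc k) \<cdot> prj k)"
    note pd = Comp_Hom[OF m(2)[OF k] pti]
    have g: "g \<in> Hom M X ?A" unfolding g_def by (rule sub_Hom[OF pt pd])
    have "g \<in> radical M X ?A"
    proof (rule biproduct_radical_right[OF b g])
      fix j assume j: "j < length Xs"
      show "g \<cdot> inc j \<in> radical M (Xs ! j) ?A"
      proof (cases "j = k")
        case True
        have "prj k \<cdot> inc k = Ide M ?A" using b k by (simp add: biproduct_def)
        then have "g \<cdot> inc k = Zero M ?A ?A"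
          unfolding g_def using Comp_sub_left[OF m(1)[OF k] pt pd] Comp_assoc[OF m(1,2)[OF k] pti]
            Ide_right[OF pti] sub_self[OF pti] by simp
        then show ?thesis using radical_Zero[OF A A] True by simp
      next
        case False
        then show ?thesis
          using local_not_radical_isomorphic[OF loc[OF j] loc[OF k] Comp_Hom[OF m(1)[OF j] g]] dist[OF j k] by blast
      qed
    qed
    then have "g \<cdot> w \<in> radical M ?A ?A" by (rule radical_Comp_right[OF _ w])
    then have "unit_at ?A (Add M u (g \<cdot> w))"
      by (rule add_unit_radical[OF loc[OF k] u uu])
    moreover have "g \<cdot> w = sub ((prj k \<cdot> t) \<cdot> w) u"
      unfolding g_def u_def using Comp_sub_left[OF w pt pd] Comp_assoc[OF w m(2)[OF k] pti] by simp
    then have "Add M u (g \<cdot> w) = (prj k \<cdot> t) \<cdot> w"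
      using Add_comm[OF u sub_Hom[OF Comp_Hom[OF w pt] u]] Add_sub_cancel[OF Comp_Hom[OF w pt] u] by simp
    moreover have "(prj k \<cdot> t) \<cdot> w = prj k \<cdot> (pow X t (Suc i) \<cdot> inc k)"
      unfolding w_def pow_Suc
      using Comp_assoc[OF Comp_Hom[OF m(1)[OF k] T] t m(2)[OF k]] Comp_assoc[OF m(1)[OF k] T t] by simp
    ultimately show ?case by simp
  qed
  from this[of n] have "unit_at ?A (Zero M ?A ?A)"
    using nil Comp_Zero_left[OF m(1)[OF k]] Comp_Zero_right[OF m(2)[OF k] A] Hom_Obj[OF t] by simp
  moreover have "Zero M ?A ?A \<in> radical M ?A ?A" by (rule radical_Zero[OF A A])
  ultimately show False
    using local_radical_end_iff[OF loc[OF k] Zero_Hom[OF A A]] by simp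
qed

lemma radical_F1_end:
  assumes fd: "vectorspace.fin_dim class_ring (hom_space M X X)" and f: "f \<in> radical M X X"
    and b: "biproduct (F0 X) Xs inc prj"
    and loc: "\<And>j. j < length Xs \<Longrightarrow> local_obj (Xs ! j)"
    and dist: "\<And>i j. i < length Xs \<Longrightarrow> j < length Xs \<Longrightarrow> isomorphic M (Xs ! i) (Xs ! j) \<Longrightarrow> i = j"
  shows "F1 f \<in> radical M (F0 X) (F0 X)"
proof -
  note F = F1_Hom[OF radical_Hom[OF f]] and m = biproduct_maps[OF b]
  have X: "X \<in> Obj M" using Hom_Obj[OF radical_Hom[OF f]] by simp
  obtain n where "pow X f n = Zero M X X" by (rule radical_nilpotent[OF fd f])
  then have nil: "pow (F0 X) (F1 f) n = Zero M (F0 X) (F0 X)"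
    using F1_pow[OF radical_Hom[OF f], of n] F1_Zero[OF X X] by simp
  show ?thesis
  proof (rule biproduct_radical_right[OF b F], rule biproduct_radical_left[OF b])
    fix j k assume j: "j < length Xs" and k: "k < length Xs"
    note pf = Comp_Hom[OF Comp_Hom[OF m(1)[OF j] F] m(2)[OF k]]
    show "prj k \<cdot> (F1 f \<cdot> inc j) \<in> radical M (Xs ! j) (Xs ! k)"
    proof (cases "j = k")
      case True
      then show ?thesis
        using nilpotent_diagonal[OF b loc dist F nil k] local_radical_end_iff[OF loc[OF k]] pf by auto
    next
      case False
      then show ?thesis
        using local_not_radical_isomorphic[OF loc[OF j] loc[OF k] pf] dist[OF j k] by blast
    qed
  qed (rule Comp_Hom[OF m(1) F])
qed

end

section \<open>Induction along the diagram of type D_infinity, whose nodes 0 and 1 are the prongs of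
  the fork at 2\<close>

definition neighbours :: "nat \<Rightarrow> nat list"
  where "neighbours i = (if i < 2 then [2] else if i = 2 then [0, 1, 3] else [i - 1, i + 1])"

lemma distinct_neighbours: "distinct (neighbours i)"
  by (auto simp: neighbours_def)

locale D_infinity = self_adjoint +
  fixes Y :: "nat \<Rightarrow> 'a"
  assumes loc: "local_obj (Y i)"
    and dist: "isomorphic M (Y i) (Y j) \<Longrightarrow> i = j"
    and fd: "vectorspace.fin_dim class_ring (hom_space M (Y i) (Y i))"
    and ends: "i < 2 \<Longrightarrow> local_obj (F0 (Y i))"
    and sums: "is_direct_sum M (F0 (Y i)) (map Y (neighbours i))"
begin

definition F1_radical :: "nat \<Rightarrow> nat \<Rightarrow> bool"
  where "F1_radical i j \<longleftrightarrow> (\<forall>f \<in> radical M (Y i) (Y j). F1 f \<in> radical M (F0 (Y i)) (F0 (Y j)))"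

lemma Y_Obj: "Y i \<in> Obj M"
  using loc[of i] by (simp add: local_obj_def)

lemma biproduct_obtain:
  obtains inc prj where "biproduct (F0 (Y i)) (map Y (neighbours i)) inc prj"
  using sums[of i] unfolding is_direct_sum_iff by blast

lemma distinct_radical: "i \<noteq> j \<Longrightarrow> f \<in> Hom M (Y i) (Y j) \<Longrightarrow> f \<in> radical M (Y i) (Y j)"
  using local_not_radical_isomorphic[OF loc loc] dist by blast

lemma F1_radical_end: "F1_radical i i"
  unfolding F1_radical_def
proof
  fix f assume f: "f \<in> radical M (Y i) (Y i)"
  obtain inc prj where b: "biproduct (F0 (Y i)) (map Y (neighbours i)) inc prj" by (rule biproduct_obtain)
  show "F1 f \<in> radical M (F0 (Y i)) (F0 (Y i))"
  proof (rule radical_F1_end[OF fd f b])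
    fix j k assume "j < length (map Y (neighbours i))" "k < length (map Y (neighbours i))"
      "isomorphic M (map Y (neighbours i) ! j) (map Y (neighbours i) ! k)"
    then show "j = k"
      using dist[of "neighbours i ! j" "neighbours i ! k"]
        nth_eq_iff_index_eq[OF distinct_neighbours[of i], of j k] by simp
  qed (simp add: loc)
qed

lemma F1_radical_low: "i < 2 \<or> j < 2 \<Longrightarrow> F1_radical i j"
  unfolding F1_radical_def using radical_F1_local_dom[OF _ loc ends] radical_F1_local_cod[OF _ loc ends] by blast

text \<open>Some matrix entry of \<open>F1 f\<close> is not radical. Such an entry joins isomorphic
  summands, so it sits at a common neighbour and is a unit there.\<close>

lemma not_F1_radical:
  assumes f: "f \<in> Hom M (Y i) (Y j)" and nr: "F1 f \<notin> radical M (F0 (Y i)) (F0 (Y j))"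
    and bi: "biproduct (F0 (Y i)) (map Y (neighbours i)) inci prji"
    and bj: "biproduct (F0 (Y j)) (map Y (neighbours j)) incj prjj"
  obtains a b where "a < length (neighbours i)" "b < length (neighbours j)"
    "neighbours i ! a = neighbours j ! b"
    "unit_at (Y (neighbours i ! a)) (prjj b \<cdot> (F1 f \<cdot> inci a))"
proof -
  note F = F1_Hom[OF f] and mi = biproduct_maps[OF bi] and mj = biproduct_maps[OF bj]
  obtain a where a: "a < length (map Y (neighbours i))"
    "F1 f \<cdot> inci a \<notin> radical M (map Y (neighbours i) ! a) (F0 (Y j))"
    using biproduct_radical_right[OF bi F] nr by blast
  obtain b where b: "b < length (map Y (neighbours j))"
    "prjj b \<cdot> (F1 f \<cdot> inci a) \<notin> radical M (map Y (neighbours i) ! a) (map Y (neighbours j) ! b)"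
    using biproduct_radical_left[OF bj Comp_Hom[OF mi(1)[OF a(1)] F]] a(2) by blast
  have h: "prjj b \<cdot> (F1 f \<cdot> inci a) \<in> Hom M (map Y (neighbours i) ! a) (map Y (neighbours j) ! b)"
    by (rule Comp_Hom[OF Comp_Hom[OF mi(1)[OF a(1)] F] mj(2)[OF b(1)]])
  have eq: "neighbours i ! a = neighbours j ! b"
    using distinct_radical[of "neighbours i ! a" "neighbours j ! b"] h b a by auto
  show ?thesis
    by (rule that[of a b]) (use a b h eq local_radical_end_iff[OF loc] in auto)
qed

lemma F1_radical_no_common:
  assumes "set (neighbours i) \<inter> set (neighbours j) = {}"
  shows "F1_radical i j"
  unfolding F1_radical_def
proof (rule ballI, rule ccontr)
  fix f assume f: "f \<in> radical M (Y i) (Y j)" and nr: "F1 f \<notin> radical M (F0 (Y i)) (F0 (Y j))"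
  obtain inci prji where bi: "biproduct (F0 (Y i)) (map Y (neighbours i)) inci prji" by (rule biproduct_obtain)
  obtain incj prjj where bj: "biproduct (F0 (Y j)) (map Y (neighbours j)) incj prjj" by (rule biproduct_obtain)
  obtain a b where "a < length (neighbours i)" "b < length (neighbours j)" "neighbours i ! a = neighbours j ! b"
    by (rule not_F1_radical[OF radical_Hom[OF f] nr bi bj])
  then show False using assms by (metis disjoint_iff nth_mem)
qed

text \<open>The morphism that contradicts the conclusion of \<open>all_radical_dom\<close>: the
  inclusion of a summand is a split monomorphism.\<close>

lemma inclusion_not_radical:
  assumes b: "biproduct (F0 (Y k)) (map Y (neighbours k)) inc prj" and i: "i \<in> set (neighbours k)"
  shows "\<exists>x \<in> Hom M (Y i) (F0 (Y k)). x \<notin> radical M (Y i) (F0 (Y k))"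
proof -
  obtain c where c: "c < length (map Y (neighbours k))" "map Y (neighbours k) ! c = Y i"
    using i by (metis in_set_conv_nth length_map nth_map)
  note m = biproduct_maps[OF b c(1), unfolded c(2)]
  have u: "unit_at (Y i) (prj c \<cdot> inc c)"
    using b c unit_at_Ide[OF Y_Obj[of i]] by (auto simp: biproduct_def)
  have nz: "Ide M (Y i) \<noteq> Zero M (Y i) (Y i)" using loc[of i] by (simp add: local_obj_def)
  show ?thesis
    using split_mono_not_radical[OF _ m(2) u] m(1) nz by blast
qed

text \<open>A unit entry of \<open>F1 f\<close> can occur only at the single common neighbour
  \<open>k\<close>, where its projection and inclusion serve as \<open>p\<close> and
  \<open>q\<close> in \<open>all_radical_dom\<close>. The adjunction hypothesis of that lemma
  follows from \<open>IH\<close>, and its conclusion is refuted by the inclusion of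
  \<open>Y i\<close> into \<open>F0 (Y k)\<close>.\<close>

lemma F1_radical_dom_step:
  assumes common: "set (neighbours i) \<inter> set (neighbours j) \<subseteq> {k}" and ki: "i \<in> set (neighbours k)"
    and IH: "\<And>l. l \<in> set (neighbours i) \<Longrightarrow> F1_radical l k"
  shows "F1_radical i j"
  unfolding F1_radical_def
proof (rule ballI, rule ccontr)
  fix f assume f: "f \<in> radical M (Y i) (Y j)" and nr: "F1 f \<notin> radical M (F0 (Y i)) (F0 (Y j))"
  let ?N = "map Y (neighbours i)"
  obtain inci prji where bi: "biproduct (F0 (Y i)) ?N inci prji" by (rule biproduct_obtain)
  obtain incj prjj where bj: "biproduct (F0 (Y j)) (map Y (neighbours j)) incj prjj" by (rule biproduct_obtain)
  obtain inck prjk where bk: "biproduct (F0 (Y k)) (map Y (neighbours k)) inck prjk" by (rule biproduct_obtain)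
  obtain a b where a: "a < length (neighbours i)" and b: "b < length (neighbours j)"
    and ab: "neighbours i ! a = neighbours j ! b"
    and u: "unit_at (Y (neighbours i ! a)) (prjj b \<cdot> (F1 f \<cdot> inci a))"
    by (rule not_F1_radical[OF radical_Hom[OF f] nr bi bj])
  have k: "neighbours i ! a = k" "neighbours j ! b = k"
    using common ab a b by (metis IntI nth_mem singletonD subsetD)+
  note mi = biproduct_maps[OF bi, simplified] and mj = biproduct_maps[OF bj, simplified]
  have q: "inci a \<in> Hom M (Y k) (F0 (Y i))" and p: "prjj b \<in> Hom M (F0 (Y j)) (Y k)"
    using mi(1)[OF a] mj(2)[OF b] a b k by simp_all
  have "x \<in> radical M (Y i) (F0 (Y k))" if x: "x \<in> Hom M (Y i) (F0 (Y k))" for x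
  proof (rule all_radical_dom[OF f p q u[unfolded k] _ _ x])
    fix r assume r: "r \<in> radical M (F0 (Y i)) (Y k)"
    note R = radical_Hom[OF r]
    \<comment> \<open>The assumption \<open>IH\<close> covers the restrictions of \<open>r\<close>
      to the summands of \<open>F0 (Y i)\<close>; additivity of this set extends it to
      \<open>r\<close> itself.\<close>
    define I where "I = {r \<in> Hom M (F0 (Y i)) (Y k). F1 r \<in> radical M (F0 (F0 (Y i))) (F0 (Y k))}"
    have "r \<in> I"
    proof (rule biproduct_mem_right[OF bi R])
      show "add_closed (F0 (Y i)) (Y k) I"
        using F1_Zero[OF F0_Obj[OF Y_Obj[of i]] Y_Obj[of k]] F0_Obj Y_Obj
        by (auto simp: add_closed_def I_def Zero_Hom Add_Hom radical_Zero F1_Add radical_Add)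
      fix l assume l: "l < length ?N"
      then have l': "l < length (neighbours i)" by simp
      note rl = radical_Comp_right[OF r mi(1)[OF l']]
      have "F1 (r \<cdot> inci l) \<in> radical M (F0 (Y (neighbours i ! l))) (F0 (Y k))"
        using IH[of "neighbours i ! l"] rl l' by (simp add: F1_radical_def)
      then have "F1 (r \<cdot> inci l) \<cdot> F1 (prji l) \<in> radical M (F0 (F0 (Y i))) (F0 (Y k))"
        using radical_Comp_right F1_Hom[OF mi(2)[OF l']] l' by simp
      then show "(r \<cdot> inci l) \<cdot> prji l \<in> I"
        using Comp_Hom[OF mi(2)[OF l'] radical_Hom[OF rl]] F1_Comp[OF mi(2)[OF l'] radical_Hom[OF rl]]
        by (simp add: I_def)
    qed
    then have "F1 r \<in> radical M (F0 (F0 (Y i))) (F0 (Y k))" by (simp add: I_def)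
    then show "F1 r \<cdot> \<eta> (Y i) \<in> radical M (Y i) (F0 (Y k))"
      by (rule radical_Comp_right[OF _ unit_Hom[OF Y_Obj]])
  next
    \<comment> \<open>Since \<open>Y k\<close> occurs only once in \<open>F0 (Y i)\<close>, all
      components other than \<open>a\<close> are radical automatically, and component
      \<open>a\<close> is zero.\<close>
    fix r assume r: "r \<in> Hom M (F0 (Y i)) (Y k)" and z: "r \<cdot> inci a = Zero M (Y k) (Y k)"
    show "r \<in> radical M (F0 (Y i)) (Y k)"
    proof (rule biproduct_radical_right[OF bi r])
      fix l assume "l < length ?N"
      then have l: "l < length (neighbours i)" by simp
      show "r \<cdot> inci l \<in> radical M (?N ! l) (Y k)"
      proof (cases "l = a")
        case True
        then show ?thesis using z k a radical_Zero[OF Y_Obj Y_Obj] by simp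
      next
        case False
        then have "neighbours i ! l \<noteq> k"
          using k(1) a l distinct_neighbours[of i] nth_eq_iff_index_eq by metis
        then show ?thesis
          using distinct_radical[of "neighbours i ! l" k] Comp_Hom[OF mi(1)[OF l] r] l by simp
      qed
    qed
  qed
  then show False using inclusion_not_radical[OF bk ki] by blast
qed

lemma D_infinity_op: "D_infinity (op_cat M) F0 F1 \<epsilon> \<eta> Y"
proof -
  interpret op: self_adjoint "op_cat M" F0 F1 \<epsilon> \<eta> by (rule self_adjoint_op)
  show ?thesis
    using dist by unfold_locales
      (auto simp: op_local_obj op_isomorphic loc fd ends intro: op_is_direct_sum[OF sums])
qed

text \<open>The opposite category is again an instance of the locale, with the two indices of
  \<open>F1_radical\<close> exchanged.\<close>

lemma F1_radical_cod_step:
  assumes "set (neighbours i) \<inter> set (neighbours j) \<subseteq> {k}" "j \<in> set (neighbours k)"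
    and "\<And>l. l \<in> set (neighbours j) \<Longrightarrow> F1_radical k l"
  shows "F1_radical i j"
proof -
  have op: "D_infinity.F1_radical (op_cat M) F0 F1 Y l m = F1_radical m l" for l m
    unfolding D_infinity.F1_radical_def[OF D_infinity_op] F1_radical_def op_radical ..
  show ?thesis
    using D_infinity.F1_radical_dom_step[OF D_infinity_op, of j i k] assms unfolding op by blast
qed

text \<open>The common neighbour of m and m + 2 is k = m + 1. At m = 2 the neighbours 0 and 1 are
  low and 3 equals k, so the steps apply outright. Afterwards the neighbours of m + 1 are m, at
  distance two from the new k = m + 2 and covered by induction, and k itself.\<close>

lemma F1_radical_distance_two: "2 \<le> m \<Longrightarrow> F1_radical m (m + 2) \<and> F1_radical (m + 2) m"
proof (induction m rule: dec_induct)
  case base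
  have "F1_radical l 3" "F1_radical 3 l" if "l \<in> set (neighbours 2)" for l
    using that F1_radical_low[of l 3] F1_radical_low[of 3 l] F1_radical_end[of 3]
    by (auto simp: neighbours_def)
  then show ?case
    using F1_radical_dom_step[of 2 4 3] F1_radical_cod_step[of 4 2 3] by (auto simp: neighbours_def)
next
  case (step m)
  then have "F1_radical l (m + 2)" "F1_radical (m + 2) l" if "l \<in> set (neighbours (Suc m))" for l
    using that F1_radical_end[of "m + 2"] by (auto simp: neighbours_def)
  then show ?case
    using step.hyps F1_radical_dom_step[of "Suc m" "m + 3" "m + 2"] F1_radical_cod_step[of "m + 3" "Suc m" "m + 2"]
    by (auto simp: neighbours_def numeral_3_eq_3)
qed

theorem F1_preserves_radical: "F1_radical i j"
proof -
  consider "i = j" | "i < 2 \<or> j < 2" | "2 \<le> i" "j = i + 2" | "2 \<le> j" "i = j + 2"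
    | "2 \<le> i" "2 \<le> j" "i \<noteq> j" "j \<noteq> i + 2" "i \<noteq> j + 2" by linarith
  then show ?thesis
  proof cases
    case 5
    then show ?thesis
      by (intro F1_radical_no_common) (auto simp: neighbours_def)
  qed (use F1_radical_end F1_radical_low F1_radical_distance_two in auto)
qed

end

section \<open>A ring of linear operators\<close>

text \<open>Matrices of all sizes are embedded into one ring, so that type class algebra applies to them;
  the identity matrix of size \<open>n\<close> becomes the idempotent \<open>pr n\<close>.\<close>

typedef endo = "{f :: (nat \<Rightarrow> complex) \<Rightarrow> nat \<Rightarrow> complex.
    (\<forall>x y. f (\<lambda>i. x i + y i) = (\<lambda>i. f x i + f y i)) \<and> (\<forall>c x. f (\<lambda>i. c * x i) = (\<lambda>i. c * f x i))}"
  morphisms app Endo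
  by (rule exI[of _ "\<lambda>x. x"]) auto

setup_lifting type_definition_endo

lemma app_add: "app f (\<lambda>i. x i + y i) = (\<lambda>i. app f x i + app f y i)"
  using app[of f] by auto

lemma app_scale: "app f (\<lambda>i. c * x i) = (\<lambda>i. c * app f x i)"
  using app[of f] by auto

lemma app_zero: "app f (\<lambda>i. 0) = (\<lambda>i. 0)"
  using app_scale[of f 0] by auto

lemma app_sum: "app f (\<lambda>i. \<Sum>j\<in>S. x j i) = (\<lambda>i. \<Sum>j\<in>S. app f (x j) i)"
  by (induction S rule: infinite_finite_induct) (auto simp: app_zero app_add)

lemma endo_eqI: "(\<And>x i. app f x i = app g x i) \<Longrightarrow> f = g"
  by (metis app_inject ext)

instantiation endo :: ring_1
begin

lift_definition zero_endo :: endo is "\<lambda>x i. 0" by auto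
lift_definition one_endo :: endo is "\<lambda>x. x" by auto
lift_definition plus_endo :: "endo \<Rightarrow> endo \<Rightarrow> endo" is "\<lambda>f g x i. f x i + g x i"
  by (auto simp: algebra_simps)
lift_definition minus_endo :: "endo \<Rightarrow> endo \<Rightarrow> endo" is "\<lambda>f g x i. f x i - g x i"
  by (auto simp: algebra_simps)
lift_definition uminus_endo :: "endo \<Rightarrow> endo" is "\<lambda>f x i. - f x i"
  by (auto simp: algebra_simps)
lift_definition times_endo :: "endo \<Rightarrow> endo \<Rightarrow> endo" is "\<lambda>f g x. f (g x)"
  by auto

instance
proof
  fix a b c :: endo
  show "a + b + c = a + (b + c)" "a + b = b + a" "0 + a = a" "- a + a = 0" "a - b = a + - b"
    "a * b * c = a * (b * c)" "1 * a = a" "a * 1 = a" "(a + b) * c = a * c + b * c"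
    by (auto intro!: endo_eqI simp: zero_endo.rep_eq one_endo.rep_eq plus_endo.rep_eq
        minus_endo.rep_eq uminus_endo.rep_eq times_endo.rep_eq)
  show "a * (b + c) = a * b + a * c"
    by (auto intro!: endo_eqI simp: plus_endo.rep_eq[abs_def] times_endo.rep_eq app_add)
  show "(0::endo) \<noteq> 1"
  proof
    assume "(0::endo) = 1"
    then have "app 0 (\<lambda>i. 1) 0 = app 1 (\<lambda>i. 1) 0" by simp
    then show False by (simp add: zero_endo.rep_eq one_endo.rep_eq)
  qed
qed

end

lift_definition sc :: "complex \<Rightarrow> endo" is "\<lambda>c x i. c * x i"
  by (auto simp: algebra_simps)

lemmas app_simps = zero_endo.rep_eq one_endo.rep_eq plus_endo.rep_eq minus_endo.rep_eq
  uminus_endo.rep_eq times_endo.rep_eq sc.rep_eq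

lemma sc_hom [simp]:
  "sc 0 = 0" "sc 1 = 1" "sc (a + b) = sc a + sc b" "sc (a - b) = sc a - sc b" "sc (- a) = - sc a"
  "sc (a * b) = sc a * sc b"
  by (auto intro!: endo_eqI simp: app_simps algebra_simps)

lemma sc_of_nat [simp]: "sc (of_nat n) = of_nat n"
  by (induction n) auto

lemma sc_commute: "a * sc c = sc c * a"
  by (auto intro!: endo_eqI simp: app_simps app_scale)

lemma sc_left_commute: "a * (sc c * b) = sc c * (a * b)"
  by (metis mult.assoc sc_commute)

lemma sc_cancel: "sc c * a = 0 \<Longrightarrow> c \<noteq> 0 \<Longrightarrow> a = 0"
  by (metis left_inverse mult.assoc mult_1 mult_zero_right sc_hom(2) sc_hom(6))

interpretation endo_vs: vector_space "\<lambda>c a. sc c * a"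
  by unfold_locales (auto simp: algebra_simps)

declare endo_vs.scale_scale [simp del] endo_vs.scale_cancel_left [simp del]

lemma app_sum_endo: "app (\<Sum>j\<in>S. f j) x i = (\<Sum>j\<in>S. app (f j) x i)"
  by (induction S rule: infinite_finite_induct) (auto simp: app_simps)

definition bvec :: "nat \<Rightarrow> nat \<Rightarrow> complex"
  where "bvec j = (\<lambda>i. if i = j then 1 else 0)"

lift_definition of_mat :: "complex mat \<Rightarrow> endo"
  is "\<lambda>A x i. if i < dim_row A then \<Sum>j<dim_col A. A $$ (i, j) * x j else 0"
  by (auto simp: algebra_simps sum.distrib sum_distrib_left)

definition to_mat :: "nat \<Rightarrow> nat \<Rightarrow> endo \<Rightarrow> complex mat"
  where "to_mat m n a = mat m n (\<lambda>(i, j). app a (bvec j) i)"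

definition pr :: "nat \<Rightarrow> endo"
  where "pr n = of_mat (1\<^sub>m n)"

lemma app_pr: "app (pr n) x = (\<lambda>i. if i < n then x i else 0)"
  by (auto simp: pr_def of_mat.rep_eq if_distrib[of "\<lambda>t. t * _"] cong: if_cong)

lemma of_mat_mult:
  assumes "A \<in> carrier_mat m k" "B \<in> carrier_mat k n"
  shows "of_mat (A * B) = of_mat A * of_mat B"
proof (rule endo_eqI)
  fix x i
  show "app (of_mat (A * B)) x i = app (of_mat A * of_mat B) x i"
  proof (cases "i < m")
    case True
    have "app (of_mat (A * B)) x i = (\<Sum>j<n. \<Sum>l<k. A $$ (i, l) * B $$ (l, j) * x j)"
      using True assms
      by (auto simp: of_mat.rep_eq scalar_prod_def sum_distrib_right atLeast0LessThan
          intro!: sum.cong)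
    also have "\<dots> = (\<Sum>l<k. \<Sum>j<n. A $$ (i, l) * B $$ (l, j) * x j)"
      by (rule sum.swap)
    also have "\<dots> = app (of_mat A * of_mat B) x i"
      using True assms by (auto simp: of_mat.rep_eq app_simps sum_distrib_left mult.assoc)
    finally show ?thesis .
  qed (use assms in \<open>auto simp: of_mat.rep_eq app_simps\<close>)
qed

lemma of_mat_add:
  assumes "A \<in> carrier_mat m n" "B \<in> carrier_mat m n"
  shows "of_mat (A + B) = of_mat A + of_mat B"
  using assms by (auto intro!: endo_eqI simp: of_mat.rep_eq app_simps sum.distrib algebra_simps)

lemma of_mat_minus:
  assumes "A \<in> carrier_mat m n" "B \<in> carrier_mat m n"
  shows "of_mat (A - B) = of_mat A - of_mat B"
  using assms by (auto intro!: endo_eqI simp: of_mat.rep_eq app_simps sum_subtractf algebra_simps)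

lemma of_mat_smult: "of_mat (c \<cdot>\<^sub>m A) = sc c * of_mat A"
  by (auto intro!: endo_eqI simp: of_mat.rep_eq app_simps sum_distrib_left algebra_simps)

lemma app_of_mat_bvec: "j < dim_col A \<Longrightarrow> i < dim_row A \<Longrightarrow> app (of_mat A) (bvec j) i = A $$ (i, j)"
  by (auto simp: of_mat.rep_eq bvec_def if_distrib[of "\<lambda>t. _ * t"] cong: if_cong)

lemma to_mat_of_mat: "A \<in> carrier_mat m n \<Longrightarrow> to_mat m n (of_mat A) = A"
  by (auto simp: to_mat_def app_of_mat_bvec)

lemma to_mat_carrier [simp]: "to_mat m n a \<in> carrier_mat m n"
  by (auto simp: to_mat_def)

lemma of_mat_inject:
  assumes "A \<in> carrier_mat m n" "B \<in> carrier_mat m n" "of_mat A = of_mat B"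
  shows "A = B"
  using assms by (metis to_mat_of_mat)

lemma app_pr_expand: "app (pr n) x = (\<lambda>i. \<Sum>j<n. x j * bvec j i)"
  by (auto simp: app_pr bvec_def if_distrib[of "\<lambda>t. _ * t"] cong: if_cong)

lemma of_mat_to_mat:
  assumes "pr m * a = a" "a * pr n = a"
  shows "of_mat (to_mat m n a) = a"
proof (rule endo_eqI)
  fix x i
  have "app a x = app a (app (pr n) x)"
    using assms(2) by (metis times_endo.rep_eq)
  also have "\<dots> = (\<lambda>i. \<Sum>j<n. x j * app a (bvec j) i)"
    unfolding app_pr_expand app_sum by (simp add: app_scale)
  finally have *: "app a x i = (\<Sum>j<n. x j * app a (bvec j) i)" for i by meson
  have "\<not> i < m \<Longrightarrow> app a x i = 0"
    using assms(1) app_pr by (metis (no_types, lifting) times_endo.rep_eq)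
  then show "app (of_mat (to_mat m n a)) x i = app a x i"
    using * by (auto simp: of_mat.rep_eq to_mat_def mult.commute intro!: sum.cong)
qed

lemma pr_of_mat: "A \<in> carrier_mat m n \<Longrightarrow> pr m * of_mat A = of_mat A \<and> of_mat A * pr n = of_mat A"
  using of_mat_mult[of "1\<^sub>m m" m m A n] of_mat_mult[of A m n "1\<^sub>m n" n] by (simp add: pr_def)

lemma pr_idem: "pr n * pr n = pr n"
  by (metis one_carrier_mat pr_def pr_of_mat)

text \<open>The matrix units; \<open>unit_op i j\<close> sends basis vector j to basis vector
  i.\<close>

lift_definition unit_op :: "nat \<Rightarrow> nat \<Rightarrow> endo" is "\<lambda>i j x k. if k = i then x j else 0"
  by auto

lemma unit_op_mult: "unit_op i j * unit_op k l = (if j = k then unit_op i l else 0)"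
  by (auto intro!: endo_eqI simp: app_simps unit_op.rep_eq)

lemma pr_unit_ops: "pr n = (\<Sum>i<n. unit_op i i)"
  by (auto intro!: endo_eqI simp: app_pr app_sum_endo unit_op.rep_eq)

lemma unit_op_sandwich: "unit_op i j * a * unit_op k l = sc (app a (bvec k) j) * unit_op i l"
proof (rule endo_eqI)
  fix x m
  have "app (unit_op k l) x = (\<lambda>i. x l * bvec k i)"
    by (auto simp: unit_op.rep_eq bvec_def)
  then show "app (unit_op i j * a * unit_op k l) x m = app (sc (app a (bvec k) j) * unit_op i l) x m"
    by (auto simp: app_simps unit_op.rep_eq app_scale)
qed

text \<open>Finite dimensionality of the operators living on an m by n block, from which the
  annihilating polynomial is obtained.\<close>

lemma pr_sandwich_span: "pr m * a * pr n \<in> endo_vs.span ((\<lambda>(i, j). unit_op i j) ` ({..<m} \<times> {..<n}))"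
proof -
  have "pr m * a * pr n = (\<Sum>i<m. \<Sum>j<n. unit_op i i * a * unit_op j j)"
    unfolding pr_unit_ops sum_distrib_left sum_distrib_right by (rule sum.swap)
  also have "\<dots> = (\<Sum>i<m. \<Sum>j<n. sc (app a (bvec j) i) * unit_op i j)"
    by (simp add: unit_op_sandwich)
  also have "\<dots> \<in> endo_vs.span ((\<lambda>(i, j). unit_op i j) ` ({..<m} \<times> {..<n}))"
    by (intro endo_vs.span_sum endo_vs.span_scale endo_vs.span_base) auto
  finally show ?thesis .
qed

section \<open>Annihilating polynomials\<close>

definition pev :: "complex poly \<Rightarrow> endo \<Rightarrow> endo"
  where "pev p h = (\<Sum>i\<le>degree p. sc (coeff p i) * h ^ i)"

lemma pev_bound: "degree p \<le> n \<Longrightarrow> pev p h = (\<Sum>i\<le>n. sc (coeff p i) * h ^ i)"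
  unfolding pev_def by (rule sum.mono_neutral_left) (auto simp: not_le coeff_eq_0)

lemma pev_add: "pev (p + q) h = pev p h + pev q h"
proof -
  define n where "n = max (degree p) (degree q)"
  have "degree p \<le> n" "degree q \<le> n" "degree (p + q) \<le> n"
    by (auto simp: n_def degree_add_le_max)
  then show ?thesis
    by (simp add: pev_bound[where n = n] algebra_simps sum.distrib)
qed

lemma pev_smult: "pev (Polynomial.smult c p) h = sc c * pev p h"
proof -
  have "pev (Polynomial.smult c p) h = (\<Sum>i\<le>degree p. sc (coeff (Polynomial.smult c p) i) * h ^ i)"
    by (rule pev_bound) (rule degree_smult_le)
  then show ?thesis
    by (simp add: pev_def[of p] sum_distrib_left mult.assoc)
qed

lemma pev_pCons: "pev (pCons c p) h = sc c + h * pev p h"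
proof -
  have "pev (pCons c p) h = (\<Sum>i\<le>Suc (degree p). sc (coeff (pCons c p) i) * h ^ i)"
    by (rule pev_bound) (rule degree_pCons_le)
  also have "\<dots> = sc c + (\<Sum>i\<le>degree p. sc (coeff p i) * h ^ Suc i)"
    by (subst sum.atMost_Suc_shift) simp
  also have "(\<Sum>i\<le>degree p. sc (coeff p i) * h ^ Suc i) = h * pev p h"
    by (simp add: pev_def sum_distrib_left sc_left_commute)
  finally show ?thesis .
qed

lemma pev_0 [simp]: "pev 0 h = 0"
  by (simp add: pev_def)

lemma pev_diff: "pev (p - q) h = pev p h - pev q h"
  using pev_add[of "p - q" q h] by simp

lemma pev_linear_mult: "pev ([:- l, 1:] * p) h = (h - sc l) * pev p h"
  by (simp add: pev_diff pev_smult pev_pCons mult_pCons_left algebra_simps)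

text \<open>A split polynomial is kept as the list of its roots with multiplicity: dividing by a
  linear factor is \<open>remove1\<close>, and the length is the measure of the induction in
  \<open>idempotent_induct\<close>.\<close>

definition rootprod :: "complex list \<Rightarrow> endo \<Rightarrow> endo"
  where "rootprod ls h = prod_list (map (\<lambda>l. h - sc l) ls)"

lemma rootprod_simps [simp]: "rootprod [] h = 1" "rootprod (l # ls) h = (h - sc l) * rootprod ls h"
  by (simp_all add: rootprod_def)

lemma pev_factorized: "pev (\<Prod>l\<leftarrow>ls. [:- l, 1:]) h = rootprod ls h"
  by (induction ls) (auto simp: pev_linear_mult pev_pCons one_pCons simp del: mult_pCons_left)

text \<open>The powers of \<open>h\<close> lie in a space of dimension at most the square of n, so
  one of them depends on the lower ones. The resulting monic polynomial splits over the complex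
  numbers.\<close>

lemma annihilator_exists:
  assumes "pr n * h = h" "h * pr n = h"
  shows "\<exists>ls. rootprod ls h * pr n = 0"
proof -
  \<comment> \<open>The factor \<open>pr n\<close> keeps even the zeroth power, the identity of the
    whole ring, inside the finite dimensional block.\<close>
  define s where "s = (\<lambda>k. h ^ k * pr n)"
  define B where "B = (\<lambda>(i, j). unit_op i j) ` ({..<n} \<times> {..<n})"
  have s_span: "s k \<in> endo_vs.span B" for k
  proof -
    have "pr n * h = h * pr n" using assms by simp
    then have "pr n * h ^ k * pr n = h ^ k * (pr n * pr n)"
      by (metis mult.assoc power_commuting_commutes)
    then show ?thesis
      using pr_sandwich_span[of n "h ^ k" n] by (simp add: s_def B_def pr_idem)
  qed
  have "\<exists>k. s k \<in> endo_vs.span (s ` {..<k})"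
  proof (rule ccontr)
    assume none: "\<nexists>k. s k \<in> endo_vs.span (s ` {..<k})"
    have "endo_vs.independent (s ` {..<k}) \<and> card (s ` {..<k}) = k" for k
    proof (induction k)
      case (Suc k)
      have notin: "s k \<notin> endo_vs.span (s ` {..<k})" using none by blast
      then have new: "s k \<notin> s ` {..<k}"
        using endo_vs.span_base[of "s k" "s ` {..<k}"] by blast
      then have "card (s ` {..<Suc k}) = Suc k"
        using Suc new by (simp add: lessThan_Suc)
      moreover have "endo_vs.independent (insert (s k) (s ` {..<k}))"
        using Suc notin by (intro endo_vs.independent_insertI) auto
      ultimately show ?case
        by (simp add: lessThan_Suc)
    qed (simp add: endo_vs.independent_empty)
    then have "endo_vs.independent (s ` {..<Suc (card B)})"
      and "card (s ` {..<Suc (card B)}) = Suc (card B)" by blast+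
    moreover have "finite B" by (simp add: B_def)
    ultimately show False
      using endo_vs.independent_span_bound[of B "s ` {..<Suc (card B)}"] s_span by auto
  qed
  then obtain k where "s k \<in> endo_vs.span (s ` {..<k})" by blast
  \<comment> \<open>The alternative \<open>p = 0\<close> covers k = 0, where no degree lies below
    k.\<close>
  also have "\<dots> \<subseteq> {pev p h * pr n | p. p = 0 \<or> degree p < k}"
  proof (rule endo_vs.span_minimal)
    show "s ` {..<k} \<subseteq> {pev p h * pr n | p. p = 0 \<or> degree p < k}"
    proof safe
      fix i assume "i < k"
      have "pev (monom 1 i) h = h ^ i"
        by (simp add: pev_def degree_monom_eq if_distrib[of sc] if_distrib[of "\<lambda>t. t * _"] cong: if_cong)
      then show "\<exists>p. s i = pev p h * pr n \<and> (p = 0 \<or> degree p < k)"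
        using \<open>i < k\<close> by (intro exI[of _ "monom 1 i"]) (auto simp: s_def degree_monom_eq)
    qed
    show "endo_vs.subspace {pev p h * pr n | p. p = 0 \<or> degree p < k}"
    proof (rule endo_vs.subspaceI)
      show "0 \<in> {pev p h * pr n | p. p = 0 \<or> degree p < k}"
        by (auto intro!: exI[of _ 0])
    next
      fix x y assume "x \<in> {pev p h * pr n | p. p = 0 \<or> degree p < k}"
        and "y \<in> {pev p h * pr n | p. p = 0 \<or> degree p < k}"
      then obtain p q where "x = pev p h * pr n" "p = 0 \<or> degree p < k"
        "y = pev q h * pr n" "q = 0 \<or> degree q < k" by blast
      then show "x + y \<in> {pev p h * pr n | p. p = 0 \<or> degree p < k}"
        by (intro CollectI exI[of _ "p + q"]) (auto simp: pev_add algebra_simps degree_add_less)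
    next
      fix c x assume "x \<in> {pev p h * pr n | p. p = 0 \<or> degree p < k}"
      then obtain p where "x = pev p h * pr n" "p = 0 \<or> degree p < k" by blast
      then show "sc c * x \<in> {pev p h * pr n | p. p = 0 \<or> degree p < k}"
        by (intro CollectI exI[of _ "Polynomial.smult c p"]) (auto simp: pev_smult mult.assoc)
    qed
  qed
  finally obtain p where p: "s k = pev p h * pr n" "p = 0 \<or> degree p < k" by blast
  define q where "q = monom 1 k - p"
  have "coeff q k = 1"
    using p(2) by (auto simp: q_def coeff_eq_0)
  then have "q \<noteq> 0" by auto
  have "pev (monom 1 k) h = h ^ k"
    by (simp add: pev_def degree_monom_eq if_distrib[of sc] if_distrib[of "\<lambda>t. t * _"] cong: if_cong)
  moreover have "pev q h + pev p h = pev (monom 1 k) h"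
    by (simp add: q_def flip: pev_add)
  ultimately have "(pev q h + pev p h) * pr n = s k" by (simp add: s_def)
  then have q0: "pev q h * pr n = 0"
    using p(1) by (simp add: algebra_simps)
  obtain A where A: "q = Polynomial.smult (lead_coeff q) (\<Prod>l\<in>#A. [:- l, 1:])"
    using alg_closed_imp_factorization[OF \<open>q \<noteq> 0\<close>] by blast
  obtain ls where "A = mset ls" by (metis ex_mset)
  with A have ls: "Polynomial.smult (lead_coeff q) (\<Prod>l\<leftarrow>ls. [:- l, 1:]) = q"
    by (simp add: prod_mset_prod_list flip: mset_map)
  have "sc (lead_coeff q) * (rootprod ls h * pr n) = 0"
    using q0 by (metis ls mult.assoc pev_factorized pev_smult)
  then show ?thesis
    using sc_cancel \<open>q \<noteq> 0\<close> by (metis leading_coeff_0_iff)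
qed

lemma rootprod_append: "rootprod (xs @ ys) h = rootprod xs h * rootprod ys h"
  by (induction xs) (auto simp: mult.assoc)

lemma rootprod_commute:
  assumes "g * h = h * g"
  shows "g * rootprod ls h = rootprod ls h * g"
proof (induction ls)
  case (Cons l ls)
  have "g * (h - sc l) = (h - sc l) * g"
    by (simp add: right_diff_distrib left_diff_distrib assms sc_commute)
  then have "g * ((h - sc l) * rootprod ls h) = (h - sc l) * (g * rootprod ls h)"
    by (metis mult.assoc)
  then show ?case
    using Cons by (simp add: mult.assoc)
qed simp

lemma rootprod_remove1:
  "l \<in> set ls \<Longrightarrow> rootprod ls h = (h - sc l) * rootprod (remove1 l ls) h"
proof (induction ls)
  case (Cons a ls)
  have "(h - sc a) * (h - sc l) = (h - sc l) * (h - sc a)"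
    by (simp add: left_diff_distrib right_diff_distrib sc_commute[of h] sc_commute[of "sc a" l])
  then have "(h - sc a) * ((h - sc l) * x) = (h - sc l) * ((h - sc a) * x)" for x
    by (metis mult.assoc)
  then show ?case
    using Cons by (auto simp: mult.assoc)
qed simp

lemma rootprod_eigen:
  assumes "h * x = sc m * x"
  shows "rootprod ls h * x = sc (\<Prod>l\<leftarrow>ls. m - l) * x"
proof (induction ls)
  case (Cons l ls)
  have "rootprod (l # ls) h * x = (h - sc l) * (sc (\<Prod>l\<leftarrow>ls. m - l) * x)"
    using Cons by (simp add: mult.assoc)
  also have "\<dots> = sc (\<Prod>l\<leftarrow>ls. m - l) * (h * x - sc l * x)"
    by (metis left_diff_distrib sc_left_commute)
  also have "\<dots> = sc (\<Prod>l\<leftarrow>ls. m - l) * (sc (m - l) * x)"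
    by (simp add: assms left_diff_distrib)
  also have "\<dots> = sc ((\<Prod>l\<leftarrow>ls. m - l) * (m - l)) * x"
    by (simp only: sc_hom(6) mult.assoc)
  finally show ?case
    by (simp only: list.map prod_list.Cons mult.commute)
qed simp

lemma rootprod_eigen_right:
  assumes "x * h = sc m * x"
  shows "x * rootprod ls h = sc (\<Prod>l\<leftarrow>ls. m - l) * x"
proof (induction ls)
  case (Cons l ls)
  have "x * rootprod (l # ls) h = (x * h - x * sc l) * rootprod ls h"
    by (simp add: left_diff_distrib right_diff_distrib mult.assoc)
  also have "x * h - x * sc l = sc (m - l) * x"
    by (simp add: assms left_diff_distrib sc_commute)
  finally show ?case
    using Cons by (simp add: mult.assoc)
qed simp

text \<open>On an eigenoperator of eigenvalue m the product acts by the scalar with factors m - l.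
  Thus all weights occurring in the module are among the roots.\<close>

lemma eigen_not_root:
  assumes "h * x = sc m * x" "rootprod ls h * x = 0" "m \<notin> set ls"
  shows "x = 0"
proof -
  have "sc (\<Prod>l\<leftarrow>ls. m - l) * x = 0"
    using assms by (metis rootprod_eigen)
  moreover have "(\<Prod>l\<leftarrow>ls. m - l) \<noteq> 0"
    using assms(3) by (auto simp: prod_list_zero_iff)
  ultimately show ?thesis using sc_cancel by blast
qed

lemma eigen_not_root_right:
  assumes "x * h = sc m * x" "x * rootprod ls h = 0" "m \<notin> set ls"
  shows "x = 0"
proof -
  have "sc (\<Prod>l\<leftarrow>ls. m - l) * x = 0"
    using assms by (metis rootprod_eigen_right)
  moreover have "(\<Prod>l\<leftarrow>ls. m - l) \<noteq> 0"
    using assms(3) by (auto simp: prod_list_zero_iff)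
  ultimately show ?thesis using sc_cancel by blast
qed

section \<open>Highest weight theory\<close>

definition triple :: "endo \<Rightarrow> endo \<Rightarrow> endo \<Rightarrow> bool"
  where "triple e f h \<longleftrightarrow> e * f = f * e + h \<and> h * e = e * h + 2 * e \<and> h * f = f * h - 2 * f"

text \<open>\<open>hwt k l = k! \<cdot> l (l - 1) \<dots> (l - k + 1)\<close> is the scalar by which \<open>e\<^sup>k f\<^sup>k\<close> acts on a highest
  weight vector of weight \<open>l\<close>.\<close>

definition hwt :: "nat \<Rightarrow> complex \<Rightarrow> complex"
  where "hwt k l = (\<Prod>i<k. of_nat (Suc i) * (l - of_nat i))"

lemma hwt_0 [simp]: "hwt 0 l = 1"
  by (simp add: hwt_def)

lemma hwt_Suc: "hwt (Suc k) l = hwt k l * (of_nat (Suc k) * (l - of_nat k))"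
  by (simp add: hwt_def)

lemma hwt_nonzero: "k \<le> n \<Longrightarrow> hwt k (of_nat n) \<noteq> 0"
proof -
  assume "k \<le> n"
  then have "of_nat (Suc i) * (of_nat n - of_nat i) \<noteq> (0::complex)" if "i < k" for i
    using that by (simp only: mult_eq_0_iff of_nat_eq_0_iff right_minus_eq of_nat_eq_iff) auto
  then show ?thesis by (simp add: hwt_def)
qed

lemma two_scaled: "(2::endo) = sc 2"
  using sc_of_nat[of 2] by simp

lemma h_f_power:
  assumes "triple e f h"
  shows "h * f ^ k = f ^ k * h - sc (2 * of_nat k) * f ^ k"
proof (induction k)
  case (Suc k)
  have "h * f ^ Suc k = (h * f) * f ^ k" by (simp add: mult.assoc)
  also have "\<dots> = f * (h * f ^ k) - 2 * (f * f ^ k)"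
    using assms by (simp add: triple_def left_diff_distrib mult.assoc)
  also have "\<dots> = f ^ Suc k * h - (sc (2 * of_nat k) * f ^ Suc k + 2 * f ^ Suc k)"
    by (simp only: Suc right_diff_distrib sc_left_commute) (simp add: mult.assoc)
  also have "sc (2 * of_nat k) * f ^ Suc k + 2 * f ^ Suc k = sc (2 * of_nat (Suc k)) * f ^ Suc k"
    by (simp add: two_scaled algebra_simps flip: sc_hom(6) sc_hom(3))
  finally show ?case .
qed simp

text \<open>The anti-automorphism that exchanges e and f and fixes h preserves the relations of a
  triple; this is the image of \<open>h_f_power\<close> under it. The right-handed versions of later
  lemmas arise in the same way.\<close>

lemma triple_transpose: "triple e f h \<Longrightarrow> e ^ k * h = h * e ^ k - sc (2 * of_nat k) * e ^ k"
proof (induction k)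
  case (Suc k)
  have "e ^ Suc k * h = e * (e ^ k * h)" by (simp add: mult.assoc)
  also have "\<dots> = e * h * e ^ k - sc (2 * of_nat k) * e ^ Suc k"
    by (simp only: Suc right_diff_distrib sc_left_commute mult.assoc power_Suc)
  also have "e * h = h * e - 2 * e"
    using Suc.prems by (simp add: triple_def)
  also have "(h * e - 2 * e) * e ^ k = h * e ^ Suc k - 2 * e ^ Suc k"
    by (simp add: left_diff_distrib mult.assoc)
  also have "h * e ^ Suc k - 2 * e ^ Suc k - sc (2 * of_nat k) * e ^ Suc k
    = h * e ^ Suc k - sc (2 * of_nat (Suc k)) * e ^ Suc k"
    by (simp add: two_scaled algebra_simps)
  finally show ?case .
qed simp

lemma e_f_power:
  assumes "triple e f h"
  shows "e * f ^ Suc k = f ^ Suc k * e + sc (of_nat (Suc k)) * (f ^ k * (h - sc (of_nat k)))"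
proof (induction k)
  case 0
  then show ?case using assms by (simp add: triple_def)
next
  case (Suc k)
  have "e * f ^ Suc (Suc k) = (e * f) * f ^ Suc k" by (simp add: mult.assoc)
  also have "\<dots> = f * (e * f ^ Suc k) + h * f ^ Suc k"
    using assms by (simp add: triple_def distrib_right mult.assoc)
  also have "\<dots> = f ^ Suc (Suc k) * e + sc (of_nat (Suc k)) * (f ^ Suc k * (h - sc (of_nat k)))
      + (f ^ Suc k * h - sc (2 * of_nat (Suc k)) * f ^ Suc k)"
    unfolding Suc h_f_power[OF assms]
    by (simp only: distrib_left sc_left_commute mult.assoc power_Suc)
  also have "\<dots> = f ^ Suc (Suc k) * e + (sc (of_nat (Suc k) + 1) * (f ^ Suc k * h)
      - sc (of_nat (Suc k) * of_nat k + 2 * of_nat (Suc k)) * f ^ Suc k)"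
    by (simp only: right_diff_distrib distrib_right sc_hom(3) sc_commute[of "f ^ Suc k"] sc_hom(6)
        mult.assoc sc_hom(2) mult_1 left_diff_distrib) (simp add: algebra_simps)
  also have "of_nat (Suc k) * of_nat k + 2 * of_nat (Suc k)
      = (of_nat (Suc (Suc k)) * of_nat (Suc k) :: complex)"
    by (simp add: algebra_simps)
  also have "of_nat (Suc k) + 1 = (of_nat (Suc (Suc k)) :: complex)"
    by simp
  also have "sc (of_nat (Suc (Suc k))) * (f ^ Suc k * h)
      - sc (of_nat (Suc (Suc k)) * of_nat (Suc k)) * f ^ Suc k
      = sc (of_nat (Suc (Suc k))) * (f ^ Suc k * (h - sc (of_nat (Suc k))))"
    by (simp only: right_diff_distrib sc_commute[of "f ^ Suc k"] sc_hom(6) mult.assoc)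
  finally show ?case .
qed

lemma f_e_power:
  assumes "triple e f h"
  shows "e ^ Suc k * f = f * e ^ Suc k + sc (of_nat (Suc k)) * ((h - sc (of_nat k)) * e ^ k)"
proof (induction k)
  case 0
  then show ?case using assms by (simp add: triple_def)
next
  case (Suc k)
  have "e ^ Suc (Suc k) * f = e ^ Suc k * (e * f)" by (metis mult.assoc power_Suc2)
  also have "\<dots> = (e ^ Suc k * f) * e + e ^ Suc k * h"
    using assms by (simp add: triple_def distrib_left mult.assoc)
  also have "\<dots> = f * e ^ Suc (Suc k) + sc (of_nat (Suc k)) * ((h - sc (of_nat k)) * e ^ Suc k)
      + (h * e ^ Suc k - sc (2 * of_nat (Suc k)) * e ^ Suc k)"
    unfolding Suc triple_transpose[OF assms]
    by (simp only: distrib_right mult.assoc power_Suc2)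
  also have "\<dots> = f * e ^ Suc (Suc k) + (sc (of_nat (Suc k) + 1) * (h * e ^ Suc k)
      - sc (of_nat (Suc k) * of_nat k + 2 * of_nat (Suc k)) * e ^ Suc k)"
    by (simp only: right_diff_distrib distrib_right sc_hom(3) sc_hom(6)
        mult.assoc sc_hom(2) mult_1 left_diff_distrib) (simp add: algebra_simps)
  also have "of_nat (Suc k) * of_nat k + 2 * of_nat (Suc k)
      = (of_nat (Suc (Suc k)) * of_nat (Suc k) :: complex)"
    by (simp add: algebra_simps)
  also have "of_nat (Suc k) + 1 = (of_nat (Suc (Suc k)) :: complex)"
    by simp
  also have "sc (of_nat (Suc (Suc k))) * (h * e ^ Suc k)
      - sc (of_nat (Suc (Suc k)) * of_nat (Suc k)) * e ^ Suc k
      = sc (of_nat (Suc (Suc k))) * ((h - sc (of_nat (Suc k))) * e ^ Suc k)"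
    by (simp only: right_diff_distrib left_diff_distrib sc_hom(6) mult.assoc)
  finally show ?case .
qed

text \<open>Highest weight vectors are replaced by operators \<open>x\<close> with \<open>e * x = 0\<close>, that is, whose values
  are highest weight vectors, and dually highest weight functionals by operators with \<open>x * f = 0\<close>.\<close>

lemma e_f_power_hw:
  assumes "triple e f h" "e * x = 0" "h * x = sc l * x"
  shows "e * (f ^ Suc k * x) = sc (of_nat (Suc k) * (l - of_nat k)) * (f ^ k * x)"
proof -
  have "e * (f ^ Suc k * x)
      = f ^ Suc k * (e * x) + sc (of_nat (Suc k)) * (f ^ k * (h * x - sc (of_nat k) * x))"
    using e_f_power[OF assms(1), of k]
    by (simp only: distrib_right left_diff_distrib mult.assoc flip: mult.assoc[of e])
  then show ?thesis
    by (simp only: assms right_diff_distrib sc_left_commute[of "f ^ k"] left_diff_distrib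
        sc_hom mult.assoc mult_zero_right add_0)
qed

lemma f_e_power_hw:
  assumes "triple e f h" "x * f = 0" "x * h = sc l * x"
  shows "x * e ^ Suc k * f = sc (of_nat (Suc k) * (l - of_nat k)) * (x * e ^ k)"
proof -
  have "x * e ^ Suc k * f = x * (f * e ^ Suc k + sc (of_nat (Suc k)) * ((h - sc (of_nat k)) * e ^ k))"
    by (simp only: f_e_power[OF assms(1), of k] mult.assoc)
  also have "\<dots> = (x * f) * e ^ Suc k + sc (of_nat (Suc k)) * (x * (h - sc (of_nat k)) * e ^ k)"
    by (simp only: distrib_left sc_left_commute[of x] mult.assoc)
  also have "x * (h - sc (of_nat k)) = x * h - sc (of_nat k) * x"
    by (simp only: right_diff_distrib sc_commute[of x])
  finally have "x * e ^ Suc k * f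
    = (x * f) * e ^ Suc k + sc (of_nat (Suc k)) * ((x * h - sc (of_nat k) * x) * e ^ k)" .
  then show ?thesis
    by (simp only: assms right_diff_distrib left_diff_distrib
        sc_hom mult.assoc mult_zero_left add_0)
qed

lemma power_sandwich_eq:
  assumes "triple e f h" "e * x = 0" "h * x = sc l * x"
  shows "e ^ k * (f ^ k * x) = sc (hwt k l) * x"
proof (induction k)
  case (Suc k)
  have "e ^ Suc k * (f ^ Suc k * x) = e ^ k * (e * (f ^ Suc k * x))"
    by (metis mult.assoc power_Suc2)
  also have "\<dots> = sc (of_nat (Suc k) * (l - of_nat k)) * (e ^ k * (f ^ k * x))"
    by (simp only: e_f_power_hw[OF assms] sc_left_commute)
  finally show ?case
    unfolding Suc hwt_Suc by (metis mult.assoc mult.commute sc_hom(6))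
qed simp

lemma power_sandwich_eq_right:
  assumes "triple e f h" "x * f = 0" "x * h = sc l * x"
  shows "x * e ^ k * f ^ k = sc (hwt k l) * x"
proof (induction k)
  case (Suc k)
  have "x * e ^ Suc k * f ^ Suc k = (x * e ^ Suc k * f) * f ^ k"
    by (simp add: mult.assoc)
  also have "\<dots> = sc (of_nat (Suc k) * (l - of_nat k)) * (x * e ^ k * f ^ k)"
    unfolding f_e_power_hw[OF assms] by (simp only: mult.assoc)
  finally show ?case
    unfolding Suc hwt_Suc by (metis mult.assoc mult.commute sc_hom(6))
qed simp

text \<open>Equal exponents give the scalar \<open>hwt k l\<close>. If there are more factors e than
  f, a surplus e reaches \<open>z\<close>; otherwise a surplus f reaches \<open>y\<close>. Both
  products vanish.\<close>

lemma power_sandwich: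
  assumes t: "triple e f h"
    and y: "y * f = 0" "y * h = sc l * y" and z: "e * z = 0" "h * z = sc l * z"
  shows "y * e ^ j * (f ^ k * z) = (if j = k then sc (hwt k l) * (y * z) else 0)"
proof -
  consider "j = k" | "k < j" | "j < k" by linarith
  then show ?thesis
  proof cases
    case 1
    then show ?thesis
      by (metis mult.assoc power_sandwich_eq[OF t z] sc_left_commute)
  next
    case 2
    then obtain d where d: "j = Suc d + k" by (metis add.commute add_Suc_right less_iff_Suc_add)
    have "e ^ j * (f ^ k * z) = e ^ Suc d * (e ^ k * (f ^ k * z))"
      by (simp only: d power_add mult.assoc)
    also have "\<dots> = sc (hwt k l) * (e ^ d * (e * z))"
      by (metis mult.assoc power_Suc2 power_sandwich_eq[OF t z] sc_left_commute)
    finally show ?thesis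
      using 2 by (simp add: z mult.assoc)
  next
    case 3
    then obtain d where d: "k = j + Suc d" by (metis add_Suc_right less_iff_Suc_add)
    have "y * e ^ j * f ^ k = (y * e ^ j * f ^ j) * (f * f ^ d)"
      by (simp only: d power_add mult.assoc power_Suc)
    also have "\<dots> = sc (hwt j l) * ((y * f) * f ^ d)"
        unfolding power_sandwich_eq_right[OF t y] by (simp only: mult.assoc)
    finally show ?thesis
      using 3 by (simp add: y flip: mult.assoc)
  qed
qed

text \<open>The intertwiner determined by its highest weight part \<open>y\<close>.\<close>

definition hw_ext :: "nat \<Rightarrow> endo \<Rightarrow> endo \<Rightarrow> endo \<Rightarrow> endo"
  where "hw_ext n f y e = (\<Sum>k\<le>n. sc (inverse (hwt k (of_nat n))) * (f ^ k * y * e ^ k))"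

text \<open>The first triple acts on the target and the second on the source. The left conditions
  say that the values of \<open>y\<close> are highest weight vectors of weight n whose lowering
  string stops after n steps; the right conditions are their duals.\<close>

definition hw_part :: "nat \<Rightarrow> endo \<times> endo \<times> endo \<Rightarrow> endo \<times> endo \<times> endo \<Rightarrow> endo \<Rightarrow> bool"
  where "hw_part n = (\<lambda>(e, f, h) (e', f', h') y.
    e * y = 0 \<and> h * y = sc (of_nat n) * y \<and> f ^ Suc n * y = 0 \<and>
    y * f' = 0 \<and> y * h' = sc (of_nat n) * y \<and> y * e' ^ Suc n = 0)"

text \<open>Both identities are index shifts governed by c_k = c_{k+1} (k+1)(n-k), the factor
  produced by moving f' or e past one more power. The boundary terms of the shifted sums vanish by
  the four annihilation conditions in \<open>hw_part\<close>.\<close>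

lemma
  assumes t: "triple e f h" and t': "triple e' f' h'"
    and y: "hw_part n (e, f, h) (e', f', h') y"
  shows hw_ext_f: "f * hw_ext n f y e' = hw_ext n f y e' * f'"
    and hw_ext_e: "e * hw_ext n f y e' = hw_ext n f y e' * e'"
proof -
  note y = y[unfolded hw_part_def, simplified prod.case]
  define c where "c k = inverse (hwt k (of_nat n))" for k
  define z where "z k = f ^ k * y" for k
  define x where "x k = y * e' ^ k" for k
  have c: "c k = c (Suc k) * (of_nat (Suc k) * (of_nat n - of_nat k))" if "k < n" for k
    using hwt_nonzero[of "Suc k" n] hwt_nonzero[of k n] that
    unfolding c_def hwt_Suc by (auto simp: field_simps)
  show "f * hw_ext n f y e' = hw_ext n f y e' * f'"
  proof -
    have "f * hw_ext n f y e' = (\<Sum>k\<le>n. sc (c k) * (f ^ Suc k * y * e' ^ k))"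
      by (simp add: hw_ext_def c_def sum_distrib_left sc_left_commute mult.assoc)
    also have "\<dots> = (\<Sum>k<n. sc (c k) * (f ^ Suc k * y * e' ^ k))"
      using y by (simp add: lessThan_Suc_atMost[symmetric] del: power_Suc)
    also have "\<dots> = (\<Sum>k<n. sc (c (Suc k)) * (f ^ Suc k * (y * e' ^ Suc k * f')))"
    proof (rule sum.cong)
      fix k assume "k \<in> {..<n}"
      then have "sc (c k) * (f ^ Suc k * y * e' ^ k)
        = sc (c (Suc k)) * (sc (of_nat (Suc k) * (of_nat n - of_nat k)) * (f ^ Suc k * (y * e' ^ k)))"
        using c[of k] by (simp only: lessThan_iff sc_hom(6) mult.assoc)
      also have "\<dots> = sc (c (Suc k)) * (f ^ Suc k * (sc (of_nat (Suc k) * (of_nat n - of_nat k)) * (y * e' ^ k)))"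
        by (simp only: sc_left_commute[of "f ^ Suc k"])
      also have "sc (of_nat (Suc k) * (of_nat n - of_nat k)) * (y * e' ^ k) = y * e' ^ Suc k * f'"
        using f_e_power_hw[OF t', of y "of_nat n" k] y by simp
      finally show "sc (c k) * (f ^ Suc k * y * e' ^ k) = sc (c (Suc k)) * (f ^ Suc k * (y * e' ^ Suc k * f'))" .
    qed simp
    also have "\<dots> = (\<Sum>k\<le>n. sc (c k) * (f ^ k * (y * e' ^ k * f')))"
      using y by (simp add: lessThan_Suc_atMost[symmetric] sum.lessThan_Suc_shift del: power_Suc sum.lessThan_Suc)
    also have "\<dots> = hw_ext n f y e' * f'"
      by (simp add: hw_ext_def c_def sum_distrib_right mult.assoc)
    finally show ?thesis .
  qed
  show "e * hw_ext n f y e' = hw_ext n f y e' * e'"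
  proof -
    have "hw_ext n f y e' * e' = (\<Sum>k\<le>n. sc (c k) * (f ^ k * (y * e' ^ Suc k)))"
      by (simp add: hw_ext_def c_def sum_distrib_right mult.assoc power_Suc2 del: power_Suc)
    also have "\<dots> = (\<Sum>k<n. sc (c k) * (f ^ k * (y * e' ^ Suc k)))"
      using y by (simp add: lessThan_Suc_atMost[symmetric] del: power_Suc)
    also have "\<dots> = (\<Sum>k<n. sc (c (Suc k)) * (e * (f ^ Suc k * y) * e' ^ Suc k))"
    proof (rule sum.cong)
      fix k assume "k \<in> {..<n}"
      then have "sc (c k) * (f ^ k * (y * e' ^ Suc k))
        = sc (c (Suc k)) * (sc (of_nat (Suc k) * (of_nat n - of_nat k)) * (f ^ k * y) * e' ^ Suc k)"
        using c[of k] by (simp only: lessThan_iff sc_hom(6) mult.assoc)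
      also have "sc (of_nat (Suc k) * (of_nat n - of_nat k)) * (f ^ k * y) = e * (f ^ Suc k * y)"
        using e_f_power_hw[OF t, of y "of_nat n" k] y by simp
      finally show "sc (c k) * (f ^ k * (y * e' ^ Suc k)) = sc (c (Suc k)) * (e * (f ^ Suc k * y) * e' ^ Suc k)" .
    qed simp
    also have "\<dots> = (\<Sum>k\<le>n. sc (c k) * (e * (f ^ k * y) * e' ^ k))"
      using y by (simp add: lessThan_Suc_atMost[symmetric] sum.lessThan_Suc_shift del: power_Suc sum.lessThan_Suc)
    also have "\<dots> = e * hw_ext n f y e'"
      by (simp add: hw_ext_def c_def sum_distrib_left sc_left_commute mult.assoc)
    finally show ?thesis by simp
  qed
qed

lemma hw_ext_h:
  assumes "triple e f h" "triple e' f' h'" "hw_part n (e, f, h) (e', f', h') y"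
  shows "h * hw_ext n f y e' = hw_ext n f y e' * h'"
proof -
  have "h = e * f - f * e" "h' = e' * f' - f' * e'"
    using assms(1,2) by (simp_all add: triple_def)
  then show ?thesis
    using hw_ext_f[OF assms] hw_ext_e[OF assms] by (simp add: left_diff_distrib right_diff_distrib)
      (metis mult.assoc)
qed

lemmas hw_ext_intertwines = hw_ext_f hw_ext_e hw_ext_h

lemma sc_mult_sc: "(sc a * x) * (sc b * y) = sc a * (sc b * (x * y))"
  by (metis mult.assoc sc_left_commute)

text \<open>In the double sum \<open>power_sandwich\<close> leaves only the diagonal, and its scalar
  \<open>hwt\<close> cancels one of the two normalising coefficients. In particular an idempotent
  \<open>y\<close> extends to an idempotent.\<close>

lemma hw_ext_mult:
  assumes t': "triple e' f' h'"
    and y: "hw_part n T (e', f', h') y" and z: "hw_part n (e', f', h') T' z"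
  shows "hw_ext n f y e' * hw_ext n f' z e = hw_ext n f (y * z) e"
proof -
  define c where "c k = inverse (hwt k (of_nat n))" for k
  have yz: "y * f' = 0" "y * h' = sc (of_nat n) * y" "e' * z = 0" "h' * z = sc (of_nat n) * z"
    using y z by (auto simp: hw_part_def split: prod.splits)
  have "hw_ext n f y e' * hw_ext n f' z e
      = (\<Sum>j\<le>n. \<Sum>k\<le>n. sc (c j) * (sc (c k) * (f ^ j * (y * e' ^ j * (f' ^ k * z)) * e ^ k)))"
    unfolding hw_ext_def sum_product sc_mult_sc c_def[symmetric] by (simp only: mult.assoc)
  also have "\<dots> = (\<Sum>j\<le>n. \<Sum>k\<le>n. if j = k then sc (c j) * (f ^ j * (y * z) * e ^ j) else 0)"
  proof (intro sum.cong refl)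
    fix j k assume "j \<in> {..n}" "k \<in> {..n}"
    then have 1: "sc (c j) * sc (hwt j (of_nat n)) = 1"
      using hwt_nonzero[of j n] by (simp add: c_def flip: sc_hom)
    have "sc (c j) * (sc (c j) * (f ^ j * (sc (hwt j (of_nat n)) * (y * z)) * e ^ j))
      = sc (c j) * ((sc (c j) * sc (hwt j (of_nat n))) * (f ^ j * (y * z) * e ^ j))"
      by (simp only: mult.assoc sc_left_commute[of "f ^ j"])
    with 1 show "sc (c j) * (sc (c k) * (f ^ j * (y * e' ^ j * (f' ^ k * z)) * e ^ k)) =
      (if j = k then sc (c j) * (f ^ j * (y * z) * e ^ j) else 0)"
      unfolding power_sandwich[OF t' yz] by (cases "j = k") simp_all
  qed
  also have "\<dots> = hw_ext n f (y * z) e"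
    by (simp add: hw_ext_def c_def)
  finally show ?thesis .
qed

lemma hw_ext_sum: "hw_ext n f (\<Sum>i\<in>S. y i) e = (\<Sum>i\<in>S. hw_ext n f (y i) e)"
proof -
  have "hw_ext n f (\<Sum>i\<in>S. y i) e
      = (\<Sum>k\<le>n. \<Sum>i\<in>S. sc (inverse (hwt k (of_nat n))) * (f ^ k * y i * e ^ k))"
    unfolding hw_ext_def sum_distrib_left sum_distrib_right ..
  also have "\<dots> = (\<Sum>i\<in>S. hw_ext n f (y i) e)"
    unfolding hw_ext_def by (rule sum.swap)
  finally show ?thesis .
qed

text \<open>The version of \<open>power_sandwich_eq\<close> for a \<open>w\<close> that need not be
  an eigenoperator of \<open>h\<close>. The polynomial in \<open>h\<close> on the right has distinct
  roots, which rules out Jordan blocks in \<open>idempotent_induct\<close>.\<close>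

lemma power_sandwich_rootprod:
  assumes t: "triple e f h" and "e * w = 0"
  shows "e ^ k * (f ^ k * w) = sc (fact k) * (rootprod (map of_nat [0..<k]) h * w)"
  using assms(2)
proof (induction k arbitrary: w)
  case (Suc k)
  define v where "v = (h - sc (of_nat k)) * w"
  have "e * h = h * e - 2 * e" using t by (simp add: triple_def)
  then have "e * v = (h * e - 2 * e) * w - sc (of_nat k) * (e * w)"
    by (simp add: v_def left_diff_distrib right_diff_distrib sc_left_commute flip: mult.assoc del: sc_of_nat)
       (simp add: mult.assoc sc_left_commute del: sc_of_nat)
  also have "\<dots> = 0"
    by (simp add: left_diff_distrib mult.assoc Suc.prems)
  finally have v: "e * v = 0" .
  have "e * (f ^ Suc k * w) = f ^ Suc k * (e * w) + sc (of_nat (Suc k)) * (f ^ k * v)"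
    unfolding v_def using e_f_power[OF t, of k] by (metis distrib_right mult.assoc)
  then have "e * (f ^ Suc k * w) = sc (of_nat (Suc k)) * (f ^ k * v)"
    unfolding Suc.prems by simp
  then have "e ^ Suc k * (f ^ Suc k * w) = sc (of_nat (Suc k)) * (e ^ k * (f ^ k * v))"
    by (metis mult.assoc power_Suc2 sc_left_commute)
  also have "\<dots> = sc (of_nat (Suc k)) * (sc (fact k) * (rootprod (map of_nat [0..<k]) h * v))"
    unfolding Suc.IH[OF v] ..
  also have "\<dots> = sc (fact (Suc k)) * (rootprod (map of_nat [0..<Suc k]) h * w)"
    unfolding v_def fact_Suc sc_hom(6) by (simp add: rootprod_append mult.assoc del: of_nat_Suc)
  finally show ?case .
qed simp

lemma h_f_power_hw:
  assumes "triple e f h" "h * x = sc l * x"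
  shows "h * (f ^ k * x) = sc (l - 2 * of_nat k) * (f ^ k * x)"
proof -
  have "h * (f ^ k * x) = f ^ k * (h * x) - sc (2 * of_nat k) * (f ^ k * x)"
    using h_f_power[OF assms(1), of k] by (metis left_diff_distrib mult.assoc)
  then show ?thesis
    unfolding assms(2) by (simp only: sc_left_commute[of "f ^ k"] sc_hom(4) left_diff_distrib)
qed

lemma e_power_h_hw:
  assumes "triple e f h" "x * h = sc l * x"
  shows "x * e ^ k * h = sc (l - 2 * of_nat k) * (x * e ^ k)"
proof -
  have "x * e ^ k * h = (x * h) * e ^ k - sc (2 * of_nat k) * (x * e ^ k)"
    using triple_transpose[OF assms(1), of k] sc_left_commute[of x]
    by (metis mult.assoc right_diff_distrib)
  then show ?thesis
    unfolding assms(2) by (simp only: sc_hom(4) left_diff_distrib mult.assoc)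
qed

lemma exists_non_weight:
  fixes l :: complex
  obtains k :: nat where "l - 2 * of_nat k \<notin> set ls"
proof -
  have "inj (\<lambda>k. l - 2 * of_nat k)" by (auto simp: inj_on_def)
  then have "infinite (range (\<lambda>k::nat. l - 2 * of_nat k))"
    by (simp add: finite_image_iff)
  then show ?thesis
    using that by (metis (no_types, lifting) List.finite_set finite_subset rangeE subsetI)
qed

lemma hwt_factor_nonzero: "n < j \<Longrightarrow> of_nat (Suc j) * (of_nat n - of_nat j) \<noteq> (0::complex)"
  unfolding mult_eq_0_iff of_nat_eq_0_iff right_minus_eq of_nat_eq_iff by simp

text \<open>Applying e to a vanishing power j + 1 gives (j+1)(n-j) times power j. The scalar is
  non-zero for j > n, so vanishing descends to exponent n + 1.\<close>

lemma f_power_zero: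
  assumes t: "triple e f h" and x: "e * x = 0" "h * x = sc (of_nat n) * x" and k: "f ^ k * x = 0"
  shows "f ^ Suc n * x = 0"
proof (cases "n < k")
  case True
  have "f ^ j * x = 0" if "j \<le> k" "Suc n \<le> j" for j
    using that
  proof (induction rule: inc_induct)
    case (step j)
    then have "sc (of_nat (Suc j) * (of_nat n - of_nat j)) * (f ^ j * x) = 0"
      using e_f_power_hw[OF t x, of j] by simp
    then show ?case
      by (rule sc_cancel) (rule hwt_factor_nonzero, use step.prems in simp)
  qed (rule k)
  from this[of "Suc n"] show ?thesis using True by simp
next
  case False
  then obtain d where "Suc n = Suc d + k"
    by (metis add_Suc le_add_diff_inverse2 not_less)
  then show ?thesis using k by (simp only: power_add mult.assoc mult_zero_right)
qed

lemma e_power_zero: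
  assumes t: "triple e f h" and x: "x * f = 0" "x * h = sc (of_nat n) * x" and k: "x * e ^ k = 0"
  shows "x * e ^ Suc n = 0"
proof (cases "n < k")
  case True
  have "x * e ^ j = 0" if "j \<le> k" "Suc n \<le> j" for j
    using that
  proof (induction rule: inc_induct)
    case (step j)
    then have "sc (of_nat (Suc j) * (of_nat n - of_nat j)) * (x * e ^ j) = 0"
      using f_e_power_hw[OF t x, of j] by simp
    then show ?case
      by (rule sc_cancel) (rule hwt_factor_nonzero, use step.prems in simp)
  qed (rule k)
  from this[of "Suc n"] show ?thesis using True by simp
next
  case False
  then obtain d where "Suc n = k + Suc d"
    by (metis add.commute add_Suc le_add_diff_inverse2 not_less)
  then have "x * e ^ Suc n = (x * e ^ k) * e ^ Suc d"
    by (simp only: power_add mult.assoc)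
  then show ?thesis using k by simp
qed

text \<open>Induction on the number of roots in \<open>ls\<close>. Let \<open>l\<close> be a root of maximal real part and \<open>q\<close> the
  product of the other factors. Then \<open>u = q(h) g\<close> consists of highest weight vectors of weight \<open>l\<close>, a
  double root would force \<open>u = 0\<close>, and \<open>u\<close> is a multiple of an idempotent \<open>y\<close>. Its extension
  \<open>hw_ext n f y e\<close> is an idempotent intertwiner below \<open>g\<close>, and \<open>q(h)\<close> annihilates the difference.\<close>

lemma idempotent_induct:
  assumes t: "triple e f h"
    and zero: "P 0" and add: "\<And>a b. P a \<Longrightarrow> P b \<Longrightarrow> P (a + b)"
    and ext: "\<And>n y. hw_part n (e, f, h) (e, f, h) y \<Longrightarrow> y * y = y \<Longrightarrow> p * y = y \<Longrightarrow> y * p = y \<Longrightarrow> P (hw_ext n f y e)"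
  shows "g * e = e * g \<Longrightarrow> g * f = f * g \<Longrightarrow> g * h = h * g \<Longrightarrow> g * g = g \<Longrightarrow> p * g = g \<Longrightarrow> g * p = g
    \<Longrightarrow> rootprod ls h * g = 0 \<Longrightarrow> P g"
proof (induction "length ls" arbitrary: ls g rule: less_induct)
  case (less ls g)
  note ge = less.prems(1) and gf = less.prems(2) and gh = less.prems(3) and gg = less.prems(4)
    and pg = less.prems(5) and gp = less.prems(6) and ann = less.prems(7)
  show ?case
  proof (cases "ls = []")
    case True
    then show ?thesis using ann zero by simp
  next
    case False
    then have "Max (Re ` set ls) \<in> Re ` set ls" by (intro Max_in) auto
    then obtain l where l: "l \<in> set ls" and "Re l = Max (Re ` set ls)" by (metis imageE)
    then have maxl: "Re m \<le> Re l" if "m \<in> set ls" for m using that by simp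
    define ls' where "ls' = remove1 l ls"
    have len: "length ls' < length ls"
      using l length_pos_if_in_set[OF l] by (simp add: ls'_def length_remove1)
    define u where "u = rootprod ls' h * g"
    show ?thesis
    proof (cases "u = 0")
      case True
      then show ?thesis
        using less.hyps[OF len ge gf gh gg pg gp] by (simp add: u_def)
    next
      case u0: False
      have gR: "g * rootprod xs h = rootprod xs h * g" for xs
        by (rule rootprod_commute) (rule gh)
      have hR: "h * rootprod xs h = rootprod xs h * h" for xs
        by (rule rootprod_commute) simp
      have left_zero: "rootprod ls h * x = 0" if "g * x = x" for x
        by (metis ann mult.assoc mult_zero_left that)
      have right_zero: "x * rootprod ls h = 0" if "x * g = x" for x
        by (metis ann gR mult.assoc mult_zero_right that)
      have gek: "g * e ^ k = e ^ k * g" and gfk: "g * f ^ k = f ^ k * g" for k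
        using ge gf by (metis power_commuting_commutes)+
      have gu: "g * u = u"
        unfolding u_def by (metis gR gg mult.assoc)
      have ug: "u * g = u"
        unfolding u_def by (metis gg mult.assoc)
      have hu: "h * u = sc l * u"
      proof -
        have "(h - sc l) * (rootprod ls' h * g) = 0"
          using rootprod_remove1[OF l, of h] ann by (simp add: ls'_def mult.assoc)
        then show ?thesis by (simp add: u_def left_diff_distrib)
      qed
      have uh: "u * h = sc l * u"
        unfolding hu[symmetric] unfolding u_def by (metis gh hR mult.assoc)
      \<comment> \<open>The real part of l + 2 exceeds the maximum, so nothing of that weight
        survives; this is why \<open>u\<close> is killed by \<open>e\<close> on the left and by
        \<open>f\<close> on the right.\<close>
      have l2: "l + 2 \<notin> set ls" using maxl by fastforce
      have h_e: "h * e = e * h + 2 * e" and f_h: "f * h = h * f + 2 * f"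
        using t by (auto simp: triple_def)
      have eu: "e * u = 0"
      proof (rule eigen_not_root[OF _ left_zero l2])
        have "h * (e * u) = e * (h * u) + 2 * (e * u)"
          by (simp add: h_e distrib_right flip: mult.assoc)
        then show "h * (e * u) = sc (l + 2) * (e * u)"
          unfolding hu by (simp only: sc_left_commute two_scaled sc_hom distrib_right)
        show "g * (e * u) = e * u" by (metis ge gu mult.assoc)
      qed
      have uf: "u * f = 0"
      proof (rule eigen_not_root_right[OF _ right_zero l2])
        have "u * f * h = (u * h) * f + 2 * (u * f)"
          by (simp add: f_h distrib_left mult.assoc two_scaled sc_left_commute)
        then show "u * f * h = sc (l + 2) * (u * f)"
          unfolding uh by (simp only: two_scaled sc_hom distrib_right mult.assoc)
        show "u * f * g = u * f" by (metis gf ug mult.assoc)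
      qed
      note h_fku = h_f_power_hw[OF t hu]
      \<comment> \<open>Only finitely many weights occur, so the lowering string from
        \<open>u\<close> leaves the list of roots and must vanish there.\<close>
      obtain k :: nat where k: "l - 2 * of_nat k \<notin> set ls" by (rule exists_non_weight)
      have g_fk: "g * (f ^ j * x) = f ^ j * x" if "g * x = x" for j x
        by (metis gfk mult.assoc that)
      have fku: "f ^ k * u = 0"
        by (rule eigen_not_root[OF h_fku left_zero k]) (rule g_fk[OF gu])
      have uek: "u * e ^ k = 0"
        by (rule eigen_not_root_right[OF e_power_h_hw[OF t uh] right_zero k]) (metis gek ug mult.assoc)
      have "sc (hwt k l) * u = 0"
        using power_sandwich_eq[OF t eu hu, of k] fku by simp
      then have "hwt k l = 0" using u0 sc_cancel by blast
      \<comment> \<open>A factor l - n of \<open>hwt k l\<close> with n < k is zero: the highest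
        weight is a natural number.\<close>
      then obtain n where n: "n < k" "l = of_nat n"
        by (auto simp: hwt_def simp del: of_nat_Suc)
      have fnu: "f ^ Suc n * u = 0" and uen: "u * e ^ Suc n = 0"
        using f_power_zero[OF t eu _ fku] e_power_zero[OF t uf _ uek] hu uh n(2) by auto
      \<comment> \<open>With a double root, \<open>w\<close> would be a generalised highest weight
        vector with (h - l) w = u. Since e^k f^k kills it, so does h (h - 1) ... (h - k + 1). There
        l is a simple root, so the remaining factors kill \<open>u\<close> while acting on it by a
        non-zero scalar.\<close>
      have l_simple: "l \<notin> set ls'"
      proof
        assume l': "l \<in> set ls'"
        define w where "w = rootprod (remove1 l ls') h * g"
        have gw: "g * w = w"
          unfolding w_def by (metis gR gg mult.assoc)
        have "u = (h - sc l) * w"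
          unfolding u_def w_def rootprod_remove1[OF l'] by (simp add: mult.assoc)
        then have hw: "h * w = sc l * w + u" by (simp add: left_diff_distrib)
        have ew: "e * w = 0"
        proof (rule eigen_not_root[OF _ left_zero l2])
          have "h * (e * w) = e * (h * w) + 2 * (e * w)"
            by (simp add: h_e distrib_right flip: mult.assoc)
          then show "h * (e * w) = sc (l + 2) * (e * w)"
            unfolding hw by (simp add: eu distrib_left distrib_right two_scaled sc_left_commute del: sc_of_nat)
          show "g * (e * w) = e * w" by (metis ge gw mult.assoc)
        qed
        have fkw: "f ^ k * w = 0"
        proof (rule eigen_not_root[OF _ left_zero k])
          show "h * (f ^ k * w) = sc (l - 2 * of_nat k) * (f ^ k * w)"
          proof -
            have "h * (f ^ k * w) = f ^ k * (h * w) - sc (2 * of_nat k) * (f ^ k * w)"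
              using h_f_power[OF t, of k] by (metis left_diff_distrib mult.assoc)
            then show ?thesis
              unfolding hw by (simp only: distrib_left fku sc_left_commute[of "f ^ k"] sc_hom(4)
                  left_diff_distrib add_0_right)
          qed
          show "g * (f ^ k * w) = f ^ k * w" by (rule g_fk[OF gw])
        qed
        \<comment> \<open>Appending the empty list only fixes the type of the roots.\<close>
        define ns where "ns = map of_nat [0..<k] @ ([] :: complex list)"
        have "distinct ns" "l \<in> set ns"
          using n by (auto simp: ns_def distinct_map inj_on_def)
        have "sc (fact k) * (rootprod ns h * w) = 0"
          using power_sandwich_rootprod[OF t ew, of k] fkw by (simp add: ns_def)
        then have "rootprod ns h * w = 0"
          using sc_cancel[of "fact k"] by simp
        then have "(h - sc l) * rootprod (remove1 l ns) h * w = 0"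
          using rootprod_remove1[OF \<open>l \<in> set ns\<close>] by simp
        moreover have "(h - sc l) * rootprod (remove1 l ns) h = rootprod (remove1 l ns) h * (h - sc l)"
          by (rule rootprod_commute) (simp add: left_diff_distrib right_diff_distrib sc_commute)
        ultimately have "rootprod (remove1 l ns) h * u = 0"
          using \<open>u = (h - sc l) * w\<close> by (simp add: mult.assoc)
        moreover have "l \<notin> set (remove1 l ns)"
          using \<open>distinct ns\<close> by simp
        ultimately have "u = 0" by (rule eigen_not_root[OF hu])
        with u0 show False by simp
      qed
      \<comment> \<open>The value at l of the product q of the other factors. From u = q(h) g and g
        u = u it follows that u u = d u, so dividing \<open>u\<close> by \<open>d\<close> gives an
        idempotent.\<close>
      define d where "d = (\<Prod>m\<leftarrow>ls'. l - m)"
      have d: "d \<noteq> 0"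
        using l_simple by (auto simp: d_def prod_list_zero_iff)
      have Ru: "rootprod ls' h * u = sc d * u"
        unfolding d_def by (rule rootprod_eigen[OF hu])
      have uu: "u * u = sc d * u"
      proof -
        have "u * u = rootprod ls' h * (g * u)" by (simp add: u_def mult.assoc)
        then show ?thesis by (simp add: gu Ru)
      qed
      define y where "y = sc (inverse d) * u"
      have inv_d: "sc (inverse d) * (sc d * x) = x" for x
        using d by (simp flip: mult.assoc sc_hom(6))
      have yy: "y * y = y"
        by (simp add: y_def sc_mult_sc uu inv_d)
      have gy: "g * y = y" and yg: "y * g = y"
        by (simp_all add: y_def sc_left_commute gu ug mult.assoc)
      have py: "p * y = y" and yp: "y * p = y"
        using gy yg pg gp by (metis mult.assoc)+
      have part: "hw_part n (e, f, h) (e, f, h) y"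
        unfolding hw_part_def prod.case
        using eu hu uf uh fnu uen
        by (intro conjI) (metis n(2) y_def mult.assoc mult_zero_right sc_left_commute)+
      define E where "E = hw_ext n f y e"
      have PE: "P E"
        unfolding E_def by (rule ext[OF part yy py yp])
      have gE: "g * E = E" and Eg: "E * g = E"
      proof -
        have "g * (f ^ j * y * e ^ j) = f ^ j * y * e ^ j" for j
          using g_fk[OF gy, of j] by (metis mult.assoc)
        then show "g * E = E"
          by (simp add: E_def hw_ext_def sum_distrib_left sc_left_commute)
        have "f ^ j * y * e ^ j * g = f ^ j * y * e ^ j" for j
          using gek[of j] yg by (metis mult.assoc)
        then show "E * g = E"
          by (simp add: E_def hw_ext_def sum_distrib_right mult.assoc)
      qed
      have EE: "E * E = E"
        unfolding E_def hw_ext_mult[OF t part part] yy ..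
      \<comment> \<open>Only the summand j = 0 survives: for j > 0 the weight l - 2 j is either a
        root of the remaining product or no weight at all. Hence the product takes the same value on
        \<open>E\<close> as on \<open>g\<close>.\<close>
      have RE: "rootprod ls' h * E = u"
      proof -
        have term0: "rootprod ls' h * (f ^ j * y) = 0" if "0 < j" for j
        proof -
          have fjy: "h * (f ^ j * y) = sc (l - 2 * of_nat j) * (f ^ j * y)"
            by (rule h_f_power_hw[OF t]) (metis hu sc_left_commute y_def)
          show ?thesis
          proof (cases "l - 2 * of_nat j \<in> set ls")
            case True
            then have "l - 2 * of_nat j \<in> set ls'"
              using that by (auto simp: ls'_def in_set_remove1)
            then have "(\<Prod>m\<leftarrow>ls'. l - 2 * of_nat j - m) = 0"
              by (auto simp: prod_list_zero_iff)
            then show ?thesis using rootprod_eigen[OF fjy, of ls'] by simp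
          next
            case False
            then have "f ^ j * y = 0"
              using eigen_not_root[OF fjy left_zero] g_fk[OF gy] by blast
            then show ?thesis by simp
          qed
        qed
        have "rootprod ls' h * E
            = (\<Sum>j\<le>n. sc (inverse (hwt j (of_nat n))) * (rootprod ls' h * (f ^ j * y) * e ^ j))"
          by (simp add: E_def hw_ext_def sum_distrib_left sc_left_commute mult.assoc)
        also have "\<dots> = (\<Sum>j\<le>n. if j = 0 then rootprod ls' h * y else 0)"
          by (rule sum.cong) (auto simp: term0)
        also have "\<dots> = u"
          using Ru inv_d sc_left_commute[of "rootprod ls' h" "inverse d" u] by (simp add: y_def)
        finally show ?thesis .
      qed
      have "P (g - E)"
      proof (rule less.hyps[OF len])
        show "(g - E) * e = e * (g - E)" "(g - E) * f = f * (g - E)" "(g - E) * h = h * (g - E)"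
          using hw_ext_intertwines[OF t t part] ge gf gh
          by (simp_all add: E_def left_diff_distrib right_diff_distrib)
        show "(g - E) * (g - E) = g - E"
          by (simp add: left_diff_distrib right_diff_distrib gg gE Eg EE)
        show "p * (g - E) = g - E" "(g - E) * p = g - E"
          using pg gp gE Eg by (metis left_diff_distrib right_diff_distrib mult.assoc)+
        show "rootprod ls' h * (g - E) = 0"
          using RE by (simp add: right_diff_distrib u_def)
      qed
      from add[OF this PE] show ?thesis by simp
    qed
  qed
qed

section \<open>Modules over \<open>sl\<^sub>2\<close> are generated by the tensor powers of \<open>L(1)\<close>\<close>

definition eM :: "complex mat" where "eM = mat 2 2 (\<lambda>(i, j). if i = 0 \<and> j = 1 then 1 else 0)"
definition fM :: "complex mat" where "fM = mat 2 2 (\<lambda>(i, j). if i = 1 \<and> j = 0 then 1 else 0)"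
definition hM :: "complex mat" where "hM = mat 2 2 (\<lambda>(i, j). if i = j then (if i = 0 then 1 else -1) else 0)"

lemma less_2_iff: "(i::nat) < 2 \<longleftrightarrow> i = 0 \<or> i = 1"
  by auto

lemma sl2_basis_index:
  assumes "i < 2" "j < 2"
  shows "eM $$ (i, j) = (if i = 0 \<and> j = 1 then 1 else 0)"
    and "fM $$ (i, j) = (if i = 1 \<and> j = 0 then 1 else 0)"
    and "hM $$ (i, j) = (if i = j then (if i = 0 then 1 else -1) else 0)"
  using assms by (simp_all add: eM_def fM_def hM_def)

lemma sl2_basis_mem [simp]: "eM \<in> sl2" "fM \<in> sl2" "hM \<in> sl2"
  by (auto simp: sl2_def eM_def fM_def hM_def)

lemma sl2_basis_bracket:
  "bracket eM fM = hM" "bracket hM eM = 2 \<cdot>\<^sub>m eM" "bracket hM fM = (-2) \<cdot>\<^sub>m fM"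
  by (rule eq_matI; auto simp: bracket_def eM_def fM_def hM_def less_2_iff scalar_prod_def
      numeral_2_eq_2)+

lemma sl2_expand:
  assumes "x \<in> sl2"
  shows "x = (x $$ (0, 1) \<cdot>\<^sub>m eM + x $$ (1, 0) \<cdot>\<^sub>m fM) + x $$ (0, 0) \<cdot>\<^sub>m hM"
proof -
  have "x \<in> carrier_mat 2 2" "x $$ (Suc 0, Suc 0) = - x $$ (0, 0)"
    using assms by (auto simp: sl2_def add_eq_0_iff)
  then show ?thesis
    by (intro eq_matI) (auto simp: eM_def fM_def hM_def less_2_iff)
qed

lemma sl2_smult_add [simp]:
  "x \<in> sl2 \<Longrightarrow> c \<cdot>\<^sub>m x \<in> sl2" "x \<in> sl2 \<Longrightarrow> y \<in> sl2 \<Longrightarrow> x + y \<in> sl2"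
  by (auto simp: sl2_def algebra_simps add_eq_0_iff simp flip: distrib_left)

definition op :: "sl2_mod \<Rightarrow> complex mat \<Rightarrow> endo"
  where "op V x = of_mat (srep V x)"

lemma srep_carrier: "is_sl2_mod V \<Longrightarrow> x \<in> sl2 \<Longrightarrow> srep V x \<in> carrier_mat (sdim V) (sdim V)"
  by (auto simp: is_sl2_mod_def)

lemma op_pr:
  assumes "is_sl2_mod V" "x \<in> sl2"
  shows "pr (sdim V) * op V x = op V x" "op V x * pr (sdim V) = op V x"
  using pr_of_mat[OF srep_carrier[OF assms]] by (auto simp: op_def)

lemma op_add:
  assumes "is_sl2_mod V" "x \<in> sl2" "y \<in> sl2"
  shows "op V (x + y) = op V x + op V y"
  using assms of_mat_add[OF srep_carrier[OF assms(1,2)] srep_carrier[OF assms(1,3)]]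
  by (simp add: op_def is_sl2_mod_def)

lemma op_smult: "is_sl2_mod V \<Longrightarrow> x \<in> sl2 \<Longrightarrow> op V (c \<cdot>\<^sub>m x) = sc c * op V x"
  by (simp add: op_def is_sl2_mod_def of_mat_smult)

lemma op_bracket:
  assumes V: "is_sl2_mod V" and x: "x \<in> sl2" and y: "y \<in> sl2"
  shows "op V (bracket x y) = op V x * op V y - op V y * op V x"
proof -
  note c = srep_carrier[OF V x] srep_carrier[OF V y]
  have "srep V (bracket x y) = srep V x * srep V y - srep V y * srep V x"
    using assms by (simp add: is_sl2_mod_def bracket_def)
  then show ?thesis
    using of_mat_mult[OF c] of_mat_mult[OF c(2,1)]
      of_mat_minus[of "srep V x * srep V y" "sdim V" "sdim V" "srep V y * srep V x"] c
    by (simp add: op_def)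
qed

lemma op_expand:
  assumes "is_sl2_mod V" "x \<in> sl2"
  shows "op V x = sc (x $$ (0, 1)) * op V eM + sc (x $$ (1, 0)) * op V fM + sc (x $$ (0, 0)) * op V hM"
  by (subst sl2_expand[OF assms(2)]) (simp add: op_add op_smult assms(1))

lemma op_triple: "is_sl2_mod V \<Longrightarrow> triple (op V eM) (op V fM) (op V hM)"
  using op_bracket[of V eM fM] op_bracket[of V hM eM] op_bracket[of V hM fM]
  by (auto simp: triple_def sl2_basis_bracket op_smult two_scaled algebra_simps)

lemma hom_iff: "a \<in> Hom sl2_modules V W \<longleftrightarrow> is_sl2_hom a \<and> hdom a = V \<and> hcod a = W"
  by (auto simp: Hom_def sl2_modules_def)

text \<open>Commuting with e and f suffices: h is their commutator, and the three matrices span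
  \<open>sl2\<close>.\<close>

lemma mk_hom:
  assumes V: "is_sl2_mod V" and W: "is_sl2_mod W"
    and a: "pr (sdim W) * a = a" "a * pr (sdim V) = a"
    and comm: "op W eM * a = a * op V eM" "op W fM * a = a * op V fM"
  shows "Sl2_Hom V W (to_mat (sdim W) (sdim V) a) \<in> Hom sl2_modules V W"
proof -
  have "op U hM = op U eM * op U fM - op U fM * op U eM" if "is_sl2_mod U" for U
    using op_triple[OF that] by (simp add: triple_def)
  then have comm': "op W hM * a = a * op V hM"
    using comm V W by (simp add: left_diff_distrib right_diff_distrib) (metis mult.assoc)
  have "to_mat (sdim W) (sdim V) a * srep V x = srep W x * to_mat (sdim W) (sdim V) a" if "x \<in> sl2" for x
  proof (rule of_mat_inject)
    note c = srep_carrier[OF V that] srep_carrier[OF W that]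
    show "to_mat (sdim W) (sdim V) a * srep V x \<in> carrier_mat (sdim W) (sdim V)"
      "srep W x * to_mat (sdim W) (sdim V) a \<in> carrier_mat (sdim W) (sdim V)"
      using mult_carrier_mat[OF to_mat_carrier c(1)] mult_carrier_mat[OF c(2) to_mat_carrier] by simp_all
    have "a * op V x = op W x * a"
      by (simp add: op_expand[OF V that] op_expand[OF W that] distrib_left distrib_right
          sc_left_commute comm comm' mult.assoc)
    then show "of_mat (to_mat (sdim W) (sdim V) a * srep V x) = of_mat (srep W x * to_mat (sdim W) (sdim V) a)"
      using of_mat_mult[OF to_mat_carrier c(1), of "sdim W" a]
        of_mat_mult[OF c(2) to_mat_carrier, of "sdim V" a] of_mat_to_mat[OF a]
      by (simp add: op_def)
  qed
  then show ?thesis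
    by (simp add: hom_iff is_sl2_hom_def V W)
qed

lemma L1_mod: "is_sl2_mod L1"
proof -
  have "bracket x y \<in> sl2" if "x \<in> sl2" "y \<in> sl2" for x y
  proof -
    have "x \<in> carrier_mat 2 2" "x $$ (Suc 0, Suc 0) = - x $$ (0, 0)"
      "y \<in> carrier_mat 2 2" "y $$ (Suc 0, Suc 0) = - y $$ (0, 0)"
      using that by (auto simp: sl2_def add_eq_0_iff)
    then show ?thesis
      by (auto simp: sl2_def bracket_def scalar_prod_def numeral_2_eq_2)
  qed
  then show ?thesis
    by (auto simp: is_sl2_mod_def L1_def) (auto simp: sl2_def)
qed

section \<open>Tensor powers of L(1) and their extreme weight vectors\<close>

fun tpow :: "nat \<Rightarrow> sl2_mod"
  where "tpow 0 = sl2_unit" | "tpow (Suc n) = sl2_tensor L1 (tpow n)"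

text \<open>Closure under tensor products is read off from the monoidal category axioms, which
  replaces a computation with Kronecker products.\<close>

lemma tpow_mod: "monoidal_category sl2_modules \<Longrightarrow> is_sl2_mod (tpow n)"
proof (induction n)
  case 0
  then show ?case
    using monoidal_category.UnitO_Obj[of sl2_modules] by (simp add: sl2_modules_def)
next
  case (Suc n)
  then show ?case
    using monoidal_category.TensO_Obj[of sl2_modules L1 "tpow n"] L1_mod by (simp add: sl2_modules_def)
qed

lemma sdim_tpow: "sdim (tpow n) = 2 ^ n"
  by (induction n) (auto simp: sl2_unit_def sl2_tensor_def L1_def)

text \<open>Basis vector 0 is the n-fold tensor power of the first basis vector of L(1). Column 0
  shows that it is a highest weight vector of weight n; row 0 gives the dual statement for its
  coordinate functional.\<close>

lemma srep_tpow_corner: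
  assumes "monoidal_category sl2_modules"
  shows "i < 2 ^ n \<Longrightarrow> srep (tpow n) eM $$ (i, 0) = 0"
    and "i < 2 ^ n \<Longrightarrow> srep (tpow n) fM $$ (0, i) = 0"
    and "i < 2 ^ n \<Longrightarrow> srep (tpow n) hM $$ (i, 0) = (if i = 0 then of_nat n else 0)"
    and "i < 2 ^ n \<Longrightarrow> srep (tpow n) hM $$ (0, i) = (if i = 0 then of_nat n else 0)"
proof (induction n arbitrary: i)
  case 0
  { case 1 then show ?case by (simp add: sl2_unit_def) next
    case 2 then show ?case by (simp add: sl2_unit_def) next
    case 3 then show ?case by (simp add: sl2_unit_def) next
    case 4 then show ?case by (simp add: sl2_unit_def) }
next
  case (Suc n)
  have entry: "srep (tpow (Suc n)) x $$ (i, j) =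
      x $$ (i div 2 ^ n, j div 2 ^ n) * (if i mod 2 ^ n = j mod 2 ^ n then 1 else 0)
      + (if i div 2 ^ n = j div 2 ^ n then 1 else 0) * srep (tpow n) x $$ (i mod 2 ^ n, j mod 2 ^ n)"
    if "x \<in> sl2" "i < 2 ^ Suc n" "j < 2 ^ Suc n" for x i j
  proof -
    have "x \<in> carrier_mat 2 2" using that by (simp add: sl2_def)
    moreover have "srep (tpow n) x \<in> carrier_mat (2 ^ n) (2 ^ n)"
      using srep_carrier[OF tpow_mod[OF assms] that(1)] by (simp add: sdim_tpow)
    moreover have "i div 2 ^ n < 2" "j div 2 ^ n < 2"
      using that by (simp_all add: less_mult_imp_div_less mult.commute)
    ultimately show ?thesis
      using that by (auto simp: sl2_tensor_def L1_def kronecker_def sdim_tpow)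
  qed
  have small: "i mod 2 ^ n < 2 ^ n" for i :: nat by simp
  have div2: "i div 2 ^ n < 2" if "i < 2 ^ Suc n" for i :: nat
    using that by (simp add: less_mult_imp_div_less mult.commute)
  have i0: "i = 0 \<longleftrightarrow> i div 2 ^ n = 0 \<and> i mod 2 ^ n = 0" for i :: nat
    by (metis div_0 div_mult_mod_eq mod_0 mult_zero_left plus_nat.add_0)
  { case 1 then show ?case
      using entry[of eM i 0] Suc.IH(1)[OF small, of i] div2[of i] by (auto simp: sl2_basis_index less_2_iff) next
    case 2 then show ?case
      using entry[of fM 0 i] Suc.IH(2)[OF small, of i] div2[of i] by (auto simp: sl2_basis_index less_2_iff) next
    case 3 then show ?case
      using entry[of hM i 0] Suc.IH(3)[OF small, of i] div2[of i] i0[of i]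
      by (auto simp: sl2_basis_index less_2_iff) next
    case 4 then show ?case
      using entry[of hM 0 i] Suc.IH(4)[OF small, of i] div2[of i] i0[of i]
      by (auto simp: sl2_basis_index less_2_iff) }
qed

lemma of_mat_unit_op:
  assumes "A \<in> carrier_mat m n" "j < n" "\<And>i. i < m \<Longrightarrow> A $$ (i, j) = (if i = j then c else 0)"
  shows "of_mat A * unit_op j k = sc (if j < m then c else 0) * unit_op j k"
  using assms by (auto intro!: endo_eqI simp: app_simps of_mat.rep_eq unit_op.rep_eq
      if_distrib[of "\<lambda>t. _ * t"] cong: if_cong)

lemma unit_op_of_mat:
  assumes "A \<in> carrier_mat m n" "i < m" "\<And>j. j < n \<Longrightarrow> A $$ (i, j) = (if i = j then c else 0)"
  shows "unit_op k i * of_mat A = sc (if i < n then c else 0) * unit_op k i"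
  using assms by (auto intro!: endo_eqI simp: app_simps of_mat.rep_eq unit_op.rep_eq
      if_distrib[of "\<lambda>t. t * _"] cong: if_cong)

text \<open>The matrix unit at the corner combines the extreme vector with its coordinate
  functional. The string from it dies somewhere because weights are finite in number, and
  \<open>f_power_zero\<close> and \<open>e_power_zero\<close> sharpen the exponent to n + 1.\<close>

lemma tpow_hw:
  assumes mc: "monoidal_category sl2_modules"
  shows "hw_part n (op (tpow n) eM, op (tpow n) fM, op (tpow n) hM)
    (op (tpow n) eM, op (tpow n) fM, op (tpow n) hM) (unit_op 0 0)"
proof -
  define N where "N = sdim (tpow n)"
  define e f h where "e = op (tpow n) eM" and "f = op (tpow n) fM" and "h = op (tpow n) hM"
  have N: "N = 2 ^ n" "0 < N" by (simp_all add: N_def sdim_tpow)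
  note V = tpow_mod[OF mc, of n]
  have c: "srep (tpow n) x \<in> carrier_mat N N" if "x \<in> sl2" for x
    using srep_carrier[OF V that] by (simp add: N_def)
  note corner = srep_tpow_corner[OF mc, of _ n, folded N(1)]
  have t: "triple e f h" unfolding e_def f_def h_def by (rule op_triple[OF V])
  have eo: "e * unit_op 0 0 = 0"
    using of_mat_unit_op[OF c, of eM 0 0 0] corner(1) N(2) by (simp add: e_def op_def)
  have ho: "h * unit_op 0 0 = sc (of_nat n) * unit_op 0 0"
    using of_mat_unit_op[OF c, of hM 0 "of_nat n" 0] corner(3) N(2) by (simp add: h_def op_def)
  have fo: "unit_op 0 0 * f = 0"
    using unit_op_of_mat[OF c, of fM 0 0 0] corner(2) N(2) by (simp add: f_def op_def)
  have oh: "unit_op 0 0 * h = sc (of_nat n) * unit_op 0 0"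
    using unit_op_of_mat[OF c, of hM 0 "of_nat n" 0] corner(4) N(2) by (simp add: h_def op_def)
  have pe: "pr N * e = e" "e * pr N = e" and pf: "pr N * f = f" "f * pr N = f"
    and ph: "pr N * h = h" "h * pr N = h"
    using op_pr[OF V] by (simp_all add: N_def e_def f_def h_def)
  have pro: "pr N * unit_op 0 0 = unit_op 0 0" "unit_op 0 0 * pr N = unit_op 0 0"
    using N(2) by (auto intro!: endo_eqI simp: app_simps app_pr unit_op.rep_eq)
  obtain ls where ls: "rootprod ls h * pr N = 0"
    using annihilator_exists[OF ph] by blast
  have ls': "pr N * rootprod ls h = 0"
    using rootprod_commute[of "pr N" h ls] ph ls by simp
  obtain k :: nat where k: "of_nat n - 2 * of_nat k \<notin> set ls" by (rule exists_non_weight)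
  have "pr N * f ^ k = f ^ k * pr N" "pr N * e ^ k = e ^ k * pr N"
    using pf pe by (metis power_commuting_commutes)+
  then have "rootprod ls h * (f ^ k * unit_op 0 0) = 0" "unit_op 0 0 * e ^ k * rootprod ls h = 0"
    using ls ls' pro by (metis mult.assoc mult_zero_left mult_zero_right)+
  then have "f ^ k * unit_op 0 0 = 0" "unit_op 0 0 * e ^ k = 0"
    using eigen_not_root[OF h_f_power_hw[OF t ho] _ k]
      eigen_not_root_right[OF e_power_h_hw[OF t oh] _ k] by blast+
  then show ?thesis
    using f_power_zero[OF t eo ho] e_power_zero[OF t fo oh] eo ho fo oh
    unfolding hw_part_def prod.case e_def[symmetric] f_def[symmetric] h_def[symmetric] by blast
qed


definition hom_endos :: "sl2_hom set \<Rightarrow> sl2_mod \<Rightarrow> sl2_mod \<Rightarrow> endo set"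
  where "hom_endos K V W = (\<lambda>a. of_mat (hmat a)) ` (K \<inter> Hom sl2_modules V W)"

text \<open>\<open>K\<close> behaves like an ideal containing the identities of the tensor powers.
  By \<open>idempotent_induct\<close> the identity of \<open>V\<close> lies in it once every
  intertwiner with idempotent highest weight part does, and such an intertwiner is a sum of
  composites through \<open>tpow n\<close>.\<close>

theorem tpow_generate:
  assumes mc: "monoidal_category sl2_modules"
    and add: "\<And>a b V W. \<lbrakk>a \<in> K; b \<in> K; a \<in> Hom sl2_modules V W; b \<in> Hom sl2_modules V W\<rbrakk>
      \<Longrightarrow> Add sl2_modules a b \<in> K"
    and comp: "\<And>a b c T U V W. \<lbrakk>a \<in> K; a \<in> Hom sl2_modules U V; b \<in> Hom sl2_modules V W;
      c \<in> Hom sl2_modules T U\<rbrakk> \<Longrightarrow> Comp sl2_modules b (Comp sl2_modules a c) \<in> K"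
    and tp: "\<And>n. Ide sl2_modules (tpow n) \<in> K"
    and V: "is_sl2_mod V"
  shows "Ide sl2_modules V \<in> K"
proof -
  define N where "N = sdim V"
  define e f h where "e = op V eM" and "f = op V fM" and "h = op V hM"
  have t: "triple e f h" unfolding e_def f_def h_def by (rule op_triple[OF V])
  have pe: "pr N * e = e" "e * pr N = e" and pf: "pr N * f = f" "f * pr N = f"
    and ph: "pr N * h = h" "h * pr N = h"
    using op_pr[OF V] by (simp_all add: N_def e_def f_def h_def)
  have car: "hmat a \<in> carrier_mat (sdim U) (sdim T)" if "a \<in> Hom sl2_modules T U" for a T U
    using that by (auto simp: hom_iff is_sl2_hom_def)
  have sum_closed: "x + y \<in> hom_endos K V V" if "x \<in> hom_endos K V V" "y \<in> hom_endos K V V" for x y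
  proof -
    from that obtain a b where a: "a \<in> K" "a \<in> Hom sl2_modules V V" "x = of_mat (hmat a)"
      and b: "b \<in> K" "b \<in> Hom sl2_modules V V" "y = of_mat (hmat b)"
      by (auto simp: hom_endos_def)
    have "Add sl2_modules a b \<in> Hom sl2_modules V V"
      by (rule linear_category.Add_Hom[OF monoidal_category.axioms(1)[OF mc] a(2) b(2)])
    moreover have "of_mat (hmat (Add sl2_modules a b)) = x + y"
      using of_mat_add[OF car[OF a(2)] car[OF b(2)]] by (simp add: sl2_modules_def a b)
    ultimately show ?thesis
      using add[OF a(1) b(1) a(2) b(2)] unfolding hom_endos_def by force
  qed
  have factor: "b * a \<in> hom_endos K V V"
    if a: "pr (sdim (tpow n)) * a = a" "a * pr N = a" "op (tpow n) eM * a = a * e"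
      "op (tpow n) fM * a = a * f"
    and b: "pr N * b = b" "b * pr (sdim (tpow n)) = b" "e * b = b * op (tpow n) eM"
      "f * b = b * op (tpow n) fM" for n a b
  proof -
    define T where "T = tpow n"
    note T = tpow_mod[OF mc, of n, folded T_def]
    define A where "A = Sl2_Hom V T (to_mat (sdim T) N a)"
    define B where "B = Sl2_Hom T V (to_mat N (sdim T) b)"
    have A: "A \<in> Hom sl2_modules V T"
      unfolding A_def N_def by (rule mk_hom[OF V T]) (use a in \<open>simp_all add: N_def T_def e_def f_def h_def\<close>)
    have B: "B \<in> Hom sl2_modules T V"
      unfolding B_def N_def by (rule mk_hom[OF T V]) (use b in \<open>simp_all add: N_def T_def e_def f_def h_def\<close>)
    have I: "Ide sl2_modules T \<in> K" "Ide sl2_modules T \<in> Hom sl2_modules T T"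
      using tp[of n] linear_category.Ide_Hom[OF monoidal_category.axioms(1)[OF mc], of T] T
      by (simp_all add: T_def sl2_modules_def)
    have "Comp sl2_modules B (Comp sl2_modules (Ide sl2_modules T) A) \<in> K"
      by (rule comp[OF I B A])
    moreover have "Comp sl2_modules (Ide sl2_modules T) A = A"
      by (rule linear_category.Ide_left[OF monoidal_category.axioms(1)[OF mc] A])
    moreover have "Comp sl2_modules B A \<in> Hom sl2_modules V V"
      by (rule linear_category.Comp_Hom[OF monoidal_category.axioms(1)[OF mc] A B])
    moreover have "of_mat (hmat (Comp sl2_modules B A)) = b * a"
      using of_mat_mult[OF car[OF B] car[OF A]] of_mat_to_mat[of "sdim T" a N] of_mat_to_mat[of N b "sdim T"] a b
      by (simp add: sl2_modules_def A_def B_def T_def)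
    ultimately show ?thesis
      unfolding hom_endos_def by force
  qed
  \<comment> \<open>Zero is factored through \<open>tpow 0\<close>; any tensor power would
    serve.\<close>
  have zero: "0 \<in> hom_endos K V V"
    using factor[of 0 0 0] by simp
  obtain ls where ls: "rootprod ls h * pr N = 0"
    using annihilator_exists[OF ph] by blast
  have "pr N \<in> hom_endos K V V"
  proof (rule idempotent_induct[OF t, where p = "pr N" and ls = ls])
    fix n y assume y: "hw_part n (e, f, h) (e, f, h) y" "y * y = y" "pr N * y = y" "y * pr N = y"
    define T where "T = tpow n"
    define e' f' h' where "e' = op T eM" and "f' = op T fM" and "h' = op T hM"
    define M where "M = sdim T"
    note Tm = tpow_mod[OF mc, of n, folded T_def]
    have t': "triple e' f' h'" unfolding e'_def f'_def h'_def by (rule op_triple[OF Tm])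
    have pe': "pr M * e' = e'" "e' * pr M = e'" and pf': "pr M * f' = f'" "f' * pr M = f'"
      using op_pr[OF Tm] by (simp_all add: M_def e'_def f'_def h'_def)
    have o: "hw_part n (e', f', h') (e', f', h') (unit_op 0 0)"
      using tpow_hw[OF mc, of n] by (simp add: e'_def f'_def h'_def T_def)
    have "0 < M" by (simp add: M_def T_def sdim_tpow)
    then have pro: "pr M * unit_op 0 j = unit_op 0 j" "unit_op j 0 * pr M = unit_op j 0" for j
      by (auto intro!: endo_eqI simp: app_simps app_pr unit_op.rep_eq)
    \<comment> \<open>Inserting the corner unit transfers its highest weight conditions on the
      tensor power to \<open>unit_op i 0\<close> and \<open>unit_op 0 i\<close>.\<close>
    have o': "unit_op j 0 = unit_op j 0 * unit_op 0 0" "unit_op 0 j = unit_op 0 0 * unit_op 0 j" for j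
      by (simp_all add: unit_op_mult)
    note yp = y(1)[unfolded hw_part_def prod.case] and op = o[unfolded hw_part_def prod.case]
    have hb: "hw_part n (e, f, h) (e', f', h') (y * unit_op i 0)" for i
      unfolding hw_part_def prod.case using yp op o'(1)[of i]
      by (intro conjI) (metis mult.assoc mult_zero_left mult_zero_right sc_left_commute)+
    have ha: "hw_part n (e', f', h') (e, f, h) (unit_op 0 i * y)" for i
      unfolding hw_part_def prod.case using yp op o'(2)[of i]
      by (intro conjI) (metis mult.assoc mult_zero_left mult_zero_right sc_left_commute)+
    \<comment> \<open>Expanding the middle projection in y = y 1 y into matrix units gives y as the
      sum of (y E_{i0}) (E_{0i} y). Index 0 belongs to the tensor power, so each summand passes
      through its extreme vector, and \<open>hw_ext_mult\<close> turns the products into composites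
      of intertwiners.\<close>
    define b where "b i = hw_ext n f (y * unit_op i 0) e'" for i
    define a where "a i = hw_ext n f' (unit_op 0 i * y) e" for i
    have absorb: "pr k * hw_ext n g z d = hw_ext n g z d" "hw_ext n g z d * pr l = hw_ext n g z d"
      if "pr k * g = g" "g * pr k = g" "pr l * d = d" "d * pr l = d" "pr k * z = z" "z * pr l = z" for k l g d z
    proof -
      have "pr k * g ^ j = g ^ j * pr k" "pr l * d ^ j = d ^ j * pr l" for j
        using that by (metis power_commuting_commutes)+
      then have "pr k * (g ^ j * z * d ^ j) = g ^ j * z * d ^ j" "g ^ j * z * d ^ j * pr l = g ^ j * z * d ^ j" for j
        using that by (metis mult.assoc)+
      then show "pr k * hw_ext n g z d = hw_ext n g z d" "hw_ext n g z d * pr l = hw_ext n g z d"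
        by (simp_all add: hw_ext_def sum_distrib_left sum_distrib_right sc_left_commute mult.assoc)
    qed
    have ba: "b i * a i \<in> hom_endos K V V" for i
    proof (rule factor[of n])
      have zb: "pr N * (y * unit_op i 0) = y * unit_op i 0" "y * unit_op i 0 * pr M = y * unit_op i 0"
        using y(3) pro by (simp_all add: mult.assoc flip: mult.assoc[of "pr N" y])
      have za: "pr M * (unit_op 0 i * y) = unit_op 0 i * y" "unit_op 0 i * y * pr N = unit_op 0 i * y"
        using y(4) pro by (simp_all add: mult.assoc flip: mult.assoc[of "pr M"])
      show "pr (sdim (tpow n)) * a i = a i" "a i * pr N = a i"
        unfolding a_def T_def[symmetric] M_def[symmetric] by (rule absorb; fact)+
      show "pr N * b i = b i" "b i * pr (sdim (tpow n)) = b i"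
        unfolding b_def T_def[symmetric] M_def[symmetric] by (rule absorb; fact)+
      show "op (tpow n) eM * a i = a i * e" "op (tpow n) fM * a i = a i * f"
        using hw_ext_e[OF t' t ha] hw_ext_f[OF t' t ha] by (simp_all add: a_def e'_def f'_def h'_def T_def)
      show "e * b i = b i * op (tpow n) eM" "f * b i = b i * op (tpow n) fM"
        using hw_ext_e[OF t t' hb] hw_ext_f[OF t t' hb] by (simp_all add: b_def e'_def f'_def h'_def T_def)
    qed
    have "y = y * pr N * y" using y by simp
    also have "\<dots> = (\<Sum>i<N. (y * unit_op i 0) * (unit_op 0 i * y))"
      by (simp add: pr_unit_ops sum_distrib_left sum_distrib_right)
        (simp add: mult.assoc unit_op_mult flip: mult.assoc[of "unit_op _ _"])
    finally have "hw_ext n f y e = (\<Sum>i<N. hw_ext n f ((y * unit_op i 0) * (unit_op 0 i * y)) e)"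
      by (metis hw_ext_sum)
    also have "\<dots> = (\<Sum>i<N. b i * a i)"
      unfolding a_def b_def hw_ext_mult[OF t' hb ha] ..
    also have "\<dots> \<in> hom_endos K V V"
      using ba zero sum_closed by (induction N) auto
    finally show "hw_ext n f y e \<in> hom_endos K V V" .
  qed (use zero sum_closed pe pf ph ls in \<open>auto simp: pr_idem\<close>)
  then obtain a where a: "a \<in> K" "a \<in> Hom sl2_modules V V" "pr N = of_mat (hmat a)"
    by (auto simp: hom_endos_def)
  have "hmat a = 1\<^sub>m N"
    using a(3) car[OF a(2)] by (intro of_mat_inject[of _ N N]) (auto simp: pr_def N_def)
  moreover have "hdom a = V" "hcod a = V" using a(2) by (simp_all add: hom_iff)
  ultimately have "a = Ide sl2_modules V"
    by (cases a) (simp add: sl2_modules_def sl2_id_def N_def)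
  with a(1) show ?thesis by simp
qed

section \<open>The action of \<open>L(1)\<close>\<close>

text \<open>The tensor product of basis vectors i and j has index 2 i + j, so this is the
  antisymmetric vector, which spans the trivial summand. The signs here and in \<open>ev\<close>
  make both snake composites the identity; the circle \<open>ev_coev\<close> then has the value - 2,
  and its being non-zero makes the identity a retract of the double action.\<close>

definition coev :: sl2_hom
  where "coev = Sl2_Hom sl2_unit (sl2_tensor L1 L1)
    (mat 4 1 (\<lambda>(i, j). if i = 1 then - 1 else if i = 2 then 1 else 0))"

definition ev :: sl2_hom
  where "ev = Sl2_Hom (sl2_tensor L1 L1) sl2_unit
    (mat 1 4 (\<lambda>(i, j). if j = 1 then 1 else if j = 2 then - 1 else 0))"

lemma sdim_L1 [simp]: "sdim L1 = 2" and sdim_unit [simp]: "sdim sl2_unit = 1"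
  and sdim_tensor [simp]: "sdim (sl2_tensor V W) = sdim V * sdim W"
  by (simp_all add: L1_def sl2_unit_def sl2_tensor_def)

lemma less_4_iff: "(i::nat) < 4 \<longleftrightarrow> i = 0 \<or> i = 1 \<or> i = 2 \<or> i = 3"
  by auto

lemma sum_upto_4: "(\<Sum>i\<in>{0..<4}. g i) = g 0 + g 1 + g 2 + g (3::nat)" for g :: "nat \<Rightarrow> complex"
  by (simp add: numeral_eq_Suc)

lemma sum_upto_8: "(\<Sum>i\<in>{0..<8}. g i) = g 0 + g 1 + g 2 + g 3 + g 4 + g 5 + g 6 + g (7::nat)"
  for g :: "nat \<Rightarrow> complex"
  by (simp add: numeral_eq_Suc)

lemma coev_Hom:
  assumes mc: "monoidal_category sl2_modules"
  shows "coev \<in> Hom sl2_modules sl2_unit (sl2_tensor L1 L1)"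
    and "ev \<in> Hom sl2_modules (sl2_tensor L1 L1) sl2_unit"
proof -
  have U: "is_sl2_mod sl2_unit" using tpow_mod[OF mc, of 0] by simp
  have T: "is_sl2_mod (sl2_tensor L1 L1)"
    using monoidal_category.TensO_Obj[OF mc, of L1 L1] L1_mod by (simp add: sl2_modules_def)
  have rep: "srep sl2_unit x = 0\<^sub>m 1 1"
    "srep (sl2_tensor L1 L1) x = kronecker x (1\<^sub>m 2) + kronecker (1\<^sub>m 2) x" if "x \<in> sl2" for x
    using that by (simp_all add: sl2_unit_def sl2_tensor_def L1_def)
  have "hmat coev * srep sl2_unit x = srep (sl2_tensor L1 L1) x * hmat coev \<and>
      hmat ev * srep (sl2_tensor L1 L1) x = srep sl2_unit x * hmat ev" if x: "x \<in> sl2" for x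
  proof -
    have c: "x \<in> carrier_mat 2 2" and tr: "x $$ (Suc 0, Suc 0) = - x $$ (0, 0)"
      using x by (auto simp: sl2_def add_eq_0_iff)
    show ?thesis
      unfolding rep[OF x] using c tr
      by (intro conjI eq_matI) (auto simp: coev_def ev_def kronecker_def scalar_prod_def less_4_iff
          sum_upto_4)
  qed
  then show "coev \<in> Hom sl2_modules sl2_unit (sl2_tensor L1 L1)"
    "ev \<in> Hom sl2_modules (sl2_tensor L1 L1) sl2_unit"
    using U T by (auto simp: hom_iff is_sl2_hom_def) (auto simp: coev_def ev_def)
qed

lemma ev_coev: "Comp sl2_modules ev coev = Scale sl2_modules (- 2) (Ide sl2_modules sl2_unit)"
proof -
  have "hmat ev * hmat coev = (- 2) \<cdot>\<^sub>m 1\<^sub>m 1"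
    by (rule eq_matI) (auto simp: coev_def ev_def scalar_prod_def sum_upto_4)
  then show ?thesis
    by (simp add: sl2_modules_def sl2_id_def) (simp add: coev_def ev_def)
qed

lemma kronecker_ev_coev:
  "kronecker (1\<^sub>m 2) (hmat ev) * kronecker (hmat coev) (1\<^sub>m 2) = 1\<^sub>m 2"
  "kronecker (hmat ev) (1\<^sub>m 2) * kronecker (1\<^sub>m 2) (hmat coev) = 1\<^sub>m 2"
  by (rule eq_matI; auto simp: coev_def ev_def kronecker_def scalar_prod_def less_2_iff sum_upto_8)+

text \<open>The unit constraint is by definition \<open>sl2_id V\<close>, whose domain is
  \<open>V\<close>, whereas its typing axiom gives the tensor product as domain; comparing the two
  yields equality of objects. \<open>tensor_assoc\<close> below uses the associator in the same
  way.\<close>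

lemma unit_tensor:
  assumes mc: "monoidal_category sl2_modules" and V: "is_sl2_mod V"
  shows "sl2_tensor sl2_unit V = V" "sl2_tensor V sl2_unit = V"
  using monoidal_category.LUnit_Hom[OF mc, of V] monoidal_category.RUnit_Hom[OF mc, of V] V
  by (simp_all add: hom_iff) (simp_all add: sl2_modules_def sl2_id_def)

lemma snake:
  assumes mc: "monoidal_category sl2_modules"
  defines "T \<equiv> TensA sl2_modules" and "I \<equiv> Ide sl2_modules L1"
  shows "Comp sl2_modules (T I ev) (T coev I) = I" "Comp sl2_modules (T ev I) (T I coev) = I"
  using kronecker_ev_coev unit_tensor[OF mc L1_mod]
  by (simp_all add: T_def I_def sl2_modules_def sl2_id_def) (simp_all add: coev_def ev_def)

lemma sl2_modules_simps [simp]: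
  "Obj sl2_modules = {V. is_sl2_mod V}" "UnitO sl2_modules = sl2_unit" "TensO sl2_modules = sl2_tensor"
  "Ide sl2_modules = sl2_id" "Assoc sl2_modules U V W = sl2_id (sl2_tensor U (sl2_tensor V W))"
  "LUnit sl2_modules = sl2_id" "RUnit sl2_modules = sl2_id"
  by (simp_all add: sl2_modules_def)

context linear_category
begin

lemma is_iso_obtain:
  assumes "is_iso M f" "f \<in> Hom M X Y"
  obtains g where "g \<in> Hom M Y X" "g \<cdot> f = Ide M X" "f \<cdot> g = Ide M Y"
  using assms unfolding is_iso_def by (auto simp: Hom_iff)

definition inv_of :: "'m \<Rightarrow> 'm"
  where "inv_of f = (SOME g. g \<in> Hom M (Cod M f) (Dom M f) \<and> g \<cdot> f = Ide M (Dom M f) \<and> f \<cdot> g = Ide M (Cod M f))"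

lemma inv_of:
  assumes "is_iso M f" "f \<in> Hom M X Y"
  shows "inv_of f \<in> Hom M Y X" "inv_of f \<cdot> f = Ide M X" "f \<cdot> inv_of f = Ide M Y"
proof -
  obtain g where "g \<in> Hom M Y X" "g \<cdot> f = Ide M X" "f \<cdot> g = Ide M Y"
    using assms by (rule is_iso_obtain)
  then have "\<exists>g. g \<in> Hom M (Cod M f) (Dom M f) \<and> g \<cdot> f = Ide M (Dom M f) \<and> f \<cdot> g = Ide M (Cod M f)"
    using assms(2) by (auto simp: Hom_iff)
  from someI_ex[OF this] show "inv_of f \<in> Hom M Y X" "inv_of f \<cdot> f = Ide M X" "f \<cdot> inv_of f = Ide M Y"
    using assms(2) unfolding inv_of_def by (auto simp: Hom_iff)
qed

text \<open>Composites are kept nested to the right, so an equation between two-fold composites has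
  to be applied in front of a remaining factor \<open>x\<close>.\<close>

lemma comp_replace:
  assumes "a \<cdot> b = c \<cdot> d" "b \<in> Hom M X Y" "a \<in> Hom M Y Z" "d \<in> Hom M X Y'" "c \<in> Hom M Y' Z" "x \<in> Hom M W X"
  shows "a \<cdot> (b \<cdot> x) = c \<cdot> (d \<cdot> x)"
  using assms(1) Comp_assoc[OF assms(6,2,3)] Comp_assoc[OF assms(6,4,5)] by simp

lemma comp_cancel:
  assumes "a \<cdot> b = Ide M X" "b \<in> Hom M X Y" "a \<in> Hom M Y X" "x \<in> Hom M W X"
  shows "a \<cdot> (b \<cdot> x) = x"
  using assms(1) Comp_assoc[OF assms(4,2,3)] Ide_left[OF assms(4)] by simp

definition iso_hom :: "'o \<Rightarrow> 'o \<Rightarrow> 'm \<Rightarrow> bool"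
  where "iso_hom X Y f \<longleftrightarrow> f \<in> Hom M X Y \<and> (\<exists>g \<in> Hom M Y X. g \<cdot> f = Ide M X \<and> f \<cdot> g = Ide M Y)"

lemma iso_hom_comp:
  assumes "iso_hom X Y f" "iso_hom Y Z g"
  shows "iso_hom X Z (g \<cdot> f)"
proof -
  obtain f' g' where f: "f \<in> Hom M X Y" "f' \<in> Hom M Y X" "f' \<cdot> f = Ide M X" "f \<cdot> f' = Ide M Y"
    and g: "g \<in> Hom M Y Z" "g' \<in> Hom M Z Y" "g' \<cdot> g = Ide M Y" "g \<cdot> g' = Ide M Z"
    using assms unfolding iso_hom_def by blast
  have "(f' \<cdot> g') \<cdot> (g \<cdot> f) = f' \<cdot> ((g' \<cdot> g) \<cdot> f)" "(g \<cdot> f) \<cdot> (f' \<cdot> g') = g \<cdot> ((f \<cdot> f') \<cdot> g')"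
    using f(1,2) g(1,2) by (simp_all add: Hom_iff cat_simps)
  then show ?thesis
    unfolding iso_hom_def using f g Ide_left Comp_Hom by metis
qed

lemma is_iso_hom: "is_iso M f \<Longrightarrow> f \<in> Hom M X Y \<Longrightarrow> iso_hom X Y f"
  using inv_of unfolding iso_hom_def by blast

lemma iso_hom_inv: "is_iso M f \<Longrightarrow> f \<in> Hom M X Y \<Longrightarrow> iso_hom Y X (inv_of f)"
  using inv_of unfolding iso_hom_def by blast

lemma iso_hom_unit: "iso_hom X X f \<longleftrightarrow> unit_at X f"
  by (simp add: iso_hom_def unit_at_def)

end

section \<open>Self-adjointness of the action of L(1)\<close>

locale sl2_module_category = module_category sl2_modules M
  for M :: "(sl2_mod, sl2_hom, 'o, 'm, 'z) module_cat_scheme"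
begin

abbreviation comp (infixr "\<Zsemi>" 71) where "comp \<equiv> Comp M"
abbreviation "LL \<equiv> sl2_tensor L1 L1"
abbreviation "iL \<equiv> sl2_id L1"
abbreviation "act \<equiv> ActO M L1"
abbreviation "as U V X \<equiv> ActAssoc M U V X"

definition lift :: "'m \<Rightarrow> 'm" where "lift f = ActA M iL f"
definition \<eta> :: "'o \<Rightarrow> 'm" where
  "\<eta> X = as L1 L1 X \<Zsemi> ActA M coev (Ide M X) \<Zsemi> M.inv_of (ActUnit M X)"
definition \<epsilon> :: "'o \<Rightarrow> 'm" where
  "\<epsilon> X = ActUnit M X \<Zsemi> ActA M ev (Ide M X) \<Zsemi> M.inv_of (as L1 L1 X)"

lemma mods [simp]: "is_sl2_mod L1" "is_sl2_mod sl2_unit" "is_sl2_mod LL"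
  using L1_mod C.UnitO_Obj C.TensO_Obj[of L1 L1] by simp_all

lemma coevH: "coev \<in> Hom sl2_modules sl2_unit LL" and evH: "ev \<in> Hom sl2_modules LL sl2_unit"
  using coev_Hom[OF C.monoidal_category_axioms] by simp_all

lemma idH: "is_sl2_mod V \<Longrightarrow> sl2_id V \<in> Hom sl2_modules V V"
  using C.Ide_Hom by simp

lemmas unit_tensor_L1 [simp] = unit_tensor[OF C.monoidal_category_axioms L1_mod]

lemma tensor_assoc: "sl2_tensor LL L1 = sl2_tensor L1 LL"
  using C.Assoc_Hom[of L1 L1 L1] by (simp add: hom_iff) (simp add: sl2_id_def)

lemma as_Hom: "is_sl2_mod U \<Longrightarrow> is_sl2_mod V \<Longrightarrow> X \<in> Obj M \<Longrightarrow>
    as U V X \<in> Hom M (ActO M (sl2_tensor U V) X) (ActO M U (ActO M V X))"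
  using ActAssoc_Hom by simp

lemma as_iso: "is_sl2_mod U \<Longrightarrow> is_sl2_mod V \<Longrightarrow> X \<in> Obj M \<Longrightarrow> is_iso M (as U V X)"
  using ActAssoc_iso by simp

lemma u_Hom: "X \<in> Obj M \<Longrightarrow> ActUnit M X \<in> Hom M (ActO M sl2_unit X) X"
  using ActUnit_Hom by simp

lemma lift_Hom: "f \<in> Hom M X Z \<Longrightarrow> lift f \<in> Hom M (act X) (act Z)"
  unfolding lift_def by (rule ActA_Hom[OF idH]) simp_all

lemma act_Obj: "is_sl2_mod V \<Longrightarrow> X \<in> Obj M \<Longrightarrow> ActO M V X \<in> Obj M"
  using ActO_Obj by simp

lemma lift_Comp: "f \<in> Hom M X Z \<Longrightarrow> g \<in> Hom M Z W \<Longrightarrow> lift (g \<Zsemi> f) = lift g \<Zsemi> lift f"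
  unfolding lift_def using ActA_Comp[OF idH[of L1] idH[of L1], of f X Z g W] C.Ide_left[OF idH[of L1]] by simp

lemma lift_Ide: "X \<in> Obj M \<Longrightarrow> lift (Ide M X) = Ide M (act X)"
  unfolding lift_def using ActA_Ide[of L1 X] by simp

lemma actA_Comp: "a \<in> Hom sl2_modules V V' \<Longrightarrow> b \<in> Hom sl2_modules V' V'' \<Longrightarrow> X \<in> Obj M \<Longrightarrow>
    ActA M b (Ide M X) \<Zsemi> ActA M a (Ide M X) = ActA M (Comp sl2_modules b a) (Ide M X)"
  using ActA_Comp[OF _ _ M.Ide_Hom M.Ide_Hom, of a V V' b V'' X] M.Ide_left[OF M.Ide_Hom, of X] by simp

lemma actA_slide:
  assumes a: "a \<in> Hom sl2_modules V V'" and f: "f \<in> Hom M X Z"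
  shows "ActA M (sl2_id V') f \<Zsemi> ActA M a (Ide M X) = ActA M a (Ide M Z) \<Zsemi> ActA M (sl2_id V) f"
proof -
  have V: "is_sl2_mod V" "is_sl2_mod V'" using C.Hom_Obj[OF a] by simp_all
  have X: "X \<in> Obj M" "Z \<in> Obj M" using M.Hom_Obj[OF f] by simp_all
  show ?thesis
    using ActA_Comp[OF a idH[OF V(2)] M.Ide_Hom[OF X(1)] f] ActA_Comp[OF idH[OF V(1)] a f M.Ide_Hom[OF X(2)]]
      C.Ide_left[OF a] C.Ide_right[OF a] M.Ide_left[OF f] M.Ide_right[OF f] by simp
qed

end

text \<open>Passes from a square with invertible sides to the square of their inverses; in this way
  naturality of an associator or unit constraint is inherited by its chosen inverse.\<close>

lemma (in linear_category) turn_square: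
  assumes a: "a \<in> Hom M X X'" "a' \<in> Hom M X' X" "a \<cdot> a' = Ide M X'"
    and b: "b \<in> Hom M Y Y'" "b' \<in> Hom M Y' Y" "b' \<cdot> b = Ide M Y"
    and f: "f \<in> Hom M X Y" and f': "f' \<in> Hom M X' Y'" and eq: "b \<cdot> f = f' \<cdot> a"
  shows "b' \<cdot> f' = f \<cdot> a'"
proof -
  have "b' \<cdot> f' = b' \<cdot> ((f' \<cdot> a) \<cdot> a')"
    using Comp_assoc[OF a(2,1) f'] a(3) Ide_right[OF f'] by simp
  also have "\<dots> = ((b' \<cdot> b) \<cdot> f) \<cdot> a'"
    unfolding eq[symmetric] using a(1,2) b(1,2) f by (simp add: Hom_iff cat_simps)
  finally show ?thesis using b(3) Ide_left[OF f] by simp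
qed

context sl2_module_category
begin

abbreviation "aI U V X \<equiv> M.inv_of (as U V X)"
abbreviation "uI X \<equiv> M.inv_of (ActUnit M X)"

lemmas aI = M.inv_of[OF as_iso as_Hom]
lemmas uI = M.inv_of[OF ActUnit_iso u_Hom]

lemma act_coevH: "X \<in> Obj M \<Longrightarrow> ActA M coev (Ide M X) \<in> Hom M (ActO M sl2_unit X) (ActO M LL X)"
  and act_evH: "X \<in> Obj M \<Longrightarrow> ActA M ev (Ide M X) \<in> Hom M (ActO M LL X) (ActO M sl2_unit X)"
  using ActA_Hom[OF coevH M.Ide_Hom] ActA_Hom[OF evH M.Ide_Hom] by simp_all

lemma as_natural:
  assumes "a \<in> Hom sl2_modules U U'" "b \<in> Hom sl2_modules V V'" "X \<in> Obj M"
  shows "as U' V' X \<Zsemi> ActA M (TensA sl2_modules a b) (Ide M X)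
    = ActA M a (ActA M b (Ide M X)) \<Zsemi> as U V X"
  using ActAssoc_natural[OF assms(1,2) M.Ide_Hom[OF assms(3)]] .

lemma as_lift_lift:
  assumes f: "f \<in> Hom M X Z"
  shows "as L1 L1 Z \<Zsemi> ActA M (sl2_id LL) f = lift (lift f) \<Zsemi> as L1 L1 X"
  using ActAssoc_natural[OF idH[of L1] idH[of L1] f] C.TensA_Ide[of L1 L1] by (simp add: lift_def)

lemma eta_Hom: "X \<in> Obj M \<Longrightarrow> \<eta> X \<in> Hom M X (act (act X))"
  unfolding \<eta>_def by (intro M.Comp_Hom[OF M.Comp_Hom[OF uI(1) act_coevH] as_Hom]) simp_all

lemma eps_Hom: "X \<in> Obj M \<Longrightarrow> \<epsilon> X \<in> Hom M (act (act X)) X"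
  unfolding \<epsilon>_def by (intro M.Comp_Hom[OF M.Comp_Hom[OF aI(1) act_evH] u_Hom]) simp_all

lemma eta_natural:
  assumes f: "f \<in> Hom M X Z"
  shows "\<eta> Z \<Zsemi> f = lift (lift f) \<Zsemi> \<eta> X"
proof -
  have X: "X \<in> Obj M" and Z: "Z \<in> Obj M" using M.Hom_Obj[OF f] by auto
  note f1 = ActA_Hom[OF idH[OF mods(2)] f] and fLL = ActA_Hom[OF idH[OF mods(3)] f]
  note llf = lift_Hom[OF lift_Hom[OF f]] and a = as_Hom[OF mods(1) mods(1)]
  have 1: "uI Z \<Zsemi> f = ActA M (sl2_id sl2_unit) f \<Zsemi> uI X"
    by (rule M.turn_square[OF u_Hom[OF X] uI(1,3)[OF X X] u_Hom[OF Z] uI(1,2)[OF Z Z] f1 f])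
      (use ActUnit_natural[OF f] in simp)
  have "\<eta> Z \<Zsemi> f = as L1 L1 Z \<Zsemi> ActA M coev (Ide M Z) \<Zsemi> uI Z \<Zsemi> f"
    unfolding \<eta>_def using f a[OF Z] act_coevH[OF Z] uI(1)[OF Z Z] by (simp add: M.Hom_iff M.cat_simps)
  also have "\<dots> = as L1 L1 Z \<Zsemi> ActA M (sl2_id LL) f \<Zsemi> ActA M coev (Ide M X) \<Zsemi> uI X"
    unfolding 1
    using M.comp_replace[OF actA_slide[OF coevH f, symmetric] f1 act_coevH[OF Z] act_coevH[OF X] fLL uI(1)[OF X X]] by simp
  also have "\<dots> = lift (lift f) \<Zsemi> \<eta> X"
    unfolding \<eta>_def
    by (rule M.comp_replace[OF as_lift_lift[OF f] fLL a[OF Z] a[OF X] llf M.Comp_Hom[OF uI(1)[OF X X] act_coevH[OF X]]])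
  finally show ?thesis .
qed

lemma eps_natural:
  assumes f: "f \<in> Hom M X Z"
  shows "f \<Zsemi> \<epsilon> X = \<epsilon> Z \<Zsemi> lift (lift f)"
proof -
  have X: "X \<in> Obj M" and Z: "Z \<in> Obj M" using M.Hom_Obj[OF f] by auto
  note f1 = ActA_Hom[OF idH[OF mods(2)] f] and fLL = ActA_Hom[OF idH[OF mods(3)] f]
  note llf = lift_Hom[OF lift_Hom[OF f]] and a = as_Hom[OF mods(1) mods(1)]
  note aIX = aI[OF mods(1) mods(1) X mods(1) mods(1) X] and aIZ = aI[OF mods(1) mods(1) Z mods(1) mods(1) Z]
  have 1: "aI L1 L1 Z \<Zsemi> lift (lift f) = ActA M (sl2_id LL) f \<Zsemi> aI L1 L1 X"
    by (rule M.turn_square[OF a[OF X] aIX(1,3) a[OF Z] aIZ(1,2) fLL llf as_lift_lift[OF f]])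
  have "\<epsilon> Z \<Zsemi> lift (lift f) = ActUnit M Z \<Zsemi> ActA M ev (Ide M Z) \<Zsemi> aI L1 L1 Z \<Zsemi> lift (lift f)"
    unfolding \<epsilon>_def using llf aIZ(1) act_evH[OF Z] u_Hom[OF Z] by (simp add: M.Hom_iff M.cat_simps)
  also have "\<dots> = ActUnit M Z \<Zsemi> ActA M (sl2_id sl2_unit) f \<Zsemi> ActA M ev (Ide M X) \<Zsemi> aI L1 L1 X"
    unfolding 1
    using M.comp_replace[OF actA_slide[OF evH f, symmetric] fLL act_evH[OF Z] act_evH[OF X] f1 aIX(1)] by simp
  also have "\<dots> = f \<Zsemi> \<epsilon> X"
    unfolding \<epsilon>_def
    by (rule M.comp_replace[OF _ f1 u_Hom[OF Z] u_Hom[OF X] f M.Comp_Hom[OF aIX(1) act_evH[OF X]]])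
      (use ActUnit_natural[OF f] in simp)
  finally show ?thesis by simp
qed

text \<open>The associator in the middle cancels against its inverse, and \<open>ev\<close> after
  \<open>coev\<close> acts as the scalar - 2; the unit constraints then cancel as well.\<close>

lemma eps_eta:
  assumes X: "X \<in> Obj M"
  shows "M.unit_at X (\<epsilon> X \<Zsemi> \<eta> X)"
proof -
  note a = as_Hom[OF mods(1) mods(1) X] and aIX = aI[OF mods(1) mods(1) X mods(1) mods(1) X]
  note u = u_Hom[OF X] and uIX = uI[OF X X] and c = act_coevH[OF X] and e = act_evH[OF X]
  have "\<epsilon> X \<Zsemi> \<eta> X = ActUnit M X \<Zsemi> ActA M ev (Ide M X) \<Zsemi> aI L1 L1 X \<Zsemi> as L1 L1 X \<Zsemi>
      ActA M coev (Ide M X) \<Zsemi> uI X"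
    unfolding \<epsilon>_def \<eta>_def using a aIX(1) u uIX(1) c e by (simp add: M.Hom_iff M.cat_simps)
  also have "aI L1 L1 X \<Zsemi> as L1 L1 X \<Zsemi> ActA M coev (Ide M X) \<Zsemi> uI X = ActA M coev (Ide M X) \<Zsemi> uI X"
    by (rule M.comp_cancel[OF aIX(2) a aIX(1) M.Comp_Hom[OF uIX(1) c]])
  also have "ActUnit M X \<Zsemi> ActA M ev (Ide M X) \<Zsemi> ActA M coev (Ide M X) \<Zsemi> uI X
      = ActUnit M X \<Zsemi> (ActA M ev (Ide M X) \<Zsemi> ActA M coev (Ide M X)) \<Zsemi> uI X"
    using u uIX(1) c e by (simp add: M.Hom_iff M.cat_simps)
  also have "ActA M ev (Ide M X) \<Zsemi> ActA M coev (Ide M X) = Scale M (- 2) (Ide M (ActO M sl2_unit X))"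
    using actA_Comp[OF coevH evH X] ev_coev ActA_Scale_left[OF idH[OF mods(2)] M.Ide_Hom[OF X], of "- 2"]
      ActA_Ide[of sl2_unit X] X by simp
  also have "ActUnit M X \<Zsemi> Scale M (- 2) (Ide M (ActO M sl2_unit X)) \<Zsemi> uI X = Scale M (- 2) (Ide M X)"
  proof -
    have I: "Ide M (ActO M sl2_unit X) \<in> Hom M (ActO M sl2_unit X) (ActO M sl2_unit X)"
      using M.Ide_Hom act_Obj X by simp
    show ?thesis
      using M.Comp_Scale_left[OF uIX(1) I] M.Ide_left[OF uIX(1)] M.Comp_Scale_right[OF uIX(1) u] uIX(3) by simp
  qed
  finally show ?thesis
    using M.unit_at_Scale[OF M.unit_at_Ide[OF X], of "- 2"] by simp
qed

lemma snake_act: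
  assumes X: "X \<in> Obj M"
  shows "ActA M (TensA sl2_modules iL ev) (Ide M X) \<Zsemi> ActA M (TensA sl2_modules coev iL) (Ide M X) = Ide M (act X)"
    and "ActA M (TensA sl2_modules ev iL) (Ide M X) \<Zsemi> ActA M (TensA sl2_modules iL coev) (Ide M X) = Ide M (act X)"
  using actA_Comp[OF C.TensA_Hom[OF coevH idH[of L1]] _ X, of "TensA sl2_modules iL ev"]
    C.TensA_Hom[OF idH[of L1] evH] actA_Comp[OF C.TensA_Hom[OF idH[of L1] coevH] _ X, of "TensA sl2_modules ev iL"]
    C.TensA_Hom[OF evH idH[of L1]] snake[OF C.monoidal_category_axioms] ActA_Ide[of L1 X] X
  by (simp_all add: tensor_assoc)

context
  fixes X assumes X: "X \<in> Obj M"
begin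

private abbreviation "W \<equiv> ActO M (sl2_tensor L1 LL) X"

private lemma objs: "act X \<in> Obj M" "act (act X) \<in> Obj M" "ActO M LL X \<in> Obj M" "ActO M sl2_unit X \<in> Obj M"
  using X by (simp_all add: act_Obj)

private lemma maps:
  "as L1 L1 X \<in> Hom M (ActO M LL X) (act (act X))"
  "as L1 L1 (act X) \<in> Hom M (ActO M LL (act X)) (act (act (act X)))"
  "as L1 LL X \<in> Hom M W (act (ActO M LL X))"
  "as LL L1 X \<in> Hom M W (ActO M LL (act X))"
  "as sl2_unit L1 X \<in> Hom M (act X) (ActO M sl2_unit (act X))"
  "as L1 sl2_unit X \<in> Hom M (act X) (act (ActO M sl2_unit X))"
  using as_Hom[of L1 L1 X] as_Hom[of L1 L1 "act X"] as_Hom[of L1 LL X] as_Hom[of LL L1 X]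
    as_Hom[of sl2_unit L1 X] as_Hom[of L1 sl2_unit X] X objs by (simp_all add: tensor_assoc)

private lemma isos:
  "is_iso M (as L1 L1 X)" "is_iso M (as L1 L1 (act X))" "is_iso M (as L1 LL X)"
  "is_iso M (as LL L1 X)" "is_iso M (as sl2_unit L1 X)" "is_iso M (as L1 sl2_unit X)"
  using X objs by (simp_all add: as_iso)

private lemma tens_maps:
  "ActA M (TensA sl2_modules coev iL) (Ide M X) \<in> Hom M (act X) W"
  "ActA M (TensA sl2_modules iL ev) (Ide M X) \<in> Hom M W (act X)"
  "ActA M (TensA sl2_modules iL coev) (Ide M X) \<in> Hom M (act X) W"
  "ActA M (TensA sl2_modules ev iL) (Ide M X) \<in> Hom M W (act X)"
  using ActA_Hom[OF C.TensA_Hom[OF coevH idH[of L1]] M.Ide_Hom[OF X]]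
    ActA_Hom[OF C.TensA_Hom[OF idH[of L1] evH] M.Ide_Hom[OF X]]
    ActA_Hom[OF C.TensA_Hom[OF idH[of L1] coevH] M.Ide_Hom[OF X]]
    ActA_Hom[OF C.TensA_Hom[OF evH idH[of L1]] M.Ide_Hom[OF X]]
  by (simp_all add: tensor_assoc)

text \<open>The associator of \<open>sl2_modules\<close> is an identity, so one factor of
  \<open>act_pentagon\<close> disappears.\<close>

private lemma pentagon: "lift (as L1 L1 X) \<Zsemi> as L1 LL X = as L1 L1 (act X) \<Zsemi> as LL L1 X"
proof -
  have "is_sl2_mod (sl2_tensor L1 LL)" using C.TensO_Obj[of L1 LL] by simp
  then have "ActA M (Assoc sl2_modules L1 L1 L1) (Ide M X) = Ide M W"
    using ActA_Ide[of "sl2_tensor L1 LL" X] X by simp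
  then show ?thesis
    using act_pentagon[of L1 L1 L1 X] X M.Ide_right[OF M.Comp_Hom[OF maps(3) lift_Hom[OF maps(1)]]]
    by (simp add: lift_def)
qed

private lemma act_ev_coev_lift:
  "ActA M iL (ActA M ev (Ide M X)) = lift (ActA M ev (Ide M X))"
  "ActA M iL (ActA M coev (Ide M X)) = lift (ActA M coev (Ide M X))"
  "ActA M ev (ActA M iL (Ide M X)) = ActA M ev (Ide M (act X))"
  "ActA M coev (ActA M iL (Ide M X)) = ActA M coev (Ide M (act X))"
  using ActA_Ide[of L1 X] X by (simp_all add: lift_def)

private lemma inv_lift: "lift (as L1 L1 X) \<Zsemi> lift (aI L1 L1 X) = Ide M (act (act (act X)))"
  "lift (aI L1 L1 X) \<Zsemi> lift (as L1 L1 X) = Ide M (act (ActO M LL X))"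
  "lift (ActUnit M X) \<Zsemi> lift (uI X) = Ide M (act X)"
  "lift (uI X) \<Zsemi> lift (ActUnit M X) = Ide M (act (ActO M sl2_unit X))"
  using M.inv_of[OF isos(1) maps(1)] maps(1) uI[OF X X] u_Hom[OF X] objs X
  by (simp_all flip: lift_Comp add: lift_Ide)

text \<open>The pentagon and naturality of the associators bring \<open>coev\<close> and
  \<open>ev\<close> next to each other, and the snake identity removes them. What remains is built
  from unit constraints and associators involving the unit object, each of them invertible.\<close>

lemma zigzag_iso: "M.unit_at (act X) (lift (\<epsilon> X) \<Zsemi> \<eta> (act X))"
proof -
  let ?u = "ActUnit M X" and ?e = "ActA M ev (Ide M X)" and ?a = "as L1 L1 X"
    and ?a' = "as L1 L1 (act X)" and ?b = "as L1 LL X" and ?d = "as LL L1 X"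
    and ?c' = "ActA M coev (Ide M (act X))" and ?u' = "uI (act X)"
    and ?C = "ActA M (TensA sl2_modules coev iL) (Ide M X)"
    and ?E = "ActA M (TensA sl2_modules iL ev) (Ide M X)"
    and ?p = "as sl2_unit L1 X" and ?q = "as L1 sl2_unit X"
  note invs = M.inv_of[OF isos(1) maps(1)] M.inv_of[OF isos(4) maps(4)] M.inv_of[OF isos(5) maps(5)]
  note e = act_evH[OF X] and u = u_Hom[OF X] and u' = uI(1)[OF objs(1) objs(1)] and c' = act_coevH[OF objs(1)]
  note le = lift_Hom[OF e] and lu = lift_Hom[OF u] and laI = lift_Hom[OF invs(1)]
  have lift_eps: "lift (\<epsilon> X) = lift ?u \<Zsemi> lift ?e \<Zsemi> lift (M.inv_of ?a)"
    unfolding \<epsilon>_def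
    using lift_Comp[OF M.Comp_Hom[OF invs(1) e] u] lift_Comp[OF invs(1) e] by simp
  have k1: "lift (M.inv_of ?a) \<Zsemi> ?a' = ?b \<Zsemi> M.inv_of ?d"
    by (rule M.turn_square[OF maps(4) invs(4,6) lift_Hom[OF maps(1)] laI inv_lift(2) maps(3,2) pentagon])
  have k2: "M.inv_of ?d \<Zsemi> ?c' = ?C \<Zsemi> M.inv_of ?p"
    by (rule M.turn_square[OF maps(5) invs(7,9) maps(4) invs(4,5) tens_maps(1) c'])
      (use as_natural[OF coevH idH[OF mods(1)] X] in \<open>simp add: act_ev_coev_lift tensor_assoc\<close>)
  have k3: "lift ?e \<Zsemi> ?b = ?q \<Zsemi> ?E"
    using as_natural[OF idH[OF mods(1)] evH X] by (simp add: act_ev_coev_lift)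
  have pu: "M.inv_of ?p \<Zsemi> ?u' \<in> Hom M (act X) (act X)" by (rule M.Comp_Hom[OF u' invs(7)])
  have "lift (\<epsilon> X) \<Zsemi> \<eta> (act X) = lift ?u \<Zsemi> lift ?e \<Zsemi> lift (M.inv_of ?a) \<Zsemi> ?a' \<Zsemi> ?c' \<Zsemi> ?u'"
    unfolding lift_eps \<eta>_def
    using lu le laI maps(2) c' u' by (simp add: M.Hom_iff M.cat_simps)
  also have "lift (M.inv_of ?a) \<Zsemi> ?a' \<Zsemi> ?c' \<Zsemi> ?u' = ?b \<Zsemi> M.inv_of ?d \<Zsemi> ?c' \<Zsemi> ?u'"
    by (rule M.comp_replace[OF k1 maps(2) laI invs(4) maps(3) M.Comp_Hom[OF u' c']])
  also have "M.inv_of ?d \<Zsemi> ?c' \<Zsemi> ?u' = ?C \<Zsemi> M.inv_of ?p \<Zsemi> ?u'"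
    by (rule M.comp_replace[OF k2 c' invs(4) invs(7) tens_maps(1) u'])
  also have "lift ?e \<Zsemi> ?b \<Zsemi> ?C \<Zsemi> M.inv_of ?p \<Zsemi> ?u' = ?q \<Zsemi> ?E \<Zsemi> ?C \<Zsemi> M.inv_of ?p \<Zsemi> ?u'"
    by (rule M.comp_replace[OF k3 maps(3) le tens_maps(2) maps(6) M.Comp_Hom[OF pu tens_maps(1)]])
  also have "?E \<Zsemi> ?C \<Zsemi> M.inv_of ?p \<Zsemi> ?u' = M.inv_of ?p \<Zsemi> ?u'"
    by (rule M.comp_cancel[OF snake_act(1)[OF X] tens_maps(1,2) pu])
  finally have eq: "lift (\<epsilon> X) \<Zsemi> \<eta> (act X) = lift ?u \<Zsemi> ?q \<Zsemi> M.inv_of ?p \<Zsemi> ?u'" .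
  have "M.iso_hom (act (ActO M sl2_unit X)) (act X) (lift ?u)"
    unfolding M.iso_hom_def using lu lift_Hom[OF uI(1)[OF X X]] inv_lift(3,4) by blast
  then have "M.iso_hom (act X) (act X) (lift ?u \<Zsemi> ?q \<Zsemi> M.inv_of ?p \<Zsemi> ?u')"
    by (rule M.iso_hom_comp[OF M.iso_hom_comp[OF M.iso_hom_comp[OF
            M.iso_hom_inv[OF ActUnit_iso[OF objs(1)] u_Hom[OF objs(1)]]
            M.iso_hom_inv[OF isos(5) maps(5)]] M.is_iso_hom[OF isos(6) maps(6)]]])
  then show ?thesis unfolding eq M.iso_hom_unit .
qed

lemma zigzag_iso': "M.unit_at (act X) (\<epsilon> (act X) \<Zsemi> lift (\<eta> X))"
proof -
  let ?u' = "ActUnit M (act X)" and ?e' = "ActA M ev (Ide M (act X))" and ?a = "as L1 L1 X"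
    and ?a' = "as L1 L1 (act X)" and ?b = "as L1 LL X" and ?d = "as LL L1 X"
    and ?c = "ActA M coev (Ide M X)"
    and ?C = "ActA M (TensA sl2_modules iL coev) (Ide M X)"
    and ?E = "ActA M (TensA sl2_modules ev iL) (Ide M X)"
    and ?p = "as sl2_unit L1 X" and ?q = "as L1 sl2_unit X"
  note invs = M.inv_of[OF isos(2) maps(2)] M.inv_of[OF isos(3) maps(3)] M.inv_of[OF isos(6) maps(6)]
  note c = act_coevH[OF X] and uIX = uI(1)[OF X X] and u' = u_Hom[OF objs(1)] and e' = act_evH[OF objs(1)]
  note lc = lift_Hom[OF c] and luI = lift_Hom[OF uIX] and la = lift_Hom[OF maps(1)]
  have lift_eta: "lift (\<eta> X) = lift ?a \<Zsemi> lift ?c \<Zsemi> lift (uI X)"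
    unfolding \<eta>_def
    using lift_Comp[OF M.Comp_Hom[OF uIX c] maps(1)] lift_Comp[OF uIX c] by simp
  have k1: "M.inv_of ?a' \<Zsemi> lift ?a = ?d \<Zsemi> M.inv_of ?b"
    by (rule M.turn_square[OF maps(3) invs(4,6) maps(2) invs(1,2) maps(4) la pentagon[symmetric]])
  have k2: "M.inv_of ?b \<Zsemi> lift ?c = ?C \<Zsemi> M.inv_of ?q"
    by (rule M.turn_square[OF maps(6) invs(7,9) maps(3) invs(4,5) tens_maps(3) lc])
      (use as_natural[OF idH[OF mods(1)] coevH X] in \<open>simp add: act_ev_coev_lift\<close>)
  have k3: "?e' \<Zsemi> ?d = ?p \<Zsemi> ?E"
    using as_natural[OF evH idH[OF mods(1)] X] by (simp add: act_ev_coev_lift)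
  have qu: "M.inv_of ?q \<Zsemi> lift (uI X) \<in> Hom M (act X) (act X)" by (rule M.Comp_Hom[OF luI invs(7)])
  have "\<epsilon> (act X) \<Zsemi> lift (\<eta> X) = ?u' \<Zsemi> ?e' \<Zsemi> M.inv_of ?a' \<Zsemi> lift ?a \<Zsemi> lift ?c \<Zsemi> lift (uI X)"
    unfolding lift_eta \<epsilon>_def
    using u' e' invs(1) la lc luI by (simp add: M.Hom_iff M.cat_simps)
  also have "M.inv_of ?a' \<Zsemi> lift ?a \<Zsemi> lift ?c \<Zsemi> lift (uI X) = ?d \<Zsemi> M.inv_of ?b \<Zsemi> lift ?c \<Zsemi> lift (uI X)"
    by (rule M.comp_replace[OF k1 la invs(1) invs(4) maps(4) M.Comp_Hom[OF luI lc]])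
  also have "M.inv_of ?b \<Zsemi> lift ?c \<Zsemi> lift (uI X) = ?C \<Zsemi> M.inv_of ?q \<Zsemi> lift (uI X)"
    by (rule M.comp_replace[OF k2 lc invs(4) invs(7) tens_maps(3) luI])
  also have "?e' \<Zsemi> ?d \<Zsemi> ?C \<Zsemi> M.inv_of ?q \<Zsemi> lift (uI X) = ?p \<Zsemi> ?E \<Zsemi> ?C \<Zsemi> M.inv_of ?q \<Zsemi> lift (uI X)"
    by (rule M.comp_replace[OF k3 maps(4) e' tens_maps(4) maps(5) M.Comp_Hom[OF qu tens_maps(3)]])
  also have "?E \<Zsemi> ?C \<Zsemi> M.inv_of ?q \<Zsemi> lift (uI X) = M.inv_of ?q \<Zsemi> lift (uI X)"
    by (rule M.comp_cancel[OF snake_act(2)[OF X] tens_maps(3,4) qu])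
  finally have eq: "\<epsilon> (act X) \<Zsemi> lift (\<eta> X) = ?u' \<Zsemi> ?p \<Zsemi> M.inv_of ?q \<Zsemi> lift (uI X)" .
  have "M.iso_hom (act X) (act (ActO M sl2_unit X)) (lift (uI X))"
    unfolding M.iso_hom_def using luI lift_Hom[OF u_Hom[OF X]] inv_lift(3,4) by blast
  then have "M.iso_hom (act X) (act X) (?u' \<Zsemi> ?p \<Zsemi> M.inv_of ?q \<Zsemi> lift (uI X))"
    by (rule M.iso_hom_comp[OF M.iso_hom_comp[OF M.iso_hom_comp[OF _ M.iso_hom_inv[OF isos(6) maps(6)]]
            M.is_iso_hom[OF isos(5) maps(5)]] M.is_iso_hom[OF ActUnit_iso[OF objs(1)] u_Hom[OF objs(1)]]])
  then show ?thesis unfolding eq M.iso_hom_unit .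
qed

end

sublocale adj: self_adjoint M act lift \<eta> \<epsilon>
proof unfold_locales
  fix f g :: 'm and X Z :: 'o
  assume "f \<in> Hom M X Z" "g \<in> Hom M X Z"
  then show "lift (Add M f g) = Add M (lift f) (lift g)"
    unfolding lift_def using ActA_Add_right[OF idH[OF mods(1)]] by blast
next
  fix f :: 'm and X Z :: 'o and c
  assume "f \<in> Hom M X Z"
  then show "lift (Scale M c f) = Scale M c (lift f)"
    unfolding lift_def using ActA_Scale_right[OF idH[OF mods(1)]] by blast
qed (simp_all add: act_Obj lift_Hom lift_Ide lift_Comp eta_Hom eps_Hom eta_natural eps_natural eps_eta
    zigzag_iso zigzag_iso')

end

section \<open>Invariance of the radical under every module\<close>

context sl2_module_category
begin

lemma actA_decompose:
  assumes a: "a \<in> Hom sl2_modules U V" and b: "b \<in> Hom sl2_modules V W" and c: "c \<in> Hom sl2_modules T U"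
    and f: "f \<in> Hom M X Z"
  shows "ActA M (Comp sl2_modules b (Comp sl2_modules a c)) f
    = ActA M b (Ide M Z) \<Zsemi> ActA M a f \<Zsemi> ActA M c (Ide M X)"
proof -
  have X: "X \<in> Obj M" "Z \<in> Obj M" using M.Hom_Obj[OF f] by simp_all
  show ?thesis
    using ActA_Comp[OF c a M.Ide_Hom[OF X(1)] f] ActA_Comp[OF C.Comp_Hom[OF c a] b f M.Ide_Hom[OF X(2)]]
      M.Ide_left[OF f] M.Ide_right[OF f] by simp
qed

text \<open>The associator identifies the action of a tensor power with an iterated
  \<open>lift\<close>, and the unit constraint handles the empty power; \<open>tpow_generate\<close>
  carries the property to all modules.\<close>

lemma actA_radical:
  assumes lift: "\<And>X Z f. f \<in> radical M X Z \<Longrightarrow> lift f \<in> radical M (act X) (act Z)"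
    and V: "is_sl2_mod V" and f: "f \<in> radical M X Z"
  shows "ActA M (sl2_id V) f \<in> radical M (ActO M V X) (ActO M V Z)"
proof -
  note mc = C.monoidal_category_axioms
  \<comment> \<open>The property is stated for morphisms of modules, so that it is closed under sums
    and under composition on both sides; for the identity of \<open>V\<close> it is the
    claim.\<close>
  define K where "K = {a. \<forall>X Z. \<forall>f \<in> radical M X Z. ActA M a f \<in> radical M (ActO M (hdom a) X) (ActO M (hcod a) Z)}"
  have K: "a \<in> K \<longleftrightarrow> (\<forall>X Z. \<forall>f \<in> radical M X Z. ActA M a f \<in> radical M (ActO M U X) (ActO M V Z))"
    if "a \<in> Hom sl2_modules U V" for a U V
    using that by (simp add: K_def hom_iff)
  have "Ide sl2_modules V \<in> K"
  proof (rule tpow_generate[OF mc _ _ _ V])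
    fix a b V W assume ab: "a \<in> K" "b \<in> K" "a \<in> Hom sl2_modules V W" "b \<in> Hom sl2_modules V W"
    show "Add sl2_modules a b \<in> K"
      unfolding K[OF C.Add_Hom[OF ab(3,4)]]
    proof (intro allI ballI)
      fix X Z f assume f: "f \<in> radical M X Z"
      show "ActA M (Add sl2_modules a b) f \<in> radical M (ActO M V X) (ActO M W Z)"
        using ActA_Add_left[OF ab(3,4) M.radical_Hom[OF f]] f ab(1,2)[unfolded K[OF ab(3)] K[OF ab(4)]]
        by (simp add: M.radical_Add)
    qed
  next
    fix a b c T U V W
    assume a: "a \<in> K" "a \<in> Hom sl2_modules U V" and b: "b \<in> Hom sl2_modules V W"
      and c: "c \<in> Hom sl2_modules T U"
    show "Comp sl2_modules b (Comp sl2_modules a c) \<in> K"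
      unfolding K[OF C.Comp_Hom[OF C.Comp_Hom[OF c a(2)] b]]
    proof (intro allI ballI)
      fix X Z f assume f: "f \<in> radical M X Z"
      note F = M.radical_Hom[OF f]
      have X: "X \<in> Obj M" "Z \<in> Obj M" using M.Hom_Obj[OF F] by simp_all
      have "ActA M a f \<in> radical M (ActO M U X) (ActO M V Z)"
        using a(1) f unfolding K[OF a(2)] by blast
      then show "ActA M (Comp sl2_modules b (Comp sl2_modules a c)) f \<in> radical M (ActO M T X) (ActO M W Z)"
        unfolding actA_decompose[OF a(2) b c F]
        using ActA_Hom[OF b M.Ide_Hom[OF X(2)]] ActA_Hom[OF c M.Ide_Hom[OF X(1)]]
        by (intro M.radical_Comp_left[OF M.radical_Comp_right])
    qed
  next
    fix n
    show "Ide sl2_modules (tpow n) \<in> K"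
    proof (induction n)
      case 0
      have "ActA M (sl2_id sl2_unit) f \<in> radical M (ActO M sl2_unit X) (ActO M sl2_unit Z)"
        if f: "f \<in> radical M X Z" for X Z f
      proof -
        note F = M.radical_Hom[OF f]
        have X: "X \<in> Obj M" "Z \<in> Obj M" using M.Hom_Obj[OF F] by simp_all
        note uZ = uI[OF X(2) X(2)]
        have "ActA M (sl2_id sl2_unit) f = uI Z \<Zsemi> ActUnit M Z \<Zsemi> ActA M (sl2_id sl2_unit) f"
          using M.comp_cancel[OF uZ(2) u_Hom[OF X(2)] uZ(1) ActA_Hom[OF idH[OF mods(2)] F]] by simp
        also have "\<dots> = uI Z \<Zsemi> f \<Zsemi> ActUnit M X"
          using ActUnit_natural[OF F] by simp
        also have "\<dots> \<in> radical M (ActO M sl2_unit X) (ActO M sl2_unit Z)"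
          by (rule M.radical_Comp_left[OF M.radical_Comp_right[OF f u_Hom[OF X(1)]] uZ(1)])
        finally show ?thesis .
      qed
      then show ?case unfolding tpow.simps using K[OF idH[OF mods(2)]] by simp
    next
      case (Suc n)
      let ?T = "tpow n"
      note T = tpow_mod[OF mc, of n] and T' = tpow_mod[OF mc, of "Suc n", simplified]
      have IH: "ActA M (sl2_id ?T) f \<in> radical M (ActO M ?T X) (ActO M ?T Z)" if "f \<in> radical M X Z" for X Z f
        using Suc that K[OF idH[OF T]] by simp
      have "ActA M (sl2_id (sl2_tensor L1 ?T)) f
          \<in> radical M (ActO M (sl2_tensor L1 ?T) X) (ActO M (sl2_tensor L1 ?T) Z)"
        if f: "f \<in> radical M X Z" for X Z f
      proof -
        note F = M.radical_Hom[OF f]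
        have X: "X \<in> Obj M" "Z \<in> Obj M" using M.Hom_Obj[OF F] by simp_all
        note aZ = M.inv_of[OF as_iso[OF mods(1) T X(2)] as_Hom[OF mods(1) T X(2)]]
        have "as L1 ?T Z \<Zsemi> ActA M (sl2_id (sl2_tensor L1 ?T)) f = lift (ActA M (sl2_id ?T) f) \<Zsemi> as L1 ?T X"
          using ActAssoc_natural[OF idH[OF mods(1)] idH[OF T] F] C.TensA_Ide[of L1 ?T] T by (simp add: lift_def)
        then have "ActA M (sl2_id (sl2_tensor L1 ?T)) f
            = M.inv_of (as L1 ?T Z) \<Zsemi> lift (ActA M (sl2_id ?T) f) \<Zsemi> as L1 ?T X"
          using M.comp_cancel[OF aZ(2) as_Hom[OF mods(1) T X(2)] aZ(1) ActA_Hom[OF idH[OF T'] F]] by simp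
        also have "\<dots> \<in> radical M (ActO M (sl2_tensor L1 ?T) X) (ActO M (sl2_tensor L1 ?T) Z)"
          by (rule M.radical_Comp_left[OF M.radical_Comp_right[OF lift[OF IH[OF f]] as_Hom[OF mods(1) T X(1)]] aZ(1)])
        finally show ?thesis .
      qed
      then show ?case unfolding tpow.simps using K[OF idH[OF T']] by simp
    qed
  qed
  then show ?thesis using K[OF idH[OF V]] f by simp
qed

end

section \<open>Simple transitivity applied to the radical\<close>

theorem proposition20:
  fixes Y :: "(sl2_mod, sl2_hom, 'o, 'm) module_cat"
  assumes "module_category sl2_modules Y"
    and "locally_finitary Y"
    and "admissible Y"
    and "simple_transitive sl2_modules Y"
    and "type_D_infinity Y"
  shows "semisimple_category Y"
proof -
  interpret sl2_module_category Y
    using assms(1) by (simp add: sl2_module_category_def)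
  have split: "idempotent_split Y" and ks: "krull_schmidt Y"
    and fd: "\<And>X. X \<in> Obj Y \<Longrightarrow> vectorspace.fin_dim class_ring (hom_space Y X X)"
    using assms(2) by (auto simp: locally_finitary_def)
  obtain P :: "nat \<Rightarrow> 'o" where ind: "\<And>i. indecomposable Y (P i)"
    and dist: "\<And>i j. isomorphic Y (P i) (P j) \<Longrightarrow> i = j"
    and all: "\<And>X. indecomposable Y X \<Longrightarrow> \<exists>i. isomorphic Y X (P i)"
    and P01: "isomorphic Y (act (P 0)) (P 2)" "isomorphic Y (act (P 1)) (P 2)"
    and P2: "is_direct_sum Y (act (P 2)) [P 0, P 1, P 3]"
    and P3: "\<And>i. 3 \<le> i \<Longrightarrow> is_direct_sum Y (act (P i)) [P (i - 1), P (i + 1)]"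
    using assms(5) unfolding type_D_infinity_def by blast
  have loc: "M.local_obj (P i)" for i
    by (rule M.indecomposable_local[OF ind split ks])
  have ends: "isomorphic Y (act (P i)) (P 2)" if "i < 2" for i
    using that P01 by (auto simp: less_2_iff)
  interpret D: D_infinity Y act lift \<eta> \<epsilon> P
  proof
    fix i
    show "M.local_obj (P i)" by (rule loc)
    show "vectorspace.fin_dim class_ring (hom_space Y (P i) (P i))"
      using fd ind by (simp add: indecomposable_def)
    show "M.local_obj (act (P i))" if "i < 2"
      by (rule M.local_obj_isomorphic[OF ends[OF that] loc])
    show "is_direct_sum Y (act (P i)) (map P (neighbours i))"
      using M.isomorphic_direct_sum[OF ends[of i]] P2 P3[of i] by (auto simp: neighbours_def)
  qed (rule dist)
  \<comment> \<open>Local objects are indecomposable, hence isomorphic to members of the list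
    \<open>P\<close>; conjugating by such isomorphisms reduces to
    \<open>D.F1_preserves_radical\<close>.\<close>
  have lift_local: "lift f \<in> radical Y (act A) (act B)"
    if f: "f \<in> radical Y A B" and A: "M.local_obj A" and B: "M.local_obj B" for f A B
  proof -
    obtain i s s' where s: "s \<in> Hom Y A (P i)" "s' \<in> Hom Y (P i) A" "s' \<cdot>\<^bsub>Y\<^esub> s = Ide Y A"
      using all[OF M.local_indecomposable[OF A]] by (metis M.iso_obtain)
    obtain j t t' where t: "t \<in> Hom Y B (P j)" "t' \<in> Hom Y (P j) B" "t' \<cdot>\<^bsub>Y\<^esub> t = Ide Y B"
      using all[OF M.local_indecomposable[OF B]] by (metis M.iso_obtain)
    note F = M.radical_Hom[OF f]
    define g where "g = t \<cdot>\<^bsub>Y\<^esub> (f \<cdot>\<^bsub>Y\<^esub> s')"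
    have g: "g \<in> radical Y (P i) (P j)"
      unfolding g_def by (rule M.radical_Comp_left[OF M.radical_Comp_right[OF f s(2)] t(1)])
    note G = M.radical_Hom[OF g]
    have "f = (t' \<cdot>\<^bsub>Y\<^esub> t) \<cdot>\<^bsub>Y\<^esub> (f \<cdot>\<^bsub>Y\<^esub> (s' \<cdot>\<^bsub>Y\<^esub> s))"
      unfolding s(3) t(3) using M.Ide_left[OF F] M.Ide_right[OF F] by simp
    also have "\<dots> = t' \<cdot>\<^bsub>Y\<^esub> (g \<cdot>\<^bsub>Y\<^esub> s)"
      unfolding g_def using s(1,2) t(1,2) F by (simp add: M.Hom_iff M.cat_simps)
    finally have "lift f = lift t' \<cdot>\<^bsub>Y\<^esub> (lift g \<cdot>\<^bsub>Y\<^esub> lift s)"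
      using lift_Comp[OF M.Comp_Hom[OF s(1) G] t(2)] lift_Comp[OF s(1) G] by simp
    moreover have "lift g \<in> radical Y (act (P i)) (act (P j))"
      using D.F1_preserves_radical g by (simp add: D.F1_radical_def)
    ultimately show ?thesis
      using M.radical_Comp_left[OF M.radical_Comp_right[OF _ lift_Hom[OF s(1)]] lift_Hom[OF t(2)]] by simp
  qed
  \<comment> \<open>Krull-Schmidt decompositions of both ends reduce a radical morphism to its
    entries between local objects, which are radical again.\<close>
  have lift_radical: "lift f \<in> radical Y (act X) (act Z)" if f: "f \<in> radical Y X Z" for f X Z
  proof -
    note F = M.radical_Hom[OF f]
    have X: "X \<in> Obj Y" and Z: "Z \<in> Obj Y" using M.Hom_Obj[OF F] by simp_all
    obtain As where "is_direct_sum Y X As" and As: "\<forall>A \<in> set As. local_ring (end_ring Y A)"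
      using ks X unfolding krull_schmidt_def by blast
    then obtain i p where bX: "M.biproduct X As i p" unfolding M.is_direct_sum_iff by blast
    obtain Bs where "is_direct_sum Y Z Bs" and Bs: "\<forall>A \<in> set Bs. local_ring (end_ring Y A)"
      using ks Z unfolding krull_schmidt_def by blast
    then obtain i' p' where bZ: "M.biproduct Z Bs i' p'" unfolding M.is_direct_sum_iff by blast
    note mX = M.biproduct_maps[OF bX] and mZ = M.biproduct_maps[OF bZ]
    have closed: "M.add_closed U V {h \<in> Hom Y U V. lift h \<in> radical Y (act U) (act V)}"
      if "U \<in> Obj Y" "V \<in> Obj Y" for U V
      using that adj.F1_Zero[OF that] act_Obj
      by (auto simp: M.add_closed_def M.Zero_Hom M.Add_Hom M.radical_Zero adj.F1_Add M.radical_Add)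
    have "f \<in> {h \<in> Hom Y X Z. lift h \<in> radical Y (act X) (act Z)}"
    proof (rule M.biproduct_mem_right[OF bX F closed[OF X Z]])
      fix j assume j: "j < length As"
      let ?A = "As ! j"
      define g where "g = f \<cdot>\<^bsub>Y\<^esub> i j"
      have g: "g \<in> radical Y ?A Z" unfolding g_def by (rule M.radical_Comp_right[OF f mX(1)[OF j]])
      note G = M.radical_Hom[OF g]
      have A: "M.local_obj ?A" using M.local_objI[OF mX(3)[OF j]] As j by simp
      have "g \<in> {h \<in> Hom Y ?A Z. lift h \<in> radical Y (act ?A) (act Z)}"
      proof (rule M.biproduct_mem_left[OF bZ G closed[OF mX(3)[OF j] Z]])
        fix k assume k: "k < length Bs"
        have B: "M.local_obj (Bs ! k)" using M.local_objI[OF mZ(3)[OF k]] Bs k by simp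
        note pg = M.radical_Comp_left[OF g mZ(2)[OF k]]
        note PG = M.radical_Hom[OF pg]
        have "lift (p' k \<cdot>\<^bsub>Y\<^esub> g) \<in> radical Y (act ?A) (act (Bs ! k))"
          by (rule lift_local[OF pg A B])
        then show "i' k \<cdot>\<^bsub>Y\<^esub> (p' k \<cdot>\<^bsub>Y\<^esub> g) \<in> {h \<in> Hom Y ?A Z. lift h \<in> radical Y (act ?A) (act Z)}"
          using M.Comp_Hom[OF PG mZ(1)[OF k]] lift_Comp[OF PG mZ(1)[OF k]]
            M.radical_Comp_left lift_Hom[OF mZ(1)[OF k]] by simp
      qed
      then have "lift g \<in> radical Y (act ?A) (act Z)" by simp
      then show "(f \<cdot>\<^bsub>Y\<^esub> i j) \<cdot>\<^bsub>Y\<^esub> p j \<in> {h \<in> Hom Y X Z. lift h \<in> radical Y (act X) (act Z)}"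
        using M.Comp_Hom[OF mX(2)[OF j] G] lift_Comp[OF mX(2)[OF j] G]
          M.radical_Comp_right lift_Hom[OF mX(2)[OF j]] by (simp add: g_def)
    qed
    then show ?thesis by simp
  qed
  have "invariant_ideal sl2_modules Y (radical Y)"
    using M.radical_category_ideal actA_radical[OF lift_radical] by (simp add: invariant_ideal_def)
  then consider "\<forall>X \<in> Obj Y. \<forall>Z \<in> Obj Y. radical Y X Z = {Zero Y X Z}"
    | "\<forall>X \<in> Obj Y. \<forall>Z \<in> Obj Y. radical Y X Z = Hom Y X Z"
    using assms(4) unfolding simple_transitive_def by blast
  then show ?thesis
  proof cases
    case 1
    then show ?thesis by (simp add: semisimple_category_def)
  next
    case 2
    have "P 0 \<in> Obj Y" using ind by (simp add: indecomposable_def)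
    then show ?thesis
      using 2 M.local_radical_end_iff[OF loc M.Ide_Hom] M.unit_at_Ide M.Ide_Hom by blast
  qed
qed

end
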